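(* For every $(\lambda^{(1)}|\cdots|\lambda^{(r)})\in\mathrm{Par}^r$, $$\mathcal{S}_{(\lambda^{(1)}|\cdots|\lambda^{(r)})}=m_{(\lambda^{(1)}|\cdots|\lambda^{(r)})}+\sum_{(\mu^{(1)}|\cdots|\mu^{(r)})\triangleleft(\lambda^{(1)}|\cdots|\lambda^{(r)})}K^{(\lambda^{(1)}|\cdots|\lambda^{(r)})}_{(\mu^{(1)}|\cdots|\mu^{(r)})}\,m_{(\mu^{(1)}|\cdots|\mu^{(r)})},$$ and every Kostka coefficient $K^{(\lambda)}_{(\mu)}$ appearing in this sum (i.e. for every $(\mu)\triangleleft(\lambda)$) is nonzero.
   Context: Key polynomials $\mathcal{K}_\alpha$ ($\alpha\in\mathbb{Z}_{\ge0}^n$): unique polynomials with $\mathcal{K}_\alpha=x^\alpha$ if $\alpha$ weakly decreasing and $\mathcal{K}_{s_i\alpha}=\xi_i\mathcal{K}_\alpha$ whenever $\alpha_i>\alpha_{i+1}$, where $\xi_if=\frac{x_if-x_{i+1}s_if}{x_i-x_{i+1}}$. $\mathrm{rev}(\lambda)=(\lambda_{\ell(\lambda)},\dots,\lambda_1)$, $*$ concatenation, $0^m$ $m$ zeros. $\mathcal{S}_{(\lambda^{(1)}|\cdots|\lambda^{(r)})}(X_1|\cdots|X_r)$ is the coefficientwise limit as all $n_i\to\infty$ of $\mathcal{K}_\gamma(x_{1,1},\dots,x_{1,n_1},\dots,x_{r,1},\dots,x_{r,n_r})$, $\gamma=(0^{n_1-\ell(\lambda^{(1)})}*\mathrm{rev}(\lambda^{(1)}))*\cdots*(0^{n_r-\ell(\lambda^{(r)})}*\mathrm{rev}(\lambda^{(r)}))$,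 an element of $\Lambda(X_1)\otimes\cdots\otimes\Lambda(X_r)$. $m_{(\mu^{(1)}|\cdots|\mu^{(r)})}=m_{\mu^{(1)}}(X_1)\cdots m_{\mu^{(r)}}(X_r)$, and $K^{(\lambda)}_{(\mu)}$ are the coefficients of $\mathcal{S}_{(\lambda)}$ in this basis. Order $\triangleleft$ on $\mathrm{Par}^r$ (partitions padded with infinitely many zeros): $(\mu)\triangleleft(\lambda)$ if $(\mu)$ is obtained from $(\lambda)$ by a nonempty finite sequence of the following moves on $(\nu^{(1)}|\cdots|\nu^{(r)})$: Move 1: if $\nu^{(i_1)}_{j_1}<\nu^{(i_2)}_{j_2}$ with $i_1<i_2$, swap these two entries and re-sort each partition; Move 2: if $\nu^{(i)}_j>\nu^{(i)}_k+1$ with $j<k$, replace $\nu^{(i)}$ by $\nu^{(i)}+e_k-e_j$ and re-sort; Move 3: if $\nu^{(i_1)}_{j_1}+1<\nu^{(i_2)}_{j_2}$ with $i_1<i_2$, replace these entries by $\nu^{(i_1)}_{j_1}+1$ and $\nu^{(i_2)}_{j_2}-1$ respectively and re-sort each partition. *)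

theory Defs
  imports
    "HOL-Library.Poly_Mapping"
    "HOL-Library.Multiset"
    "HOL-Combinatorics.Transposition"
begin

section \<open>Polynomials\<close>

text \<open>A monomial is a finitely supported exponent function, and a polynomial is a finitely
  supported coefficient function on monomials. Addition and multiplication are those of
  HOL-Library.Poly_Mapping.\<close>

type_synonym 'v monom = "'v \<Rightarrow>\<^sub>0 nat"
type_synonym 'v mpoly = "'v monom \<Rightarrow>\<^sub>0 int"

definition Var :: "'v \<Rightarrow> 'v mpoly" where
  "Var v = Poly_Mapping.single (Poly_Mapping.single v 1) 1"

definition Const :: "int \<Rightarrow> 'v mpoly" where
  "Const c = Poly_Mapping.single 0 c"

definition subst :: "('v \<Rightarrow> 'w mpoly) \<Rightarrow> 'v mpoly \<Rightarrow> 'w mpoly" where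
  "subst \<sigma> p = (\<Sum>m \<in> Poly_Mapping.keys p. Const (Poly_Mapping.lookup p m) *
      (\<Prod>v \<in> Poly_Mapping.keys m. \<sigma> v ^ Poly_Mapping.lookup m v))"

section \<open>Key polynomials\<close>

text \<open>A composition in \<open>n\<close> entries is a list of length \<open>n\<close>, indexed from \<open>0\<close>; its key polynomial
  is a polynomial in the variables \<open>Var 0, \<dots>, Var (n - 1)\<close>.\<close>

definition swap_vars :: "nat \<Rightarrow> nat mpoly \<Rightarrow> nat mpoly" where
  "swap_vars i f = subst (\<lambda>k. Var (transpose i (Suc i) k)) f"

text \<open>The quotient of \<open>x\<^sub>i f - x\<^sub>i\<^sub>+\<^sub>1 s\<^sub>i f\<close> by \<open>x\<^sub>i - x\<^sub>i\<^sub>+\<^sub>1\<close>, an exact division in the polynomial ring.\<close>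

definition xi :: "nat \<Rightarrow> nat mpoly \<Rightarrow> nat mpoly" where
  "xi i f = (THE g. (Var i - Var (Suc i)) * g = Var i * f - Var (Suc i) * swap_vars i f)"

definition is_key_family :: "(nat list \<Rightarrow> nat mpoly) \<Rightarrow> bool" where
  "is_key_family K \<longleftrightarrow>
     (\<forall>\<alpha>. sorted_wrt (\<ge>) \<alpha> \<longrightarrow> K \<alpha> = (\<Prod>k<length \<alpha>. Var k ^ (\<alpha> ! k))) \<and>
     (\<forall>\<alpha> i. Suc i < length \<alpha> \<and> \<alpha> ! i > \<alpha> ! Suc i \<longrightarrow>
        K (\<alpha>[i := \<alpha> ! Suc i, Suc i := \<alpha> ! i]) = xi i (K \<alpha>))"

definition key_poly :: "nat list \<Rightarrow> nat mpoly" where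
  "key_poly = (THE K. is_key_family K)"

section \<open>Tuples of partitions\<close>

definition is_partition :: "nat list \<Rightarrow> bool" where
  "is_partition p \<longleftrightarrow> sorted_wrt (\<ge>) p \<and> 0 \<notin> set p"

definition Par :: "nat \<Rightarrow> nat list list set" where
  "Par r = {ps. length ps = r \<and> (\<forall>p \<in> set ps. is_partition p)}"

section \<open>The multi-symmetric series\<close>

text \<open>Formal power series in the variables \<open>x\<^sub>i\<^sub>,\<^sub>j\<close>, given by their coefficients. The variable
  \<open>(i, j)\<close> is the \<open>j\<close>-th variable of the alphabet \<open>X\<^sub>i\<close>; both indices start at \<open>0\<close>.\<close>

type_synonym series = "(nat \<times> nat) monom \<Rightarrow> int"

definition block_vars :: "nat \<Rightarrow> (nat \<Rightarrow> nat) \<Rightarrow> (nat \<times> nat) list" where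
  "block_vars r n = [(i, j). i \<leftarrow> [0..<r], j \<leftarrow> [0..<n i]]"

text \<open>The following has length \<open>n 0 + \<dots> + n (r - 1)\<close> only if every \<open>n i\<close> is at least the length
  of the \<open>i\<close>-th partition, which is all that matters in the limit below.\<close>

definition block_comp :: "nat list list \<Rightarrow> (nat \<Rightarrow> nat) \<Rightarrow> nat list" where
  "block_comp lam n =
     concat (map (\<lambda>i. replicate (n i - length (lam ! i)) 0 @ rev (lam ! i)) [0..<length lam])"

definition block_key :: "nat list list \<Rightarrow> (nat \<Rightarrow> nat) \<Rightarrow> (nat \<times> nat) mpoly" where
  "block_key lam n =
     subst (\<lambda>k. Var (block_vars (length lam) n ! k)) (key_poly (block_comp lam n))"

text \<open>Coefficients are integers, so the limit of a coefficient is its eventual value.\<close>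

definition multi_S :: "nat list list \<Rightarrow> series" where
  "multi_S lam = (\<lambda>M. THE c. \<exists>N. \<forall>n. (\<forall>i<length lam. N \<le> n i) \<longrightarrow>
      Poly_Mapping.lookup (block_key lam n) M = c)"

section \<open>Monomial basis and Kostka coefficients\<close>

text \<open>The Cauchy product; a monomial has only finitely many factorizations.\<close>

definition series_times :: "series \<Rightarrow> series \<Rightarrow> series" where
  "series_times f g = (\<lambda>M. \<Sum>(A, B) \<in> {(A, B). A + B = M}. f A * g B)"

definition series_one :: series where
  "series_one = (\<lambda>M. if M = 0 then 1 else 0)"

text \<open>\<open>m\<^sub>\<mu>(X\<^sub>i)\<close>, the sum of all distinct monomials in \<open>X\<^sub>i\<close> whose nonzero exponents are the parts
  of \<open>\<mu>\<close> in some order.\<close>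

definition mono_sym :: "nat \<Rightarrow> nat list \<Rightarrow> series" where
  "mono_sym i mu = (\<lambda>M.
     if Poly_Mapping.keys M \<subseteq> {i} \<times> UNIV \<and>
        image_mset (Poly_Mapping.lookup M) (mset_set (Poly_Mapping.keys M)) = mset mu
     then 1 else 0)"

definition multi_m :: "nat list list \<Rightarrow> series" where
  "multi_m mu = foldr series_times (map (\<lambda>i. mono_sym i (mu ! i)) [0..<length mu]) series_one"

definition kostka :: "nat list list \<Rightarrow> (nat list list \<Rightarrow>\<^sub>0 int)" where
  "kostka lam = (THE c. Poly_Mapping.keys c \<subseteq> Par (length lam) \<and>
     multi_S lam = (\<lambda>M. \<Sum>mu \<in> Poly_Mapping.keys c. Poly_Mapping.lookup c mu * multi_m mu M))"

section \<open>The order on tuples of partitions\<close>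

definition part :: "nat list \<Rightarrow> nat \<Rightarrow> nat" where
  "part p j = (if j < length p then p ! j else 0)"

definition set_part :: "nat list \<Rightarrow> nat \<Rightarrow> nat \<Rightarrow> nat list" where
  "set_part p j v = (p @ replicate (Suc j - length p) 0)[j := v]"

definition resort :: "nat list \<Rightarrow> nat list" where
  "resort p = rev (sort (filter (\<lambda>v. v > 0) p))"

inductive move :: "nat list list \<Rightarrow> nat list list \<Rightarrow> bool" where
  move1: "\<lbrakk>i1 < i2; i2 < length nu; part (nu ! i1) j1 < part (nu ! i2) j2\<rbrakk> \<Longrightarrow>
    move nu (nu[i1 := resort (set_part (nu ! i1) j1 (part (nu ! i2) j2)),
                i2 := resort (set_part (nu ! i2) j2 (part (nu ! i1) j1))])"
| move2: "\<lbrakk>i < length nu; j < k; part (nu ! i) j > part (nu ! i) k + 1\<rbrakk> \<Longrightarrow>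
    move nu (nu[i := resort (set_part (set_part (nu ! i) j (part (nu ! i) j - 1))
                                      k (part (nu ! i) k + 1))])"
| move3: "\<lbrakk>i1 < i2; i2 < length nu; part (nu ! i1) j1 + 1 < part (nu ! i2) j2\<rbrakk> \<Longrightarrow>
    move nu (nu[i1 := resort (set_part (nu ! i1) j1 (part (nu ! i1) j1 + 1)),
                i2 := resort (set_part (nu ! i2) j2 (part (nu ! i2) j2 - 1))])"

definition tri_less :: "nat list list \<Rightarrow> nat list list \<Rightarrow> bool" (infix "\<lhd>" 50) where
  "mu \<lhd> lam \<longleftrightarrow> move\<^sup>+\<^sup>+ lam mu"

end

(*
The branching rule.  If the last entry of a composition is a, process the values v = 0, ..., a - 1
in this order and at each step either contribute a factor x_n, or replace the rightmost entry v
among the others by v + 1; the key polynomial is the sum over all choices of these factors times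
the key polynomial of what remains, in the variables before x_n.  The polynomials defined by this
recursion satisfy K_{s_i alpha} = xi_i K_alpha: for i < n - 1 because sorting at i commutes with
every bump, and for the last two variables because the transfer operators
(y + u_{a-1}) ... (y + u_0) for different y commute, the bumps u_v satisfying the local plactic
relations.  The rule is manifestly positive.

The support.  The support of K_alpha is the closure of alpha under the moves "exchange an ascent"
and "transfer a unit between two entries p < q with alpha_p + 1 < alpha_q".  It is contained in the
closure since xi_i stays inside i-strings and the closure of an i-ascending composition is
s_i-stable.  Conversely, the pairs (composition after bumping, number of unused values) are closed
under the moves which involve the last entry: adding the smallest unused value above the entry to be
raised to the bumped values raises it, up to moves.

The limit.  Setting x_k = 0 where alpha_k = 0 deletes the entry, so the coefficients stabilise.  For
large blocks the moves on compositions induce exactly the moves on tuples of partitions, and the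
leading coefficient is 1.
*)
theory Submission
  imports Defs
begin

section \<open>Substitution in polynomials\<close>

text \<open>The recursion through \<open>xi\<close> subtracts, so it bounds a support from above but
  cannot exclude cancellation. Nonvanishing needs a formula with positive terms only; this is why
  the branching rule is developed, and why the two inclusions for the support have unrelated proofs.
  The delicate point is the rigidity of a bump sequence: values increase and each bump hits the
  rightmost occurrence, so an additional unit usually lands on another entry than the intended one.
  In the limit, a new variable enters at the end of its alphabet, while the new zero of the
  composition enters at the front of its block. Symmetry of the polynomial inside a block, where the
  composition ascends, reconciles the two. The key family, the quotient in \<open>xi\<close>, the
  limit and the Kostka coefficients are all given by definite descriptions, so existence and
  uniqueness are established for each.\<close>

abbreviation coeff_of :: "'v mpoly \<Rightarrow> 'v monom \<Rightarrow> int" where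
  "coeff_of \<equiv> Poly_Mapping.lookup"

abbreviation expo :: "'v monom \<Rightarrow> 'v \<Rightarrow> nat" where
  "expo \<equiv> Poly_Mapping.lookup"

lemma mpoly_induct [case_names zero add]:
  fixes p :: "'a \<Rightarrow>\<^sub>0 'b::comm_monoid_add"
  assumes "P 0" and "\<And>m c p. P p \<Longrightarrow> P (Poly_Mapping.single m c + p)"
  shows "P p"
proof (induction p rule: Poly_Mapping.update_induct)
  case const
  then show ?case by (rule assms)
next
  case (update f a b)
  have "Poly_Mapping.update a b f = Poly_Mapping.single a b + f"
    using update(1)
    by (intro poly_mapping_eqI)
      (auto simp: lookup_add lookup_update lookup_single not_in_keys_iff_lookup_eq_zero when_def)
  with update assms(2) show ?case by simp
qed

definition subst_monom :: "('v \<Rightarrow> 'w mpoly) \<Rightarrow> 'v monom \<Rightarrow> 'w mpoly" where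
  "subst_monom \<sigma> m = (\<Prod>v \<in> Poly_Mapping.keys m. \<sigma> v ^ expo m v)"

lemma subst_monom_superset:
  "finite A \<Longrightarrow> Poly_Mapping.keys m \<subseteq> A \<Longrightarrow> subst_monom \<sigma> m = (\<Prod>v\<in>A. \<sigma> v ^ expo m v)"
  unfolding subst_monom_def
  by (rule prod.mono_neutral_left) (auto simp: not_in_keys_iff_lookup_eq_zero)

lemma subst_monom_add: "subst_monom \<sigma> (m + m') = subst_monom \<sigma> m * subst_monom \<sigma> m'"
proof -
  let ?A = "Poly_Mapping.keys m \<union> Poly_Mapping.keys m'"
  have "Poly_Mapping.keys (m + m') \<subseteq> ?A" by (rule Poly_Mapping.keys_add)
  then show ?thesis
    by (simp add: subst_monom_superset[of ?A] lookup_add power_add prod.distrib)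
qed

lemma subst_monom_zero [simp]: "subst_monom \<sigma> 0 = 1"
  by (simp add: subst_monom_def)

lemma Const_add: "Const (a + b) = Const a + Const b"
  by (simp add: Const_def single_add)

lemma Const_zero [simp]: "Const 0 = 0"
  by (simp add: Const_def)

lemma Const_mult: "Const (a * b) = Const a * Const b"
  by (simp add: Const_def mult_single)

lemma Const_one [simp]: "Const 1 = 1"
  by (simp add: Const_def)

lemma subst_superset:
  "finite A \<Longrightarrow> Poly_Mapping.keys p \<subseteq> A \<Longrightarrow>
    subst \<sigma> p = (\<Sum>m\<in>A. Const (coeff_of p m) * subst_monom \<sigma> m)"
  unfolding subst_def subst_monom_def
  by (rule sum.mono_neutral_left) (auto simp: not_in_keys_iff_lookup_eq_zero)

lemma subst_add: "subst \<sigma> (p + q) = subst \<sigma> p + subst \<sigma> q"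
proof -
  let ?A = "Poly_Mapping.keys p \<union> Poly_Mapping.keys q"
  have "Poly_Mapping.keys (p + q) \<subseteq> ?A" by (rule Poly_Mapping.keys_add)
  then show ?thesis
    by (simp add: subst_superset[of ?A] lookup_add Const_add distrib_right sum.distrib)
qed

lemma subst_zero [simp]: "subst \<sigma> 0 = 0"
  by (simp add: subst_def)

lemma subst_single: "subst \<sigma> (Poly_Mapping.single m c) = Const c * subst_monom \<sigma> m"
  by (subst subst_superset[of "{m}"]) auto

lemma subst_one [simp]: "subst \<sigma> 1 = 1"
  using subst_single[of \<sigma> 0 1] unfolding single_one by simp

lemma subst_Var [simp]: "subst \<sigma> (Var v) = \<sigma> v"
  by (simp add: Var_def subst_single subst_monom_def)

lemma subst_mult: "subst \<sigma> (p * q) = subst \<sigma> p * subst \<sigma> q"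
proof (induction p rule: mpoly_induct)
  case (add m c p)
  have "subst \<sigma> (Poly_Mapping.single m c * q) = subst \<sigma> (Poly_Mapping.single m c) * subst \<sigma> q"
  proof (induction q rule: mpoly_induct)
    case (add m' c' q)
    then show ?case
      by (simp add: distrib_left subst_add mult_single subst_single subst_monom_add Const_mult mult_ac)
  qed simp
  with add show ?case by (simp add: distrib_right subst_add)
qed simp

lemma subst_diff: "subst \<sigma> (p - q) = subst \<sigma> p - subst \<sigma> q"
  by (metis (no_types, lifting) add_diff_cancel diff_add_cancel subst_add)

text \<open>Subtraction of exponents is truncated, hence the explicit divisibility test.\<close>

lemma coeff_single_times:
  fixes p :: "'v mpoly"
  shows "coeff_of (Poly_Mapping.single k c * p) m =
    (if \<exists>m'. m = k + m' then c * coeff_of p (m - k) else 0)"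
proof -
  have eq: "coeff_of (Poly_Mapping.single k c * p) m = c * (\<Sum>q. coeff_of p q when m = k + q)"
    by (simp add: lookup_mult lookup_single when_mult)
  show ?thesis
  proof (cases "\<exists>m'. m = k + m'")
    case True
    then obtain m' where m: "m = k + m'" by blast
    then have "(\<Sum>q. coeff_of p q when m = k + q) = (\<Sum>q. coeff_of p q when q = m')"
      by (intro Sum_any.cong) (auto simp: when_def)
    with eq m show ?thesis by simp
  qed (simp add: eq)
qed

lemma monom_single_factor:
  "(\<exists>m'. m = Poly_Mapping.single v 1 + m') \<longleftrightarrow> expo (m :: 'v monom) v > 0"
proof
  assume "expo m v > 0"
  then have "m = Poly_Mapping.single v 1 + (m - Poly_Mapping.single v 1)"
    by (intro poly_mapping_eqI) (auto simp: lookup_add lookup_minus lookup_single when_def)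
  then show "\<exists>m'. m = Poly_Mapping.single v 1 + m'" by blast
qed (auto simp: lookup_add)

lemma coeff_Var_times:
  "coeff_of (Var v * p) m =
    (if expo m v > 0 then coeff_of p (m - Poly_Mapping.single v 1) else 0)"
  unfolding Var_def coeff_single_times monom_single_factor by simp

lemma coeff_Var_power_times:
  "coeff_of (Var v ^ k * p) m =
    (if expo m v \<ge> k then coeff_of p (m - Poly_Mapping.single v k) else 0)"
proof (induction k arbitrary: m)
  case (Suc k)
  have "m - Poly_Mapping.single v 1 - Poly_Mapping.single v k = m - Poly_Mapping.single v (Suc k)"
    by (intro poly_mapping_eqI) (auto simp: lookup_minus lookup_single when_def)
  then show ?case
    by (auto simp: mult.assoc coeff_Var_times Suc lookup_minus)
qed simp

lemma Var_eq_iff: "(Var v :: 'v mpoly) = Var w \<longleftrightarrow> v = w"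
proof
  assume "(Var v :: 'v mpoly) = Var w"
  then have "coeff_of (Var v) (Poly_Mapping.single v 1) = coeff_of (Var w) (Poly_Mapping.single v 1)"
    by simp
  then have "Poly_Mapping.single v (1::nat) = Poly_Mapping.single w 1"
    by (simp add: Var_def lookup_single when_def split: if_splits)
  then have "expo (Poly_Mapping.single v 1) v = expo (Poly_Mapping.single w 1) v"
    by simp
  then show "v = w" by (simp add: lookup_single when_def split: if_splits)
qed simp

section \<open>Bump operators\<close>

definition is_last :: "nat \<Rightarrow> nat \<Rightarrow> (nat \<Rightarrow> nat) \<Rightarrow> nat \<Rightarrow> bool" where
  "is_last n v f i \<longleftrightarrow> i < n \<and> f i = v \<and> (\<forall>j. i < j \<and> j < n \<longrightarrow> f j \<noteq> v)"

definition bump :: "nat \<Rightarrow> nat \<Rightarrow> (nat \<Rightarrow> nat) \<Rightarrow> nat \<Rightarrow> nat" where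
  "bump n v f = f((THE i. is_last n v f i) := Suc v)"

text \<open>Compositions are functions on \<open>{..<n}\<close>, extended arbitrarily.  Operators act on functions
  \<open>F\<close> of a composition, hence contravariantly: in \<open>bump_op n v (bump_op n w F)\<close> the value \<open>v\<close>
  is bumped first.\<close>

definition bump_op :: "nat \<Rightarrow> nat \<Rightarrow> ((nat \<Rightarrow> nat) \<Rightarrow> 'a::comm_ring_1) \<Rightarrow> (nat \<Rightarrow> nat) \<Rightarrow> 'a" where
  "bump_op n v F f = (if \<exists>i<n. f i = v then F (bump n v f) else 0)"

definition step_op :: "nat \<Rightarrow> 'a \<Rightarrow> nat \<Rightarrow> ((nat \<Rightarrow> nat) \<Rightarrow> 'a::comm_ring_1) \<Rightarrow> (nat \<Rightarrow> nat) \<Rightarrow> 'a" where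
  "step_op n z v F f = z * F f + bump_op n v F f"

text \<open>In terms of the bumps u_v this is the product of the factors z + u_v for v < a, with v =
  0 acting first on the composition: the generating function of the elementary symmetric functions
  in the noncommuting u_0, ..., u_(a-1).\<close>

fun row_op :: "nat \<Rightarrow> 'a \<Rightarrow> nat \<Rightarrow> ((nat \<Rightarrow> nat) \<Rightarrow> 'a::comm_ring_1) \<Rightarrow> (nat \<Rightarrow> nat) \<Rightarrow> 'a" where
  "row_op n z 0 F = F"
| "row_op n z (Suc a) F = row_op n z a (step_op n z a F)"

fun bump_poly :: "nat \<Rightarrow> (nat \<Rightarrow> nat) \<Rightarrow> nat mpoly" where
  "bump_poly 0 f = 1"
| "bump_poly (Suc n) f = row_op n (Var n) (f n) (bump_poly n) f"

lemma is_last_unique: "is_last n v f i \<Longrightarrow> is_last n v f j \<Longrightarrow> i = j"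
  unfolding is_last_def by (metis linorder_neqE_nat)

lemma is_last_ex: "\<exists>i<n. f i = v \<Longrightarrow> \<exists>i. is_last n v f i"
proof (induction n)
  case (Suc n)
  show ?case
  proof (cases "f n = v")
    case True
    then have "is_last (Suc n) v f n" by (auto simp: is_last_def)
    then show ?thesis by blast
  next
    case False
    with Suc.prems have "\<exists>i<n. f i = v" by (metis less_Suc_eq)
    with Suc.IH obtain i where "is_last n v f i" by blast
    with False have "is_last (Suc n) v f i" by (auto simp: is_last_def less_Suc_eq)
    then show ?thesis by blast
  qed
qed simp

lemma bump_eq: "is_last n v f i \<Longrightarrow> bump n v f = f(i := Suc v)"
  unfolding bump_def using is_last_unique by (metis the_equality)

lemma bump_op_eq: "is_last n v f i \<Longrightarrow> bump_op n v F f = F (f(i := Suc v))"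
  unfolding bump_op_def by (auto simp: bump_eq) (auto simp: is_last_def)

lemma bump_op_none: "(\<And>i. i < n \<Longrightarrow> f i \<noteq> v) \<Longrightarrow> bump_op n v F f = 0"
  by (auto simp: bump_op_def)

lemma last_cases:
  obtains (none) "\<And>i. i < n \<Longrightarrow> f i \<noteq> v" | (last) i where "is_last n v f i"
  using is_last_ex by blast

lemma bump_op_add: "bump_op n v (\<lambda>f. F f + G f) = (\<lambda>f. bump_op n v F f + bump_op n v G f)"
  by (rule ext) (auto simp: bump_op_def)

lemma bump_op_scale: "bump_op n v (\<lambda>f. c * F f) = (\<lambda>f. c * bump_op n v F f)"
  by (rule ext) (auto simp: bump_op_def)

lemma step_op_add: "step_op n z v (\<lambda>f. F f + G f) = (\<lambda>f. step_op n z v F f + step_op n z v G f)"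
  by (rule ext) (auto simp: step_op_def bump_op_add algebra_simps)

lemma step_op_scale: "step_op n z v (\<lambda>f. c * F f) = (\<lambda>f. c * step_op n z v F f)"
  by (rule ext) (auto simp: step_op_def bump_op_scale algebra_simps)

lemma row_op_add: "row_op n z a (\<lambda>f. F f + G f) = (\<lambda>f. row_op n z a F f + row_op n z a G f)"
  by (induction a arbitrary: F G) (auto simp: step_op_add)

lemma row_op_scale: "row_op n z a (\<lambda>f. c * F f) = (\<lambda>f. c * row_op n z a F f)"
  by (induction a arbitrary: F) (auto simp: step_op_scale)

text \<open>Bumping v removes one v and creates one v + 1. It can influence a bump of w only if w is
  one of these two values, and conversely.\<close>

lemma bump_op_commute:
  assumes "v \<noteq> w" "Suc v \<noteq> w" "Suc w \<noteq> v"
  shows "bump_op n v (bump_op n w F) = bump_op n w (bump_op n v F)"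
proof
  fix f
  show "bump_op n v (bump_op n w F) f = bump_op n w (bump_op n v F) f"
  proof (cases n f v rule: last_cases)
    case none
    show ?thesis
    proof (cases n f w rule: last_cases)
      case none2: (last j)
      have "bump_op n v F (f(j := Suc w)) = 0"
        using none assms by (intro bump_op_none) auto
      then show ?thesis using none none2 by (simp add: bump_op_none bump_op_eq)
    qed (simp add: none bump_op_none)
  next
    case (last i)
    show ?thesis
    proof (cases n f w rule: last_cases)
      case none
      have "bump_op n w F (f(i := Suc v)) = 0"
        using none assms by (intro bump_op_none) auto
      then show ?thesis using none last by (simp add: bump_op_none bump_op_eq)
    next
      case l2: (last j)
      have ij: "i \<noteq> j" using last l2 assms by (auto simp: is_last_def)
      have "is_last n w (f(i := Suc v)) j" "is_last n v (f(j := Suc w)) i"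
        using last l2 ij assms by (auto simp: is_last_def)
      then show ?thesis using last l2 ij by (simp add: bump_op_eq fun_upd_twist)
    qed
  qed
qed

text \<open>The next two relations are the local plactic relations of Fomin and Greene.\<close>

lemma bump_op_plactic_up:
  "bump_op n v (bump_op n (Suc v) (bump_op n (Suc v) F)) =
   bump_op n (Suc v) (bump_op n v (bump_op n (Suc v) F))"
proof
  fix f
  let ?w = "Suc v"
  show "bump_op n v (bump_op n ?w (bump_op n ?w F)) f = bump_op n ?w (bump_op n v (bump_op n ?w F)) f"
  proof (cases n f v rule: last_cases)
    case none
    have "bump_op n ?w (bump_op n v (bump_op n ?w F)) f = 0"
    proof (cases n f ?w rule: last_cases)
      case (last j)
      have "bump_op n v (bump_op n ?w F) (f(j := Suc ?w)) = 0"
        using none by (intro bump_op_none) auto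
      then show ?thesis using last by (simp add: bump_op_eq)
    qed (simp add: bump_op_none)
    then show ?thesis using none by (simp add: bump_op_none)
  next
    case p: (last p)
    show ?thesis
    proof (cases n f ?w rule: last_cases)
      case none
      have 1: "is_last n ?w (f(p := ?w)) p"
        using p none by (auto simp: is_last_def)
      have "bump_op n ?w F (f(p := Suc ?w)) = 0"
        using p none by (intro bump_op_none) (auto simp: is_last_def)
      with 1 p none show ?thesis by (simp add: bump_op_eq bump_op_none)
    next
      case q: (last q)
      have pq: "p \<noteq> q" using p q by (auto simp: is_last_def)
      have 0: "is_last n v (f(q := Suc ?w)) p" using p q pq by (auto simp: is_last_def)
      have rhs: "bump_op n ?w (bump_op n v (bump_op n ?w F)) f =
          bump_op n ?w F (f(q := Suc ?w, p := ?w))"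
        using q 0 by (simp add: bump_op_eq)
      \<comment> \<open>If \<open>p < q\<close>, the first two bumps lead to the same composition on
        both sides. Otherwise both sides end up having raised \<open>p\<close> twice and
        \<open>q\<close> once.\<close>
      show ?thesis
      proof (cases "p < q")
        case True
        have 1: "is_last n ?w (f(p := ?w)) q" using p q True by (auto simp: is_last_def)
        show ?thesis unfolding rhs using p 1 pq by (simp add: bump_op_eq fun_upd_twist)
      next
        case False
        have 1: "is_last n ?w (f(p := ?w)) p" using p q False pq by (auto simp: is_last_def)
        have 2: "is_last n ?w (f(p := Suc ?w)) q" using p q pq by (auto simp: is_last_def)
        have 3: "is_last n ?w (f(q := Suc ?w, p := ?w)) p"
          using p q False pq by (auto simp: is_last_def)
        show ?thesis unfolding rhs using p 1 2 3 pq by (simp add: bump_op_eq fun_upd_twist)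
      qed
    qed
  qed
qed

lemma bump_op_plactic_down:
  "bump_op n v (bump_op n (Suc v) (bump_op n v F)) =
   bump_op n v (bump_op n v (bump_op n (Suc v) F))"
proof
  fix f
  let ?w = "Suc v"
  show "bump_op n v (bump_op n ?w (bump_op n v F)) f = bump_op n v (bump_op n v (bump_op n ?w F)) f"
  proof (cases n f v rule: last_cases)
    case none
    then show ?thesis by (simp add: bump_op_none)
  next
    case p: (last p)
    have "\<exists>i<n. (f(p := ?w)) i = ?w" using p by (auto simp: is_last_def)
    then obtain m where m: "is_last n ?w (f(p := ?w)) m" using is_last_ex by blast
    show ?thesis
    proof (cases n "f(p := ?w)" v rule: last_cases)
      case none
      have "bump_op n v F (f(p := ?w, m := Suc ?w)) = 0"
        using none m by (intro bump_op_none) (auto simp: is_last_def)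
      then show ?thesis using p m none by (simp add: bump_op_eq bump_op_none)
    next
      case q: (last q)
      \<comment> \<open>The next v lies to the left of \<open>p\<close>, hence to the left of the
        last v + 1. Raising it first does not change which v + 1 is the last one.\<close>
      have qp: "q < p" using p q by (metis is_last_def fun_upd_apply linorder_neqE_nat n_not_Suc_n)
      have pm: "p \<le> m" using m p by (force simp: is_last_def split: if_splits)
      have 1: "is_last n v (f(p := ?w, m := Suc ?w)) q" using q m by (auto simp: is_last_def)
      have 2: "is_last n ?w (f(p := ?w, q := ?w)) m" using q m qp pm by (auto simp: is_last_def)
      show ?thesis using p m q 1 2 qp pm by (simp add: bump_op_eq fun_upd_twist)
    qed
  qed
qed

lemma bump_step_commute:
  assumes "v \<noteq> w" "Suc v \<noteq> w" "Suc w \<noteq> v"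
  shows "bump_op n v (step_op n z w F) = step_op n z w (bump_op n v F)"
  unfolding step_op_def[abs_def] bump_op_add bump_op_scale bump_op_commute[OF assms] ..

text \<open>The row bumps values below a only, all at distance at least two from v.\<close>

lemma bump_row_commute: "a < v \<Longrightarrow> bump_op n v (row_op n z a F) = row_op n z a (bump_op n v F)"
proof (induction a arbitrary: F)
  case (Suc a)
  then show ?case by (simp add: bump_step_commute)
qed simp

lemma step_row_commute: "a < v \<Longrightarrow> step_op n y v (row_op n z a F) = row_op n z a (step_op n y v F)"
  by (simp add: step_op_def[abs_def] row_op_add row_op_scale bump_row_commute)

lemma step_step_same: "step_op n y v (step_op n z v F) = step_op n z v (step_op n y v F)"
  by (simp add: step_op_def[abs_def] bump_op_add bump_op_scale algebra_simps)

text \<open>With \<open>C = [U\<^sub>k\<^sub>+\<^sub>1, U\<^sub>k]\<close>, the plactic relations say \<open>C U\<^sub>k\<^sub>+\<^sub>1 = 0\<close> and \<open>U\<^sub>k C = 0\<close>;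
  so the correction term from moving one step past a row is again a product of two rows.\<close>

lemma row_op_commute:
  fixes F :: "(nat \<Rightarrow> nat) \<Rightarrow> 'a::comm_ring_1"
  shows "row_op n y a (row_op n z a F) = row_op n z a (row_op n y a F)"
proof (induction a arbitrary: F)
  case (Suc a)
  note IH = Suc.IH
  show ?case
  proof (cases a)
    case 0
    then show ?thesis by (simp add: step_step_same)
  next
    case (Suc k)
    define C where "C = (\<lambda>(G :: (nat \<Rightarrow> nat) \<Rightarrow> 'a) f. bump_op n a (bump_op n k G) f - bump_op n k (bump_op n a G) f)"
    have CU: "C (bump_op n a G) = (\<lambda>f. 0)" for G :: "(nat \<Rightarrow> nat) \<Rightarrow> 'a"
      using bump_op_plactic_up[of n k G] by (simp add: C_def Suc)
    have UC: "bump_op n k (C G) = (\<lambda>f. 0)" for G :: "(nat \<Rightarrow> nat) \<Rightarrow> 'a"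
    proof -
      have "C G = (\<lambda>f. bump_op n a (bump_op n k G) f + (-1) * bump_op n k (bump_op n a G) f)"
        by (simp add: C_def)
      then show ?thesis
        using bump_op_plactic_down[of n k G]
        by (simp only: bump_op_add bump_op_scale) (simp add: Suc)
    qed
    have Cadd: "C (\<lambda>f. c * G f + H f) = (\<lambda>f. c * C G f + C H f)" for c and G H :: "(nat \<Rightarrow> nat) \<Rightarrow> 'a"
      by (simp add: C_def bump_op_add bump_op_scale algebra_simps)
    have swap: "step_op n y a (step_op n z k G) = (\<lambda>f. step_op n z k (step_op n y a G) f + C G f)"
      for y z and G :: "(nat \<Rightarrow> nat) \<Rightarrow> 'a"
      by (simp add: step_op_def[abs_def] bump_op_add bump_op_scale C_def algebra_simps)
    \<comment> \<open>Both sides equal z times \<open>C G\<close>: the bump terms vanish by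
      \<open>CU\<close> on the left and by \<open>UC\<close> on the right.\<close>
    have C1: "C (step_op n z a G) = step_op n z k (C G)" for z and G :: "(nat \<Rightarrow> nat) \<Rightarrow> 'a"
      by (simp add: step_op_def[abs_def] Cadd CU UC)
    have key: "row_op n y (Suc a) (row_op n z (Suc a) F) =
        (\<lambda>f. row_op n y a (row_op n z a (step_op n y a (step_op n z a F))) f +
             row_op n y a (row_op n z a (C F)) f)" for y z
    proof -
      have "row_op n y (Suc a) (row_op n z (Suc a) F) =
          row_op n y a (step_op n y a (row_op n z k (step_op n z k (step_op n z a F))))"
        by (simp add: Suc)
      also have "step_op n y a (row_op n z k (step_op n z k (step_op n z a F))) =
          row_op n z k (step_op n y a (step_op n z k (step_op n z a F)))"
        by (rule step_row_commute) (simp add: Suc)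
      also have "\<dots> = row_op n z k (\<lambda>f. step_op n z k (step_op n y a (step_op n z a F)) f +
             step_op n z k (C F) f)"
        by (simp only: swap C1)
      finally show ?thesis by (simp add: row_op_add Suc)
    qed
    \<comment> \<open>The right-hand side of \<open>key\<close> is symmetric in y and z: the shorter
      rows commute by induction, steps for the same value commute, and \<open>C F\<close> involves
      neither variable.\<close>
    show ?thesis unfolding key by (simp add: IH step_step_same)
  qed
qed simp

section \<open>Locality: dependence on an initial segment of the entries\<close>

definition agree :: "nat \<Rightarrow> (nat \<Rightarrow> nat) \<Rightarrow> (nat \<Rightarrow> nat) \<Rightarrow> bool" where
  "agree k f g \<longleftrightarrow> (\<forall>i<k. f i = g i)"

definition local_to :: "nat \<Rightarrow> ((nat \<Rightarrow> nat) \<Rightarrow> 'a) \<Rightarrow> bool" where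
  "local_to k H \<longleftrightarrow> (\<forall>f g. agree k f g \<longrightarrow> H f = H g)"

lemma is_last_agree: "agree k f g \<Longrightarrow> is_last k v f i \<Longrightarrow> is_last k v g i"
  by (auto simp: agree_def is_last_def)

lemma local_bump_op: "local_to k H \<Longrightarrow> local_to k (bump_op k v H)"
  unfolding local_to_def
proof (intro allI impI)
  fix f g assume H: "\<forall>f g. agree k f g \<longrightarrow> H f = H g" and fg: "agree k f g"
  show "bump_op k v H f = bump_op k v H g"
  proof (cases k f v rule: last_cases)
    case none
    with fg show ?thesis by (simp add: bump_op_none agree_def)
  next
    case (last i)
    moreover have "agree k (f(i := Suc v)) (g(i := Suc v))" using fg by (auto simp: agree_def)
    ultimately show ?thesis using is_last_agree[OF fg last] H by (simp add: bump_op_eq)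
  qed
qed

lemma local_step_op: "local_to k H \<Longrightarrow> local_to k (step_op k z v H)"
  using local_bump_op[of k H v] by (simp add: local_to_def step_op_def)

lemma local_row_op: "local_to k H \<Longrightarrow> local_to k (row_op k z a H)"
  by (induction a arbitrary: H) (auto simp: local_step_op)

lemma local_to_mono: "local_to k H \<Longrightarrow> k \<le> l \<Longrightarrow> local_to l H"
  by (auto simp: local_to_def agree_def)

lemma local_bump_poly: "local_to n (bump_poly n)"
proof (induction n)
  case (Suc n)
  have "local_to (Suc n) (row_op n (Var n) a (bump_poly n))" for a
    using local_row_op[OF Suc] local_to_mono by (metis le_SucI order_refl)
  then show ?case by (auto simp: local_to_def agree_def)
qed (simp add: local_to_def)

text \<open>A row on k entries never touches the entries from index k on, so F is only evaluated at
  compositions that still agree with f there.\<close>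

lemma row_op_cong:
  assumes "\<And>g. (\<forall>i\<ge>k. g i = f i) \<Longrightarrow> F g = G g"
  shows "row_op k z a F f = row_op k z a G f"
  using assms
proof (induction a arbitrary: F G)
  case (Suc a)
  have "step_op k z a F g = step_op k z a G g" if g: "\<forall>i\<ge>k. g i = f i" for g
  proof (cases k g a rule: last_cases)
    case none
    then show ?thesis using Suc.prems[OF g] by (simp add: step_op_def bump_op_none)
  next
    case (last j)
    have "F (g(j := Suc a)) = G (g(j := Suc a))"
      using g last by (intro Suc.prems) (auto simp: is_last_def)
    then show ?thesis using Suc.prems[OF g] last by (simp add: step_op_def bump_op_eq)
  qed
  from Suc.IH[of "step_op k z a F" "step_op k z a G", OF this] show ?case by simp
qed simp

subsection \<open>Two consecutive rows\<close>

lemma is_last_Suc_other: "g k \<noteq> v \<Longrightarrow> is_last (Suc k) v g i \<longleftrightarrow> is_last k v g i"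
  unfolding is_last_def by (metis less_Suc_eq)

lemma bump_op_Suc_other: "g k \<noteq> v \<Longrightarrow> bump_op (Suc k) v G g = bump_op k v G g"
proof (cases k g v rule: last_cases)
  case none
  assume "g k \<noteq> v"
  with none show ?thesis by (subst (1 2) bump_op_none) (auto simp: less_Suc_eq)
next
  case (last i)
  assume "g k \<noteq> v"
  with last show ?thesis by (simp add: bump_op_eq is_last_Suc_other)
qed

lemma is_last_top: "g k = v \<Longrightarrow> is_last (Suc k) v g k"
  by (auto simp: is_last_def)

text \<open>Every value processed is smaller than the entry at index k, which is therefore never
  bumped.\<close>

lemma row_op_Suc_below:
  "a \<le> f k \<Longrightarrow> row_op (Suc k) z a G f = row_op k z a G f"
proof (induction a arbitrary: G)
  case (Suc a)
  have "row_op k z a (step_op (Suc k) z a G) f = row_op k z a (step_op k z a G) f"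
    by (rule row_op_cong) (use Suc.prems in \<open>auto simp: step_op_def bump_op_Suc_other\<close>)
  with Suc show ?case by simp
qed simp

text \<open>An entry that starts at most at a and is bumped only at values below a never exceeds
  a.\<close>

lemma row_op_Suc_cong:
  assumes "f k \<le> a" "\<And>g. g k \<le> a \<Longrightarrow> F g = G g"
  shows "row_op (Suc k) z a F f = row_op (Suc k) z a G f"
proof -
  \<comment> \<open>For shorter rows the entry may start above b, so the bound has to be the maximum
    of b and its initial value.\<close>
  have "row_op (Suc k) z b F f = row_op (Suc k) z b G f"
    if "b \<le> a" "\<And>g. g k \<le> max b (f k) \<Longrightarrow> F g = G g" for b F G
    using that
  proof (induction b arbitrary: F G)
    case (Suc b)
    have "step_op (Suc k) z b F g = step_op (Suc k) z b G g" if g: "g k \<le> max b (f k)" for g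
    proof (cases "Suc k" g b rule: last_cases)
      case none
      then show ?thesis using Suc.prems(2)[of g] g by (simp add: step_op_def bump_op_none)
    next
      case (last j)
      have "F (g(j := Suc b)) = G (g(j := Suc b))"
        using g by (intro Suc.prems) auto
      then show ?thesis using Suc.prems(2)[of g] g last by (simp add: step_op_def bump_op_eq)
    qed
    moreover have "b \<le> a" using Suc.prems by simp
    ultimately show ?case using Suc.IH[of "step_op (Suc k) z b F" "step_op (Suc k) z b G"] by simp
  qed simp
  from this[of a F G] assms show ?thesis by (simp add: max_def split: if_splits)
qed

text \<open>For the entry at index k to climb from a to b, each of the values a, ..., b - 1 must be
  spent on it. Only the values below a remain free for the entries before it.\<close>

lemma row_op_Suc_chain:
  assumes "local_to k L" "f k = a" "a \<le> b"
  shows "row_op (Suc k) z b (\<lambda>g. if g k = b then L g else 0) f = row_op k z a L f"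
  using assms(3)
proof (induction b rule: dec_induct)
  case base
  have "row_op (Suc k) z a (\<lambda>g. if g k = a then L g else 0) f =
      row_op k z a (\<lambda>g. if g k = a then L g else 0) f"
    using assms by (simp add: row_op_Suc_below)
  also have "\<dots> = row_op k z a L f"
    by (rule row_op_cong) (simp add: assms)
  finally show ?case .
next
  case (step b)
  let ?F = "\<lambda>g. if g k = Suc b then L g else 0"
  have "step_op (Suc k) z b ?F g = (if g k = b then L g else 0)" if g: "g k \<le> b" for g
  proof (cases "g k = b")
    case True
    have "L (g(k := Suc b)) = L g"
      using assms(1) by (auto simp: local_to_def agree_def)
    with True show ?thesis by (simp add: step_op_def bump_op_eq[OF is_last_top])
  next
    case False
    have "bump_op k b ?F g = 0"
    proof (cases k g b rule: last_cases)
      case (last i)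
      then have "i \<noteq> k" by (auto simp: is_last_def)
      with g last show ?thesis by (simp add: bump_op_eq)
    qed (simp add: bump_op_none)
    with False g show ?thesis by (simp add: step_op_def bump_op_Suc_other)
  qed
  then have "row_op (Suc k) z (Suc b) ?F f = row_op (Suc k) z b (\<lambda>g. if g k = b then L g else 0) f"
    unfolding row_op.simps using assms(2) step.hyps by (intro row_op_Suc_cong) auto
  with step.IH show ?case by simp
qed

text \<open>This is the relation K_{s_i alpha} = xi_i K_alpha for the last two variables y and z,
  cleared of the denominator. A composition ending in (b, a) with a \<le> b gives
  \<open>row_op k z a (row_op k y b H)\<close>, since its entry b is never bumped; the second term
  on the right is this with y and z exchanged. Induction on b starts at b = a, where the claim is
  the commutation of two rows of equal length.\<close>

lemma two_rows:
  fixes y z :: "'a::comm_ring_1"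
  assumes "local_to k H" "f k = a" "a \<le> b"
  shows "(y - z) * row_op (Suc k) z b (\<lambda>g. row_op k y (g k) H g) f =
    y * row_op k z a (row_op k y b H) f - z * row_op k y a (row_op k z b H) f"
  using assms(3,1)
proof (induction b arbitrary: H rule: dec_induct)
  case base
  have "row_op (Suc k) z a (\<lambda>g. row_op k y (g k) H g) f =
      row_op k z a (\<lambda>g. row_op k y (g k) H g) f"
    using assms by (simp add: row_op_Suc_below)
  also have "\<dots> = row_op k z a (row_op k y a H) f"
    by (rule row_op_cong) (simp add: assms)
  finally show ?case using row_op_commute[of k y a z H] by (simp add: algebra_simps)
next
  case (step b)
  let ?G = "\<lambda>H g. row_op k y (g k) H g"
  let ?L = "\<lambda>g. row_op k y b H g"
  note H = step.prems
  \<comment> \<open>An entry at k below b is not hit, and the step commutes with its row. An entry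
    equal to b either yields z or is raised, which lengthens its own row by one factor y + u_b;
    compared with the commuted expression this leaves an excess of y times the row of length
    b.\<close>
  have eq: "step_op (Suc k) z b (?G H) g =
      ?G (step_op k z b H) g + y * (if g k = b then ?L g else 0)" if g: "g k \<le> b" for g
  proof (cases "g k = b")
    case True
    have "local_to k (row_op k y (Suc b) H)" by (rule local_row_op[OF H])
    then have "row_op k y (Suc b) H (g(k := Suc b)) = row_op k y (Suc b) H g"
      by (auto simp: local_to_def agree_def)
    then have "step_op (Suc k) z b (?G H) g = z * row_op k y b H g + row_op k y (Suc b) H g"
      using True by (simp add: step_op_def bump_op_eq[OF is_last_top])
    also have "row_op k y (Suc b) H g = y * row_op k y b H g + row_op k y b (bump_op k b H) g"
      by (simp add: step_op_def[abs_def] row_op_add row_op_scale)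
    also have "z * row_op k y b H g + \<dots> = row_op k y b (step_op k z b H) g + y * row_op k y b H g"
      by (simp add: step_op_def[abs_def] row_op_add row_op_scale)
    finally show ?thesis using True by simp
  next
    case False
    with g have lt: "g k < b" by simp
    have "bump_op k b (?G H) g = bump_op k b (row_op k y (g k) H) g"
    proof (cases k g b rule: last_cases)
      case (last i)
      then have "i \<noteq> k" by (auto simp: is_last_def)
      with last show ?thesis by (simp add: bump_op_eq)
    qed (simp add: bump_op_none)
    then have "step_op (Suc k) z b (?G H) g = step_op k z b (row_op k y (g k) H) g"
      using False by (simp add: step_op_def bump_op_Suc_other)
    with lt False show ?thesis by (simp add: step_row_commute)
  qed
  have "row_op (Suc k) z (Suc b) (?G H) f =
      row_op (Suc k) z b (\<lambda>g. ?G (step_op k z b H) g + y * (if g k = b then ?L g else 0)) f"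
    unfolding row_op.simps using assms(2) step.hyps eq by (intro row_op_Suc_cong) auto
  also have "\<dots> = row_op (Suc k) z b (?G (step_op k z b H)) f + y * row_op k z a ?L f"
    using row_op_Suc_chain[where L = ?L and f = f and z = z and a = a and b = b, OF local_row_op[OF H] assms(2) step.hyps(1)]
    by (simp only: row_op_add row_op_scale)
  finally have "(y - z) * row_op (Suc k) z (Suc b) (?G H) f =
      (y - z) * row_op (Suc k) z b (?G (step_op k z b H)) f + (y - z) * (y * row_op k z a ?L f)"
    by (simp add: algebra_simps)
  also have "(y - z) * row_op (Suc k) z b (?G (step_op k z b H)) f =
      y * row_op k z a (row_op k y b (step_op k z b H)) f - z * row_op k y a (row_op k z b (step_op k z b H)) f"
    by (rule step.IH) (rule local_step_op[OF H])
  \<comment> \<open>In the first term, adding the excess y - z turns the step with z at value b into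
    the step with y.\<close>
  finally show ?case
    by (simp add: step_op_def[abs_def] row_op_add row_op_scale algebra_simps)
qed

section \<open>Key polynomials by branching\<close>

lemmas swap_vars_hom =
  subst_add[where \<sigma> = "\<lambda>k. Var (transpose i (Suc i) k)", folded swap_vars_def]
  subst_diff[where \<sigma> = "\<lambda>k. Var (transpose i (Suc i) k)", folded swap_vars_def]
  subst_mult[where \<sigma> = "\<lambda>k. Var (transpose i (Suc i) k)", folded swap_vars_def]
  subst_zero[where \<sigma> = "\<lambda>k. Var (transpose i (Suc i) k)", folded swap_vars_def]
  subst_one[where \<sigma> = "\<lambda>k. Var (transpose i (Suc i) k)", folded swap_vars_def]
  subst_Var[where \<sigma> = "\<lambda>k. Var (transpose i (Suc i) k)", folded swap_vars_def]
  for i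

locale semiring_hom =
  fixes \<phi> :: "'a::comm_ring_1 \<Rightarrow> 'b::comm_ring_1"
  assumes hom_add: "\<phi> (p + q) = \<phi> p + \<phi> q"
    and hom_mult: "\<phi> (p * q) = \<phi> p * \<phi> q"
    and hom_zero: "\<phi> 0 = 0"
begin

lemma hom_step_op: "\<phi> (step_op n z v F f) = step_op n (\<phi> z) v (\<lambda>f. \<phi> (F f)) f"
  by (auto simp: step_op_def bump_op_def hom_add hom_mult hom_zero)

lemma hom_row_op: "\<phi> (row_op n z a F f) = row_op n (\<phi> z) a (\<lambda>f. \<phi> (F f)) f"
  by (induction a arbitrary: F) (auto simp: hom_step_op)

end

lemma semiring_hom_subst: "semiring_hom (subst \<sigma>)"
  by unfold_locales (auto simp: subst_add subst_mult)

lemma subst_bump_poly_cong: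
  "(\<And>k. k < n \<Longrightarrow> \<sigma> k = \<tau> k) \<Longrightarrow> subst \<sigma> (bump_poly n f) = subst \<tau> (bump_poly n f)"
proof (induction n arbitrary: f)
  case (Suc n)
  then have "(\<lambda>f. subst \<sigma> (bump_poly n f)) = (\<lambda>f. subst \<tau> (bump_poly n f))" by auto
  with Suc.prems show ?case
    by (simp add: semiring_hom.hom_row_op[OF semiring_hom_subst])
qed simp

lemma subst_Var_bump_poly [simp]: "subst Var (bump_poly n f) = bump_poly n f"
  by (induction n arbitrary: f) (auto simp: semiring_hom.hom_row_op[OF semiring_hom_subst])

lemma swap_vars_bump_poly_below: "n \<le> i \<Longrightarrow> swap_vars i (bump_poly n f) = bump_poly n f"
  using subst_bump_poly_cong[of n "\<lambda>k. Var (transpose i (Suc i) k)" Var f]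
  by (auto simp: swap_vars_def transpose_def)

section \<open>The operators xi and the sorting of two adjacent entries\<close>

definition sort_at :: "nat \<Rightarrow> (nat \<Rightarrow> nat) \<Rightarrow> nat \<Rightarrow> nat" where
  "sort_at i f = (if f i > f (Suc i) then f(i := f (Suc i), Suc i := f i) else f)"

text \<open>A bump cannot reverse the order of two entries: the smaller one is raised at most to
  equality, and of two equal entries the later one is raised. So sorting before and after the bump
  agree, with the bumped position carried along.\<close>

lemma is_last_sort_at:
  assumes i: "Suc i < n" and j: "is_last n v f j"
  obtains j' where "is_last n v (sort_at i f) j'"
    "(sort_at i f)(j' := Suc v) = sort_at i (f(j := Suc v))"
proof (cases "j = i \<or> j = Suc i")
  case False
  then have "is_last n v (sort_at i f) j"
    "(sort_at i f)(j := Suc v) = sort_at i (f(j := Suc v))"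
    using i j by (auto simp: is_last_def sort_at_def)
  then show ?thesis using that by blast
next
  case True
  then consider "j = i" "f i \<le> f (Suc i)" | "j = i" "f i > f (Suc i)"
    | "j = Suc i" "f i \<le> f (Suc i)" | "j = Suc i" "f i > f (Suc i)" by linarith
  then show ?thesis
  proof cases
    case 1
    then show ?thesis using that[of i] i j by (auto simp: is_last_def sort_at_def fun_eq_iff)
  next
    case 2
    then show ?thesis using that[of "Suc i"] i j by (auto simp: is_last_def sort_at_def fun_eq_iff)
  next
    case 3
    then show ?thesis using that[of "Suc i"] i j by (auto simp: is_last_def sort_at_def fun_eq_iff)
  next
    case 4
    have "is_last n v (sort_at i f) i"
      unfolding is_last_def
    proof (intro conjI allI impI)
      fix k assume "i < k \<and> k < n"
      then show "sort_at i f k \<noteq> v" using 4 i j by (cases "k = Suc i") (auto simp: is_last_def sort_at_def)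
    qed (use 4 i j in \<open>auto simp: is_last_def sort_at_def\<close>)
    moreover have "(sort_at i f)(i := Suc v) = sort_at i (f(j := Suc v))"
      using 4 i j by (auto simp: is_last_def sort_at_def fun_eq_iff)
    ultimately show ?thesis using that by blast
  qed
qed

lemma bump_op_sort_at:
  assumes "Suc i < n"
  shows "bump_op n v F (sort_at i f) = bump_op n v (\<lambda>f. F (sort_at i f)) f"
proof (cases n f v rule: last_cases)
  case none
  then have "sort_at i f j \<noteq> v" if "j < n" for j
    using assms that by (auto simp: sort_at_def)
  with none show ?thesis by (simp add: bump_op_none)
next
  case (last j)
  from is_last_sort_at[OF assms last] obtain j' where
    "is_last n v (sort_at i f) j'" "(sort_at i f)(j' := Suc v) = sort_at i (f(j := Suc v))" .
  with last show ?thesis by (simp add: bump_op_eq)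
qed

text \<open>At a descent of f this is K_{s_i f} = xi_i K_f without the division; elsewhere it says
  that F f is symmetric in the two variables. The cases are joined because a bump can turn a descent
  into equality.\<close>

definition key_rel :: "nat \<Rightarrow> ((nat \<Rightarrow> nat) \<Rightarrow> nat mpoly) \<Rightarrow> bool" where
  "key_rel i F \<longleftrightarrow> (\<forall>f. (Var i - Var (Suc i)) * F (sort_at i f) =
      Var i * F f - Var (Suc i) * swap_vars i (F f))"

lemma key_rel_step_op:
  assumes i: "Suc i < n" and F: "key_rel i F" and z: "swap_vars i z = z"
  shows "key_rel i (step_op n z v F)"
  unfolding key_rel_def
proof
  fix f
  let ?D = "Var i - Var (Suc i) :: nat mpoly"
  have "?D * bump_op n v (\<lambda>f. F (sort_at i f)) f =
      bump_op n v (\<lambda>f. ?D * F (sort_at i f)) f"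
    by (simp add: bump_op_scale)
  also have "\<dots> = Var i * bump_op n v F f - Var (Suc i) * swap_vars i (bump_op n v F f)"
    using F by (auto simp: key_rel_def bump_op_def swap_vars_hom)
  finally have 1: "?D * bump_op n v F (sort_at i f) =
      Var i * bump_op n v F f - Var (Suc i) * swap_vars i (bump_op n v F f)"
    by (simp add: bump_op_sort_at[OF i])
  have "?D * (z * F (sort_at i f)) = z * (?D * F (sort_at i f))" by (simp add: mult_ac)
  also have "\<dots> = z * (Var i * F f - Var (Suc i) * swap_vars i (F f))"
    using F by (simp add: key_rel_def)
  finally have 2: "?D * (z * F (sort_at i f)) = z * (Var i * F f - Var (Suc i) * swap_vars i (F f))" .
  have "?D * step_op n z v F (sort_at i f) =
      ?D * (z * F (sort_at i f)) + ?D * bump_op n v F (sort_at i f)"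
    by (simp add: step_op_def distrib_left)
  also have "\<dots> = Var i * step_op n z v F f - Var (Suc i) * swap_vars i (step_op n z v F f)"
    unfolding 1 2 by (simp add: step_op_def swap_vars_hom z algebra_simps)
  finally show "?D * step_op n z v F (sort_at i f) =
      Var i * step_op n z v F f - Var (Suc i) * swap_vars i (step_op n z v F f)" .
qed

lemma key_rel_row_op:
  "Suc i < n \<Longrightarrow> key_rel i F \<Longrightarrow> swap_vars i z = z \<Longrightarrow> key_rel i (row_op n z a F)"
  by (induction a arbitrary: F) (auto simp: key_rel_step_op)

lemma key_rel_last: "key_rel k (bump_poly (Suc (Suc k)))"
  unfolding key_rel_def
proof
  fix f
  let ?y = "Var k :: nat mpoly" and ?z = "Var (Suc k) :: nat mpoly"
  define R where "R = (\<lambda>y z a b. row_op k z a (row_op k y b (bump_poly k)))"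
  have loc: "local_to k (R y z a b)" for y z a b
    unfolding R_def by (intro local_row_op local_bump_poly)
  have main: "(?y - ?z) * bump_poly (Suc (Suc k)) g = ?y * R ?y ?z (g k) (g (Suc k)) g - ?z * R ?z ?y (g k) (g (Suc k)) g"
    if "g k \<le> g (Suc k)" for g
    using two_rows[where k = k and H = "bump_poly k" and f = g and y = ?y and z = ?z, OF local_bump_poly refl that] by (simp add: R_def bump_poly.simps(2)[abs_def])
  have swapR: "swap_vars k (R ?y ?z a b g) = R ?z ?y a b g" "swap_vars k (R ?z ?y a b g) = R ?y ?z a b g" for a b g
    unfolding R_def swap_vars_def semiring_hom.hom_row_op[OF semiring_hom_subst]
    by (simp_all flip: swap_vars_def add: swap_vars_bump_poly_below swap_vars_hom)
  show "(?y - ?z) * bump_poly (Suc (Suc k)) (sort_at k f) =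
      ?y * bump_poly (Suc (Suc k)) f - ?z * swap_vars k (bump_poly (Suc (Suc k)) f)"
  proof (cases "f k > f (Suc k)")
    case True
    let ?a = "f (Suc k)" and ?b = "f k"
    let ?g = "sort_at k f"
    have g: "?g k = ?a" "?g (Suc k) = ?b" "agree k ?g f"
      using True by (auto simp: sort_at_def agree_def)
    \<comment> \<open>The last entry is smaller than the one before it, which therefore keeps its
      value while the last row is processed.\<close>
    have "bump_poly (Suc (Suc k)) f = row_op k ?z ?a (\<lambda>g. row_op k ?y (g k) (bump_poly k) g) f"
      using True by (simp add: row_op_Suc_below bump_poly.simps(2)[abs_def])
    also have "\<dots> = R ?y ?z ?a ?b f"
      unfolding R_def by (rule row_op_cong) simp
    finally have P: "bump_poly (Suc (Suc k)) f = R ?y ?z ?a ?b f" .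
    have "R ?y ?z ?a ?b ?g = R ?y ?z ?a ?b f" "R ?z ?y ?a ?b ?g = R ?z ?y ?a ?b f"
      using loc g(3) unfolding local_to_def by blast+
    moreover have "(?y - ?z) * bump_poly (Suc (Suc k)) ?g = ?y * R ?y ?z ?a ?b ?g - ?z * R ?z ?y ?a ?b ?g"
      using main[of ?g] g True by simp
    ultimately show ?thesis unfolding P by (simp add: swapR)
  next
    case False
    let ?P = "bump_poly (Suc (Suc k)) f"
    from False have g: "sort_at k f = f" by (simp add: sort_at_def)
    have 1: "(?y - ?z) * ?P = ?y * R ?y ?z (f k) (f (Suc k)) f - ?z * R ?z ?y (f k) (f (Suc k)) f"
      by (rule main) (use False in simp)
    \<comment> \<open>Exchanging the variables negates both sides of the identity, so the polynomial
      itself is symmetric because the ring has no zero divisors.\<close>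
    from arg_cong[OF this, of "swap_vars k"]
    have 2: "(?z - ?y) * swap_vars k ?P = ?z * R ?z ?y (f k) (f (Suc k)) f - ?y * R ?y ?z (f k) (f (Suc k)) f"
      by (simp add: swap_vars_hom swapR)
    have "(?y - ?z) * swap_vars k ?P = - ((?z - ?y) * swap_vars k ?P)"
      by (simp only: mult_minus_left[symmetric] minus_diff_eq)
    also have "\<dots> = (?y - ?z) * ?P"
      unfolding 1 2 by (rule minus_diff_eq)
    finally have "(?y - ?z) * (swap_vars k ?P - ?P) = 0"
      by (simp only: right_diff_distrib diff_self)
    moreover have "?y - ?z \<noteq> 0" by (simp add: Var_eq_iff)
    ultimately have "swap_vars k ?P = ?P" by (metis mult_eq_0_iff right_minus_eq)
    then show ?thesis unfolding g by (simp add: algebra_simps)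
  qed
qed

lemma key_rel_bump_poly: "Suc i < n \<Longrightarrow> key_rel i (bump_poly n)"
proof (induction n)
  case (Suc m)
  show ?case
  proof (cases "Suc i = m")
    case True
    show ?thesis unfolding True[symmetric] by (rule key_rel_last)
  next
    case False
    with Suc have im: "Suc i < m" and IH: "key_rel i (bump_poly m)" by auto
    have "swap_vars i (Var m) = Var m" using im by (simp add: swap_vars_hom transpose_def)
    then have R: "key_rel i (row_op m (Var m) a (bump_poly m))" for a
      by (intro key_rel_row_op im IH)
    show ?thesis
      unfolding key_rel_def
    proof
      fix f
      have "sort_at i f m = f m" using im by (auto simp: sort_at_def)
      then show "(Var i - Var (Suc i)) * bump_poly (Suc m) (sort_at i f) =
         Var i * bump_poly (Suc m) f - Var (Suc i) * swap_vars i (bump_poly (Suc m) f)"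
        using R unfolding key_rel_def by simp
    qed
  qed
qed simp

lemma bump_poly_symmetric:
  assumes "Suc i < n" "f i \<le> f (Suc i)"
  shows "swap_vars i (bump_poly n f) = bump_poly n f"
proof -
  have "sort_at i f = f" using assms by (simp add: sort_at_def)
  then have "Var (Suc i) * (swap_vars i (bump_poly n f) - bump_poly n f) = 0"
    using key_rel_bump_poly[OF assms(1)] unfolding key_rel_def
    by (metis (no_types, lifting) diff_self eq_iff_diff_eq_0 left_diff_distrib right_diff_distrib
        add_diff_cancel_left' diff_diff_eq2 diff_add_cancel)
  moreover have "Var (Suc i) \<noteq> (0 :: nat mpoly)" by (simp add: Var_def)
  ultimately show ?thesis by (metis mult_eq_0_iff right_minus_eq)
qed

text \<open>Values below a do not occur among the entries, so each step can only contribute the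
  variable.\<close>

lemma row_op_dominant: "(\<And>i. i < n \<Longrightarrow> a \<le> f i) \<Longrightarrow> row_op n z a F f = z ^ a * F f"
proof (induction a arbitrary: F)
  case (Suc a)
  then have "row_op n z a (step_op n z a F) f = z ^ a * step_op n z a F f"
    by (simp add: Suc_le_eq order.strict_implies_order)
  also have "bump_op n a F f = 0" using Suc.prems by (intro bump_op_none) fastforce
  then have "step_op n z a F f = z * F f" by (simp add: step_op_def)
  finally show ?case by (simp add: mult_ac)
qed simp

lemma bump_poly_dominant:
  "(\<And>i j. i < j \<Longrightarrow> j < n \<Longrightarrow> f j \<le> f i) \<Longrightarrow> bump_poly n f = (\<Prod>k<n. Var k ^ f k)"
proof (induction n)
  case (Suc n)
  then show ?case by (simp add: row_op_dominant mult.commute)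
qed simp

section \<open>Identification with the key polynomials\<close>

lemma xi_eqI:
  assumes "(Var i - Var (Suc i)) * g = Var i * f - Var (Suc i) * swap_vars i f"
  shows "xi i f = g"
  unfolding xi_def
proof (rule the_equality)
  fix h assume "(Var i - Var (Suc i)) * h = Var i * f - Var (Suc i) * swap_vars i f"
  with assms have "(Var i - Var (Suc i)) * (h - g) = 0" by (simp add: right_diff_distrib)
  moreover have "Var i - Var (Suc i) \<noteq> (0 :: nat mpoly)" by (simp add: Var_eq_iff)
  ultimately show "h = g" by (metis mult_eq_0_iff right_minus_eq)
qed (rule assms)

lemma is_key_family_bump_poly: "is_key_family (\<lambda>\<alpha>. bump_poly (length \<alpha>) ((!) \<alpha>))"
  unfolding is_key_family_def
proof (intro conjI allI impI)
  fix \<alpha> :: "nat list" assume "sorted_wrt (\<ge>) \<alpha>"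
  then show "bump_poly (length \<alpha>) ((!) \<alpha>) = (\<Prod>k<length \<alpha>. Var k ^ \<alpha> ! k)"
    by (intro bump_poly_dominant) (auto simp: sorted_wrt_iff_nth_less)
next
  fix \<alpha> :: "nat list" and i
  assume i: "Suc i < length \<alpha> \<and> \<alpha> ! i > \<alpha> ! Suc i"
  let ?n = "length \<alpha>"
  let ?\<beta> = "\<alpha>[i := \<alpha> ! Suc i, Suc i := \<alpha> ! i]"
  have "agree ?n ((!) ?\<beta>) (sort_at i ((!) \<alpha>))"
    using i by (auto simp: agree_def sort_at_def nth_list_update)
  then have "bump_poly ?n ((!) ?\<beta>) = bump_poly ?n (sort_at i ((!) \<alpha>))"
    using local_bump_poly unfolding local_to_def by blast
  moreover have "xi i (bump_poly ?n ((!) \<alpha>)) = bump_poly ?n (sort_at i ((!) \<alpha>))"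
    using key_rel_bump_poly[of i ?n] i unfolding key_rel_def by (intro xi_eqI) simp
  ultimately show "bump_poly (length ?\<beta>) ((!) ?\<beta>) = xi i (bump_poly ?n ((!) \<alpha>))" by simp
qed

text \<open>The termination measure for removing adjacent ascents, both in the uniqueness of the key
  family and in the upper bound for the support.\<close>

lemma sum_transpose_descent:
  fixes f :: "nat \<Rightarrow> nat"
  assumes "Suc i < n" "f i < f (Suc i)"
  shows "(\<Sum>k<n. k * (f \<circ> transpose i (Suc i)) k) < (\<Sum>k<n. k * f k)"
proof -
  let ?S = "{..<n} - {i} - {Suc i}"
  have split: "(\<Sum>k<n. g k) = g i + g (Suc i) + sum g ?S" for g :: "nat \<Rightarrow> nat"
    using assms(1) by (simp add: sum.remove[of "{..<n}" i] sum.remove[of "{..<n} - {i}" "Suc i"])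
  have "(\<Sum>k\<in>?S. k * (f \<circ> transpose i (Suc i)) k) = (\<Sum>k\<in>?S. k * f k)"
    by (intro sum.cong) (auto simp: transpose_def)
  then show ?thesis using assms unfolding split by simp
qed

lemma key_family_unique:
  assumes "is_key_family K" "is_key_family L"
  shows "K \<alpha> = L \<alpha>"
proof (induction "\<Sum>k<length \<alpha>. k * \<alpha> ! k" arbitrary: \<alpha> rule: less_induct)
  case less
  show ?case
  proof (cases "sorted_wrt (\<ge>) \<alpha>")
    case True
    with assms show ?thesis by (simp add: is_key_family_def)
  next
    case False
    have "transp ((\<ge>) :: nat \<Rightarrow> nat \<Rightarrow> bool)" by (auto intro: transpI)
    with False obtain i where i: "Suc i < length \<alpha>" "\<alpha> ! i < \<alpha> ! Suc i"
      by (auto simp: sorted_wrt_iff_nth_Suc_transp not_le)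
    let ?\<beta> = "\<alpha>[i := \<alpha> ! Suc i, Suc i := \<alpha> ! i]"
    have twice: "?\<beta>[i := ?\<beta> ! Suc i, Suc i := ?\<beta> ! i] = \<alpha>"
      using i by (intro nth_equalityI) (auto simp: nth_list_update)
    have "(\<Sum>k<length ?\<beta>. k * ?\<beta> ! k) < (\<Sum>k<length \<alpha>. k * \<alpha> ! k)"
    proof -
      have "(\<Sum>k<length ?\<beta>. k * ?\<beta> ! k) = (\<Sum>k<length \<alpha>. k * ((!) \<alpha> \<circ> transpose i (Suc i)) k)"
        using i by (intro sum.cong) (auto simp: nth_list_update transpose_def)
      with sum_transpose_descent[OF i] show ?thesis by simp
    qed
    then have "K ?\<beta> = L ?\<beta>" by (rule less)
    moreover have "K \<alpha> = xi i (K ?\<beta>)" "L \<alpha> = xi i (L ?\<beta>)"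
      using assms i twice unfolding is_key_family_def
      by (metis (no_types, lifting) length_list_update nth_list_update_eq nth_list_update_neq Suc_lessD n_not_Suc_n)+
    ultimately show ?thesis by simp
  qed
qed

lemma key_poly_eq: "key_poly \<alpha> = bump_poly (length \<alpha>) ((!) \<alpha>)"
proof -
  have "key_poly = (\<lambda>\<alpha>. bump_poly (length \<alpha>) ((!) \<alpha>))"
    unfolding key_poly_def
    by (intro the_equality is_key_family_bump_poly ext key_family_unique)
  from fun_cong[OF this] show ?thesis .
qed

section \<open>Moves on compositions\<close>

definition mv :: "nat \<Rightarrow> (nat \<Rightarrow> nat) \<Rightarrow> (nat \<Rightarrow> nat) \<Rightarrow> bool" where
  "mv n f g \<longleftrightarrow> (\<exists>p q. p < q \<and> q < n \<and> f p < f q \<and>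
     (g = f(p := f q, q := f p) \<or> (Suc (f p) < f q \<and> g = f(p := Suc (f p), q := f q - 1))))"

abbreviation reach :: "nat \<Rightarrow> (nat \<Rightarrow> nat) \<Rightarrow> (nat \<Rightarrow> nat) \<Rightarrow> bool" where
  "reach n \<equiv> (mv n)\<^sup>*\<^sup>*"

lemma mv_swapI: "p < q \<Longrightarrow> q < n \<Longrightarrow> f p < f q \<Longrightarrow> mv n f (f(p := f q, q := f p))"
  unfolding mv_def by blast

lemma mv_unitI: "p < q \<Longrightarrow> q < n \<Longrightarrow> Suc (f p) < f q \<Longrightarrow> mv n f (f(p := Suc (f p), q := f q - 1))"
  unfolding mv_def using Suc_lessD by blast

lemma reach_units:
  assumes "p < q" "q < n" "f p \<le> f q" "2 * k \<le> f q - f p"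
  shows "reach n f (f(p := f p + k, q := f q - k))"
  using assms(4)
proof (induction k)
  case (Suc k)
  let ?g = "f(p := f p + k, q := f q - k)"
  have "mv n ?g (?g(p := Suc (?g p), q := ?g q - 1))"
    using assms Suc.prems by (intro mv_unitI) auto
  moreover have "?g(p := Suc (?g p), q := ?g q - 1) = f(p := f p + Suc k, q := f q - Suc k)"
    using assms(1) by (intro ext) simp
  moreover have "reach n f ?g" by (rule Suc.IH) (use Suc.prems in simp)
  ultimately show ?case by (metis rtranclp.rtrancl_into_rtrancl)
qed simp

text \<open>Two entries can be redistributed arbitrarily within the interval that they span. If c
  lies past the midpoint, unit transfers reach the mirror image, and an exchange completes it. Both
  kinds of move have this form, so later arguments treat them together.\<close>

lemma reach_between:
  assumes "p < q" "q < n" "f p \<le> c" "c \<le> f q"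
  shows "reach n f (f(p := c, q := f p + f q - c))"
proof (cases "2 * (c - f p) \<le> f q - f p")
  case True
  then have "reach n f (f(p := f p + (c - f p), q := f q - (c - f p)))"
    using assms by (intro reach_units) auto
  moreover have "f q - (c - f p) = f p + f q - c" using assms by simp
  ultimately show ?thesis using assms by simp
next
  case False
  let ?k = "f q - c"
  let ?g = "f(p := f p + f q - c, q := c)"
  have "reach n f (f(p := f p + ?k, q := f q - ?k))" using assms False by (intro reach_units) auto
  moreover have "f p + ?k = f p + f q - c" "f q - ?k = c" using assms by auto
  ultimately have 1: "reach n f ?g" by simp
  have "f p + f q - c < c" using assms False by linarith
  then have "mv n ?g (?g(p := ?g q, q := ?g p))"
    using assms(1,2) by (intro mv_swapI) auto
  moreover have "?g(p := ?g q, q := ?g p) = f(p := c, q := f p + f q - c)"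
    using assms(1) by (intro ext) simp
  ultimately have "mv n ?g (f(p := c, q := f p + f q - c))" by (simp only:)
  then show ?thesis by (rule rtranclp.rtrancl_into_rtrancl[where r = "mv n", OF 1])
qed

lemma reach_between':
  assumes "p < q" "q < n" "f p \<le> c" "c \<le> f q" "g = f(p := c, q := f p + f q - c)"
  shows "reach n f g"
  using reach_between[OF assms(1-4)] assms(5) by simp

lemma mv_cases:
  assumes "mv n f g"
  obtains p q c where "p < q" "q < n" "f p < c" "c \<le> f q" "g = f(p := c, q := f p + f q - c)"
proof -
  from assms obtain p q where pq: "p < q" "q < n" "f p < f q"
    "g = f(p := f q, q := f p) \<or> (Suc (f p) < f q \<and> g = f(p := Suc (f p), q := f q - 1))"
    unfolding mv_def by blast
  from pq(4) show ?thesis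
  proof
    assume "g = f(p := f q, q := f p)"
    with pq show ?thesis by (intro that[of p q "f q"]) auto
  next
    assume "Suc (f p) < f q \<and> g = f(p := Suc (f p), q := f q - 1)"
    with pq show ?thesis by (intro that[of p q "Suc (f p)"]) auto
  qed
qed

lemma mv_increment:
  assumes "mv n f g" "p < n"
  shows "\<exists>h<n. f h \<le> g p \<and> reach n (f(h := Suc (f h))) (g(p := Suc (g p)))"
proof -
  from assms(1) obtain i j c where ij: "i < j" "j < n" "f i < c" "c \<le> f j"
    and g: "g = f(i := c, j := f i + f j - c)" by (rule mv_cases)
  consider "p \<noteq> i" "p \<noteq> j" | "p = i" "c < f j" | "p = i" "c = f j" | "p = j"
    using ij by linarith
  then show ?thesis
  proof cases
    case 1
    have "reach n (f(p := Suc (f p))) (g(p := Suc (g p)))"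
      by (rule reach_between'[of i j _ _ c]) (use 1 ij g in \<open>auto simp: fun_eq_iff\<close>)
    with 1 g assms(2) show ?thesis by (intro exI[of _ p]) auto
  next
    case 2
    have "reach n (f(i := Suc (f i))) (g(p := Suc (g p)))"
      by (rule reach_between'[of i j _ _ "Suc c"]) (use 2 ij g in \<open>auto simp: fun_eq_iff\<close>)
    with 2 g ij show ?thesis by (intro exI[of _ i]) auto
  next
    case 3
    have "reach n (f(j := Suc (f j))) (g(p := Suc (g p)))"
      by (rule reach_between'[of i j _ _ "Suc c"]) (use 3 ij g in \<open>auto simp: fun_eq_iff\<close>)
    with 3 g ij show ?thesis by (intro exI[of _ j]) auto
  next
    case 4
    have "reach n (f(i := Suc (f i))) (g(p := Suc (g p)))"
      by (rule reach_between'[of i j _ _ c]) (use 4 ij g in \<open>auto simp: fun_eq_iff\<close>)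
    with 4 g ij show ?thesis by (intro exI[of _ i]) auto
  qed
qed

lemma reach_increment:
  assumes "reach n f g" "p < n"
  shows "\<exists>h<n. f h \<le> g p \<and> reach n (f(h := Suc (f h))) (g(p := Suc (g p)))"
  using assms
proof (induction arbitrary: p rule: rtranclp_induct)
  case (step g g')
  from mv_increment[OF step.hyps(2) step.prems] obtain h where
    h: "h < n" "g h \<le> g' p" "reach n (g(h := Suc (g h))) (g'(p := Suc (g' p)))" by blast
  from step.IH[OF h(1)] obtain k where
    "k < n" "f k \<le> g h" "reach n (f(k := Suc (f k))) (g(h := Suc (g h)))" by blast
  with h show ?case by (meson le_trans rtranclp_trans)
qed auto

text \<open>The closure of a composition which ascends at \<open>i\<close> is stable under the transposition at \<open>i\<close>:
  conjugation maps moves to moves, except for those at \<open>(i, i + 1)\<close>, which stay inside one string.\<close>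

lemma reach_transpose:
  assumes i: "Suc i < n" "f i \<le> f (Suc i)" and "reach n f g"
  shows "reach n f (g \<circ> transpose i (Suc i))"
  using assms(3)
proof (induction rule: rtranclp_induct)
  case base
  show ?case
    by (rule reach_between'[of i "Suc i" _ _ "f (Suc i)"])
      (use i in \<open>auto simp: fun_eq_iff transpose_def\<close>)
next
  case (step g g')
  let ?t = "transpose i (Suc i)"
  from step.hyps(2) obtain p q c where pq: "p < q" "q < n" "g p < c" "c \<le> g q"
    and g': "g' = g(p := c, q := g p + g q - c)" by (rule mv_cases)
  show ?case
  proof (cases "p = i \<and> q = Suc i")
    case True
    have "reach n g (g' \<circ> ?t)"
      by (rule reach_between'[of i "Suc i" _ _ "g p + g q - c"])
        (use True pq g' in \<open>auto simp: fun_eq_iff transpose_def\<close>)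
    with step.hyps(1) show ?thesis by (rule rtranclp_trans)
  next
    case False
    have "reach n (g \<circ> ?t) (g' \<circ> ?t)"
    proof (rule reach_between'[of "?t p" "?t q" _ _ c])
      show "?t p < ?t q" "?t q < n" using False pq i by (auto simp: transpose_def)
      show "g' \<circ> ?t = (g \<circ> ?t)(?t p := c, ?t q := (g \<circ> ?t) (?t p) + (g \<circ> ?t) (?t q) - c)"
        using pq by (simp add: g' fun_eq_iff) (metis transpose_involutory)
    qed (use pq in auto)
    with step.IH show ?thesis by (rule rtranclp_trans)
  qed
qed

subsection \<open>Bump sequences\<close>

fun bumps :: "nat \<Rightarrow> nat list \<Rightarrow> (nat \<Rightarrow> nat) \<Rightarrow> nat \<Rightarrow> nat" where
  "bumps n [] f = f"
| "bumps n (v # vs) f = bumps n vs (bump n v f)"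

fun valid :: "nat \<Rightarrow> nat list \<Rightarrow> (nat \<Rightarrow> nat) \<Rightarrow> bool" where
  "valid n [] f \<longleftrightarrow> True"
| "valid n (v # vs) f \<longleftrightarrow> (\<exists>i<n. f i = v) \<and> valid n vs (bump n v f)"

lemma bumps_append [simp]: "bumps n (us @ vs) f = bumps n vs (bumps n us f)"
  by (induction us arbitrary: f) auto

lemma valid_append [simp]: "valid n (us @ vs) f \<longleftrightarrow> valid n us f \<and> valid n vs (bumps n us f)"
  by (induction us arbitrary: f) auto

lemma valid_ConsE:
  assumes "valid n (v # vs) f"
  obtains i where "is_last n v f i" "valid n vs (f(i := Suc v))" "bumps n (v # vs) f = bumps n vs (f(i := Suc v))"
  using assms is_last_ex[of n f v] by (auto simp: bump_eq)

lemma valid_ConsI: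
  assumes "is_last n v f i"
  shows "valid n (v # vs) f \<longleftrightarrow> valid n vs (f(i := Suc v))" "bumps n (v # vs) f = bumps n vs (f(i := Suc v))"
  using assms by (auto simp: bump_eq) (auto simp: is_last_def)

lemma bumps_mono: "valid n vs f \<Longrightarrow> f i \<le> bumps n vs f i"
proof (induction vs arbitrary: f)
  case (Cons v vs)
  from Cons.prems obtain j where j: "is_last n v f j" "valid n vs (f(j := Suc v))"
    "bumps n (v # vs) f = bumps n vs (f(j := Suc v))" by (rule valid_ConsE)
  have "f i \<le> (f(j := Suc v)) i" using j(1) by (auto simp: is_last_def)
  also have "\<dots> \<le> bumps n (v # vs) f i" unfolding j(3) by (rule Cons.IH[OF j(2)])
  finally show ?case .
qed simp

text \<open>An entry below all values still to be bumped is inert, so overwriting it by another such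
  number leaves the rest of the run unchanged.\<close>

lemma bumps_frozen_upd:
  assumes "\<And>t. t \<in> set vs \<Longrightarrow> f i < t \<and> c < t" "valid n vs f"
  shows "valid n vs (f(i := c)) \<and> bumps n vs (f(i := c)) = (bumps n vs f)(i := c)"
  using assms
proof (induction vs arbitrary: f)
  case (Cons v vs)
  from Cons.prems(2) obtain j where j: "is_last n v f j" "valid n vs (f(j := Suc v))"
    "bumps n (v # vs) f = bumps n vs (f(j := Suc v))" by (rule valid_ConsE)
  have ne: "f i \<noteq> v" "c \<noteq> v" using Cons.prems(1)[of v] by auto
  then have ij: "i \<noteq> j" using j(1) by (auto simp: is_last_def)
  then have l: "is_last n v (f(i := c)) j"
    using j(1) ne by (auto simp: is_last_def)
  have "valid n vs ((f(j := Suc v))(i := c)) \<and>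
      bumps n vs ((f(j := Suc v))(i := c)) = (bumps n vs (f(j := Suc v)))(i := c)"
    by (rule Cons.IH[OF _ j(2)]) (use Cons.prems(1) ij in auto)
  with ij show ?case unfolding valid_ConsI[OF l] j(3) by (simp add: fun_upd_twist)
qed simp

lemma bumps_frozen:
  assumes "\<And>t. t \<in> set vs \<Longrightarrow> f i < t" "valid n vs f"
  shows "bumps n vs f i = f i"
  using bumps_frozen_upd[of vs f i "f i" n] assms by (metis fun_upd_same fun_upd_triv)

text \<open>A larger value at the later of two indices \<open>g < h\<close> is at least as good as at the earlier one,
  whatever is bumped afterwards.\<close>

lemma bumps_exchange:
  assumes "sorted_wrt (<) vs" "\<And>t. t \<in> set vs \<Longrightarrow> w \<le> t" "g < h" "h < n"
    "f g = w" "f h < w" "c < w" "valid n vs f"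
  shows "valid n vs (f(g := c, h := w)) \<and>
    reach n (bumps n vs (f(g := c, h := w))) ((bumps n vs f)(g := c, h := bumps n vs f g))"
  using assms
proof (induction vs arbitrary: f g w c)
  case (Cons t vs)
  let ?X = "f" and ?X' = "f(g := c, h := w)"
  have gt: "t < s" if "s \<in> set vs" for s using Cons.prems(1) that by simp
  show ?case
  proof (cases "t = w")
    case False
    then have fr: "w < s" if "s \<in> set (t # vs)" for s
      using Cons.prems(2)[of t] gt that by fastforce
    have 1: "valid n (t # vs) (f(g := c)) \<and> bumps n (t # vs) (f(g := c)) = (bumps n (t # vs) f)(g := c)"
      using Cons.prems fr by (intro bumps_frozen_upd) (blast intro: less_trans)+
    have 2: "valid n (t # vs) (f(g := c, h := w)) \<and>
        bumps n (t # vs) (f(g := c, h := w)) = (bumps n (t # vs) (f(g := c)))(h := w)"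
    proof (rule bumps_frozen_upd)
      fix s assume "s \<in> set (t # vs)"
      then show "(f(g := c)) h < s \<and> w < s" using fr[of s] Cons.prems(3,6) by simp
    qed (use 1 in blast)
    have 3: "bumps n (t # vs) f g = w"
      using bumps_frozen[of "t # vs" f g n] Cons.prems fr by simp
    have "bumps n (t # vs) ?X' = (bumps n (t # vs) f)(g := c, h := bumps n (t # vs) f g)"
      using 1 2 3 by (simp only:)
    with 2 show ?thesis by (metis rtranclp.rtrancl_refl)
  next
    case True
    from Cons.prems(8) obtain m where m: "is_last n t f m" "valid n vs (f(m := Suc t))"
      "bumps n (t # vs) f = bumps n vs (f(m := Suc t))" by (rule valid_ConsE)
    have gm: "g \<le> m" using m(1) Cons.prems True unfolding is_last_def by (metis less_trans not_less)
    have mh: "m \<noteq> h" using m(1) Cons.prems True by (auto simp: is_last_def)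
    have sv: "sorted_wrt (<) vs" using Cons.prems(1) by simp
    \<comment> \<open>Here \<open>m\<close> is the last w of the original composition. If
      \<open>m = g\<close>, the two runs raise w at \<open>g\<close> and at \<open>h\<close>
      respectively, and induction applies with w + 1. If \<open>h < m\<close>, both runs bump
      \<open>m\<close>, and \<open>g\<close> and \<open>h\<close> are inert from then on.\<close>
    consider "m = g" | "h < m" | "g < m" "m < h" using gm mh by linarith
    then show ?thesis
    proof cases
      case 1
      have l: "is_last n t ?X' h" unfolding is_last_def
        using m(1) 1 Cons.prems True by (auto simp: is_last_def)
      let ?Z = "f(g := Suc w)"
      have "valid n vs ((f(g := Suc w))(g := c, h := Suc w)) \<and>
        reach n (bumps n vs ((f(g := Suc w))(g := c, h := Suc w)))
          ((bumps n vs (f(g := Suc w)))(g := c, h := bumps n vs (f(g := Suc w)) g))"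
        using Cons.prems 1 m True gt by (intro Cons.IH[where f = "?Z"]) force+
      then show ?thesis unfolding valid_ConsI[OF l] m(3) using 1 True by (simp del: fun_upd_apply)
    next
      case 2
      have l: "is_last n t ?X' m" unfolding is_last_def
        using m(1) 2 Cons.prems True by (auto simp: is_last_def)
      let ?Y = "f(m := Suc t)"
      have 1: "valid n vs (?Y(g := c)) \<and> bumps n vs (?Y(g := c)) = (bumps n vs ?Y)(g := c)"
        using Cons.prems gt m 2 True by (intro bumps_frozen_upd[of _ ?Y]) force+
      have 3: "valid n vs (?Y(g := c, h := w)) \<and>
          bumps n vs (?Y(g := c, h := w)) = (bumps n vs (?Y(g := c)))(h := w)"
        using Cons.prems gt m 2 True 1 by (intro bumps_frozen_upd[of _ "?Y(g := c)"]) force+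
      have 4: "bumps n vs ?Y g = w"
        using bumps_frozen[of vs ?Y g n] Cons.prems gt m 2 True by simp
      have "?X'(m := Suc t) = ?Y(g := c, h := w)"
        using 2 Cons.prems by (auto simp: fun_eq_iff)
      then show ?thesis unfolding valid_ConsI[OF l] m(3) using 1 3 4 by (simp del: fun_upd_apply)
    next
      \<comment> \<open>The original run bumps \<open>m\<close>, the changed one \<open>h\<close>.
        Induction is applied to the pair \<open>m < h\<close>, with w + 1 in place of w and w in
        place of c; a redistribution between \<open>m\<close> and \<open>h\<close> then restores the
        values wanted.\<close>
      case 3
      have l: "is_last n t ?X' h" unfolding is_last_def
        using m(1) 3 Cons.prems True by (auto simp: is_last_def)
      let ?Y = "f(m := Suc t)"
      have 1: "valid n vs (?Y(g := c)) \<and> bumps n vs (?Y(g := c)) = (bumps n vs ?Y)(g := c)"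
        using Cons.prems gt m 3 True by (intro bumps_frozen_upd[of _ ?Y]) force+
      have fg: "bumps n vs ?Y g = w"
        using bumps_frozen[of vs ?Y g n] Cons.prems gt m 3 True by simp
      let ?Z = "?Y(g := c)"
      have IH: "valid n vs ((?Y(g := c))(m := w, h := Suc w)) \<and>
        reach n (bumps n vs ((?Y(g := c))(m := w, h := Suc w)))
          ((bumps n vs (?Y(g := c)))(m := w, h := bumps n vs (?Y(g := c)) m))"
        using Cons.prems 1 3 m True gt by (intro Cons.IH[where f = "?Z"]) force+
      have eq: "(?Y(g := c))(m := w, h := Suc w) = ?X'(h := Suc t)"
        using 3 True m(1) by (auto simp: fun_eq_iff is_last_def)
      let ?B = "bumps n vs ?Y"
      have "Suc w \<le> ?B m" using bumps_mono[OF m(2), of m] True by simp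
      then have "reach n ((?B(g := c))(m := w, h := ?B m)) (?B(g := c, h := w))"
        by (intro reach_between'[of m h _ _ "?B m"])
          (use 3 Cons.prems in \<open>auto simp: fun_eq_iff\<close>)
      moreover have "(bumps n vs (?Y(g := c)))(m := w, h := bumps n vs (?Y(g := c)) m) =
          (?B(g := c))(m := w, h := ?B m)"
        using 1 3 by simp
      ultimately have "reach n (bumps n vs (?X'(h := Suc t))) (?B(g := c, h := ?B g))"
        using IH unfolding eq fg by (metis rtranclp_trans)
      with IH show ?thesis unfolding valid_ConsI[OF l] m(3) eq by blast
    qed
  qed
qed simp

text \<open>Raising \<open>h\<close> to w before the run is at least as good as doing so after it.
  The raised entry interferes only by capturing the first bump from an entry on its left, and this
  is repaired by \<open>bumps_exchange\<close>.\<close>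

lemma bumps_insert_first:
  assumes "sorted_wrt (<) vs" "\<And>t. t \<in> set vs \<Longrightarrow> w \<le> t" "h < n" "f h < w" "valid n vs f"
  shows "valid n vs (f(h := w)) \<and> reach n (bumps n vs (f(h := w))) ((bumps n vs f)(h := w))"
proof (cases vs)
  case (Cons t us)
  have gt: "t < s" if "s \<in> set us" for s using assms(1) that Cons by simp
  show ?thesis
  proof (cases "t = w")
    case False
    then have fr: "w < s" if "s \<in> set vs" for s
      using assms(2)[of t] gt that Cons by fastforce
    then have "valid n vs (f(h := w)) \<and> bumps n vs (f(h := w)) = (bumps n vs f)(h := w)"
      using assms by (intro bumps_frozen_upd[of _ f]) force+
    then show ?thesis by simp
  next
    case True
    from assms(5) Cons obtain g where g: "is_last n t f g" "valid n us (f(g := Suc t))"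
      "bumps n (t # us) f = bumps n us (f(g := Suc t))" by (metis valid_ConsE)
    have gh: "g \<noteq> h" using g(1) assms True by (auto simp: is_last_def)
    let ?Y = "f(g := Suc w)"
    show ?thesis
    proof (cases "h < g")
      case True': True
      have l: "is_last n t (f(h := w)) g" using g(1) True True' by (auto simp: is_last_def)
      have "valid n us (?Y(h := w)) \<and> bumps n us (?Y(h := w)) = (bumps n us ?Y)(h := w)"
        using assms gt g True gh by (intro bumps_frozen_upd[of _ ?Y]) force+
      then show ?thesis using gh g(3) True unfolding Cons valid_ConsI[OF l] by (simp add: fun_upd_twist)
    next
      case False
      with gh have lt: "g < h" by simp
      have l: "is_last n t (f(h := w)) h" using g(1) lt True assms(3) by (auto simp: is_last_def)
      have "valid n us (?Y(g := w, h := Suc w)) \<and>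
          reach n (bumps n us (?Y(g := w, h := Suc w))) ((bumps n us ?Y)(g := w, h := bumps n us ?Y g))"
        using assms gt g True lt Cons by (intro bumps_exchange[of _ _ _ _ _ ?Y]) force+
      moreover have "?Y(g := w, h := Suc w) = f(h := w, h := Suc t)"
        using g(1) True by (auto simp: fun_eq_iff is_last_def)
      moreover have "Suc w \<le> bumps n us ?Y g" using bumps_mono[of n us ?Y g] g True by simp
      then have "reach n ((bumps n us ?Y)(g := w, h := bumps n us ?Y g)) ((bumps n us ?Y)(h := w))"
        by (intro reach_between'[of g h _ _ "bumps n us ?Y g"])
          (use lt assms in \<open>auto simp: fun_eq_iff\<close>)
      ultimately have "valid n us (f(h := w, h := Suc t)) \<and>
          reach n (bumps n us (f(h := w, h := Suc t))) ((bumps n us (f(g := Suc t)))(h := w))"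
        unfolding True by (metis rtranclp_trans)
      then show ?thesis unfolding Cons valid_ConsI[OF l] g(3) .
    qed
  qed
qed simp

text \<open>If the run over y, ..., v - 1 passes over \<open>h\<close>, the bump at y hits a later
  entry. From then on each bump acts at or to the right of the entry raised before, since that entry
  already carries the next value.\<close>

lemma run_last_index:
  assumes "y \<le> v" "valid n [y..<v] f" "f h = y" "h < n" "bumps n [y..<v] f h = y"
  shows "\<exists>g. h \<le> g \<and> g < n \<and> bumps n [y..<v] f g = v \<and> (y < v \<longrightarrow> h < g)"
  using assms
proof (induction v rule: dec_induct)
  case (step v)
  let ?A = "bumps n [y..<v] f"
  have split: "[y..<Suc v] = [y..<v] @ [v]" using step.hyps by simp
  have val: "valid n [y..<v] f" "valid n [v] ?A" using step.prems(1) unfolding split by auto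
  from val(2) obtain g where g: "is_last n v ?A g" "bumps n [v] ?A = ?A(g := Suc v)"
    by (rule valid_ConsE) simp
  have B: "bumps n [y..<Suc v] f = ?A(g := Suc v)" unfolding split using g(2) by simp
  have Ah: "?A h = y" "g \<noteq> h"
    using step.prems(4) bumps_mono[OF val(1), of h] step.prems(2) step.hyps unfolding B
    by (auto split: if_splits)
  from step.IH[OF val(1) step.prems(2,3) Ah(1)] obtain g' where
    "h \<le> g'" "g' < n" "?A g' = v" by blast
  with g(1) have "h \<le> g" unfolding is_last_def by (metis le_trans not_less)
  with Ah(2) have "h < g" by simp
  moreover have "g < n" using g(1) by (simp add: is_last_def)
  ultimately show ?case unfolding B by (intro exI[of _ g]) simp
qed auto

text \<open>The additional bump at v raises some entry g at or after \<open>h\<close> from v to v +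
  1. A redistribution between \<open>h\<close> and g then hands the unit to
  \<open>h\<close>.\<close>

lemma bumps_insert:
  assumes vs: "vs = us @ [y..<v] @ ws" "valid n vs f" and "y \<le> v"
    and ws: "sorted_wrt (<) ws" "\<And>t. t \<in> set ws \<Longrightarrow> v < t"
    and h: "h < n" "bumps n vs f h = y"
  shows "valid n (us @ [y..<v] @ v # ws) f \<and>
    reach n (bumps n (us @ [y..<v] @ v # ws) f) ((bumps n vs f)(h := Suc y))"
proof -
  let ?f1 = "bumps n us f"
  let ?A = "bumps n [y..<v] ?f1"
  have val: "valid n us f" "valid n [y..<v] ?f1" "valid n ws ?A"
    using vs by auto
  have B: "bumps n vs f = bumps n ws ?A" using vs by simp
  have le: "?f1 h \<le> y" "?A h \<le> y" "?f1 h \<le> ?A h"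
    using bumps_mono[OF val(2), of h] bumps_mono[OF val(3), of h] h B by auto
  \<comment> \<open>An entry below y after \<open>us\<close> would be inert for the remaining values
    and could not end at y.\<close>
  have f1h: "?f1 h = y"
  proof (rule ccontr)
    assume "?f1 h \<noteq> y"
    with le have lt: "?f1 h < y" by simp
    have "bumps n ([y..<v] @ ws) ?f1 h = ?f1 h"
      by (rule bumps_frozen) (use lt ws(2) \<open>y \<le> v\<close> val in fastforce)+
    with lt h B show False by simp
  qed
  with le have Ah: "?A h = y" by simp
  obtain g0 where g0: "h \<le> g0" "g0 < n" "?A g0 = v" "y < v \<longrightarrow> h < g0"
    using run_last_index[OF \<open>y \<le> v\<close> val(2) f1h h(1) Ah] by blast
  obtain g where g: "is_last n v ?A g" using g0 is_last_ex by blast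
  have hg: "h \<le> g" "y < v \<longrightarrow> h < g" "g < n" "?A g = v"
    using g g0 unfolding is_last_def by (metis le_trans not_less less_le_trans less_trans)+
  have ins: "valid n ws (?A(g := Suc v)) \<and>
      reach n (bumps n ws (?A(g := Suc v))) ((bumps n ws ?A)(g := Suc v))"
    by (rule bumps_insert_first) (use ws hg val in force)+
  have Bg: "bumps n ws ?A g = v"
    using bumps_frozen[of ws ?A g n] ws(2) hg(4) val(3) by simp
  have "reach n ((bumps n ws ?A)(g := Suc v)) ((bumps n ws ?A)(h := Suc y))"
  proof (cases "h = g")
    case True
    then have "y = v" using hg(4) Ah by simp
    with True show ?thesis by simp
  next
    case False
    with hg have "h < g" by simp
    have Bh: "bumps n ws ?A h = y" using h B by simp
    show ?thesis
      by (rule reach_between'[of h g _ _ "Suc y"])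
        (use \<open>h < g\<close> hg Bg Bh \<open>y \<le> v\<close> in \<open>auto simp: fun_eq_iff\<close>)
  qed
  with ins have "valid n ws (?A(g := Suc v)) \<and>
      reach n (bumps n ws (?A(g := Suc v))) ((bumps n ws ?A)(h := Suc y))"
    by (metis rtranclp_trans)
  moreover have "valid n (us @ [y..<v] @ v # ws) f \<longleftrightarrow> valid n ws (?A(g := Suc v))"
    using val valid_ConsI(1)[OF g, of ws] by simp
  moreover have "bumps n (us @ [y..<v] @ v # ws) f = bumps n ws (?A(g := Suc v))"
    using valid_ConsI(2)[OF g, of ws] by simp
  ultimately show ?thesis unfolding B by simp
qed

lemma sorted_run_decomposition:
  assumes "sorted_wrt (<) vs" "\<And>u. y \<le> u \<Longrightarrow> u < v \<Longrightarrow> u \<in> set vs" "v \<notin> set vs" "(y::nat) \<le> v"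
  shows "vs = filter (\<lambda>t. t < y) vs @ [y..<v] @ filter (\<lambda>t. v < t) vs"
    (is "_ = ?us @ _ @ ?ws")
proof (rule strict_sorted_equal)
  show "sorted_wrt (<) vs" by fact
  show "sorted_wrt (<) (?us @ [y..<v] @ ?ws)"
    using assms(1,4) by (auto simp: sorted_wrt_append sorted_wrt_filter)
  show "set vs = set (?us @ [y..<v] @ ?ws)"
    using assms(2-4) by (auto simp: not_less) (metis le_neq_implies_less not_less)
qed

lemma bumps_add_one:
  assumes vs: "sorted_wrt (<) vs" "set vs \<subseteq> {..<a}" "valid n vs f"
    and d: "reach n (bumps n vs f) d" "p < n"
    and room: "Suc m \<le> card ({d p..<a} - set vs)"
  shows "\<exists>vs'. sorted_wrt (<) vs' \<and> set vs' \<subseteq> {..<a} \<and> valid n vs' f \<and> length vs' = Suc (length vs) \<and>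
    reach n (bumps n vs' f) (d(p := Suc (d p))) \<and> m \<le> card ({Suc (d p)..<a} - set vs')"
proof -
  let ?B = "bumps n vs f" and ?x = "d p"
  obtain h where h: "h < n" "?B h \<le> ?x" "reach n (?B(h := Suc (?B h))) (d(p := Suc ?x))"
    using reach_increment[OF d] by blast
  let ?y = "?B h"
  have "{?x..<a} - set vs \<noteq> {}" using room by (metis card.empty not_less_eq_eq le0)
  then obtain u where "u \<in> {?x..<a} - set vs" by blast
  then have u: "?x \<le> u" "u < a" "u \<notin> set vs" by auto
  define v where "v = (LEAST v. ?y \<le> v \<and> v \<notin> set vs)"
  have P: "?y \<le> u \<and> u \<notin> set vs" using u h by simp
  have v: "?y \<le> v" "v \<notin> set vs" "v < a"
    unfolding v_def using LeastI[of "\<lambda>v. ?y \<le> v \<and> v \<notin> set vs", OF P] u(2)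
      Least_le[of "\<lambda>v. ?y \<le> v \<and> v \<notin> set vs", OF P] by auto
  have mem: "w \<in> set vs" if "?y \<le> w" "w < v" for w
    using not_less_Least[of w "\<lambda>v. ?y \<le> v \<and> v \<notin> set vs"] that by (auto simp: v_def)
  define us where "us = filter (\<lambda>t. t < ?y) vs"
  define ws where "ws = filter (\<lambda>t. v < t) vs"
  have dec: "vs = us @ [?y..<v] @ ws"
    unfolding us_def ws_def by (rule sorted_run_decomposition) (use vs v mem in auto)
  let ?vs' = "us @ [?y..<v] @ v # ws"
  have ws: "sorted_wrt (<) ws" "\<And>t. t \<in> set ws \<Longrightarrow> v < t"
    using vs(1) by (auto simp: ws_def sorted_wrt_filter)
  have ins: "valid n ?vs' f" "reach n (bumps n ?vs' f) (?B(h := Suc ?y))"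
    using bumps_insert[OF dec vs(3) v(1) ws h(1) refl] by auto
  have set': "set ?vs' = insert v (set vs)" using arg_cong[OF dec, of set] by auto
  have "sorted_wrt (<) ?vs'"
    using v(1) ws(1) vs(1) by (auto simp: sorted_wrt_append us_def sorted_wrt_filter dest!: ws(2))
  moreover have "length ?vs' = Suc (length vs)" using arg_cong[OF dec, of length] by simp
  moreover have "reach n (bumps n ?vs' f) (d(p := Suc ?x))"
    using ins(2) h(3) by (rule rtranclp_trans)
  moreover have "m \<le> card ({Suc ?x..<a} - set ?vs')"
  proof -
    obtain w where "({?x..<a} - set vs) - {w} \<subseteq> {Suc ?x..<a} - insert v (set vs)"
    proof (cases "?x \<in> set vs \<or> v < ?x")
      case True
      show ?thesis
      proof (cases "v < ?x")
        case True
        then show ?thesis by (intro that[of ?x]) auto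
      next
        case False
        with \<open>?x \<in> set vs \<or> v < ?x\<close> show ?thesis
          by (intro that[of v]) (auto simp: Suc_le_eq le_less)
      qed
    next
      case False
      with mem[of ?x] h(2) have "v = ?x" by (meson linorder_neqE_nat)
      then show ?thesis by (intro that[of ?x]) auto
    qed
    then have "card (({?x..<a} - set vs) - {w}) \<le> card ({Suc ?x..<a} - set ?vs')"
      unfolding set' by (intro card_mono) auto
    moreover have "card ({?x..<a} - set vs) - 1 \<le> card (({?x..<a} - set vs) - {w})"
      by (simp add: card_Diff_singleton_if)
    ultimately show ?thesis using room by linarith
  qed
  moreover have "set ?vs' \<subseteq> {..<a}" using set' v vs by auto
  ultimately show ?thesis using ins(1) by blast
qed

lemma bumps_add_many:
  assumes "sorted_wrt (<) vs" "set vs \<subseteq> {..<a}" "valid n vs f"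
    and "reach n (bumps n vs f) d" "p < n" "k \<le> card ({d p..<a} - set vs)"
  shows "\<exists>vs'. sorted_wrt (<) vs' \<and> set vs' \<subseteq> {..<a} \<and> valid n vs' f \<and> length vs' = length vs + k \<and>
    reach n (bumps n vs' f) (d(p := d p + k))"
  using assms
proof (induction k arbitrary: vs d)
  case 0
  then show ?case by auto
next
  case (Suc k)
  from bumps_add_one[OF Suc.prems] obtain us where us: "sorted_wrt (<) us" "set us \<subseteq> {..<a}" "valid n us f"
    "length us = Suc (length vs)" "reach n (bumps n us f) (d(p := Suc (d p)))"
    "k \<le> card ({Suc (d p)..<a} - set us)" by blast
  have "k \<le> card ({(d(p := Suc (d p))) p..<a} - set us)" using us(6) by simp
  from Suc.IH[OF us(1-3,5) Suc.prems(5) this] obtain ws where ws: "sorted_wrt (<) ws"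
    "set ws \<subseteq> {..<a}" "valid n ws f" "length ws = length us + k"
    "reach n (bumps n ws f) ((d(p := Suc (d p)))(p := (d(p := Suc (d p))) p + k))" by blast
  have "(d(p := Suc (d p)))(p := (d(p := Suc (d p))) p + k) = d(p := d p + Suc k)"
    by (simp add: fun_eq_iff)
  with ws us(4) show ?case by (metis add_Suc_shift)
qed

text \<open>One term of the branching rule accounts for b: the values in \<open>vs\<close> are
  bumped, the remaining \<open>b n\<close> give the exponent of the last variable. The auxiliary d
  is there because \<open>reach\<close> compares functions on all indices, whereas b is prescribed
  only below n.\<close>

definition outcome :: "nat \<Rightarrow> (nat \<Rightarrow> nat) \<Rightarrow> (nat \<Rightarrow> nat) \<Rightarrow> bool" where
  "outcome n f b \<longleftrightarrow> (\<exists>vs d. sorted_wrt (<) vs \<and> set vs \<subseteq> {..<f n} \<and> valid n vs f \<and>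
     length vs + b n = f n \<and> reach n (bumps n vs f) d \<and> agree n d b)"

lemma outcome_refl: "outcome n f f"
  unfolding outcome_def by (rule exI[of _ "[]"], rule exI[of _ f]) (simp add: agree_def)

lemma outcome_mv:
  assumes "outcome n f b" "mv (Suc n) b b'"
  shows "outcome n f b'"
proof -
  from assms(1) obtain vs d where vs: "sorted_wrt (<) vs" "set vs \<subseteq> {..<f n}" "valid n vs f"
    "length vs + b n = f n" and d: "reach n (bumps n vs f) d" "agree n d b"
    unfolding outcome_def by blast
  from assms(2) obtain p q c where pq: "p < q" "q < Suc n" "b p < c" "c \<le> b q"
    and b': "b' = b(p := c, q := b p + b q - c)" by (rule mv_cases)
  show ?thesis
  proof (cases "q < n")
    case True
    let ?d = "d(p := c, q := d p + d q - c)"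
    have dpq: "d p = b p" "d q = b q" using d(2) pq True by (auto simp: agree_def)
    have "reach n d ?d" by (rule reach_between) (use pq True dpq in auto)
    with d(1) have "reach n (bumps n vs f) ?d" by (rule rtranclp_trans)
    moreover have "agree n ?d b'" using d(2) pq True by (auto simp: agree_def b')
    moreover have "b' n = b n" using pq True by (simp add: b')
    ultimately show ?thesis using vs unfolding outcome_def by metis
  next
    case False
    with pq have q: "q = n" and p: "p < n" by auto
    have dp: "d p = b p" using d(2) p by (simp add: agree_def)
    let ?k = "c - b p"
    \<comment> \<open>The range contains f n - b p values, and at most f n - b n are used. At least
      b n - b p remain, and c is at most b n.\<close>
    have "?k \<le> card ({d p..<f n} - set vs)"
    proof -
      have "distinct vs" using vs(1) by (simp add: strict_sorted_iff)
      then have "card (set vs) = length vs" by (rule distinct_card)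
      moreover have "card {d p..<f n} - card (set vs) \<le> card ({d p..<f n} - set vs)"
        by (rule diff_card_le_card_Diff) simp
      ultimately show ?thesis using vs(4) pq q dp by simp
    qed
    from bumps_add_many[OF vs(1-3) d(1) p this] obtain us where
      us: "sorted_wrt (<) us" "set us \<subseteq> {..<f n}" "valid n us f" "length us = length vs + ?k"
      "reach n (bumps n us f) (d(p := d p + ?k))" by blast
    have "agree n (d(p := d p + ?k)) b'" using d(2) p pq q dp by (auto simp: agree_def b')
    moreover have "length us + b' n = f n" using us(4) vs(4) pq q by (simp add: b')
    ultimately show ?thesis using us unfolding outcome_def by blast
  qed
qed

lemma reach_outcome: "reach (Suc n) f b \<Longrightarrow> outcome n f b"
  by (induction rule: rtranclp_induct) (auto simp: outcome_refl outcome_mv)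

subsection \<open>Coefficients\<close>

definition mon :: "nat \<Rightarrow> (nat \<Rightarrow> nat) \<Rightarrow> nat monom" where
  "mon n b = (\<Sum>i<n. Poly_Mapping.single i (b i))"

lemma expo_mon: "expo (mon n b) i = (if i < n then b i else 0)"
  by (simp add: mon_def lookup_sum lookup_single when_def)

lemma mon_Suc: "mon (Suc n) b = mon n b + Poly_Mapping.single n (b n)"
  by (simp add: mon_def)

lemma mon_agree: "agree n b c \<Longrightarrow> mon n b = mon n c"
  by (intro poly_mapping_eqI) (auto simp: expo_mon agree_def)

lemma row_op_nonneg:
  "(\<And>g m. 0 \<le> coeff_of (F g) m) \<Longrightarrow> 0 \<le> coeff_of (row_op n (Var k) a F f) m"
proof (induction a arbitrary: F)
  case (Suc a)
  have "0 \<le> coeff_of (step_op n (Var k) a F g) m" for g m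
    by (simp add: step_op_def bump_op_def lookup_add coeff_Var_times Suc.prems)
  then show ?case by (simp add: Suc.IH)
qed simp

lemma bump_poly_nonneg: "0 \<le> coeff_of (bump_poly n f) m"
  by (induction n arbitrary: f m) (auto simp: row_op_nonneg lookup_one when_def)

text \<open>An increasing valid bump sequence is one term of the expanded row; the other terms are
  nonnegative, so this term is a lower bound.\<close>

lemma row_op_lower:
  assumes "sorted_wrt (<) vs" "set vs \<subseteq> {..<a}" "valid n vs f" "\<And>g m. 0 \<le> coeff_of (F g) m"
  shows "coeff_of (Var k ^ (a - length vs) * F (bumps n vs f)) m \<le> coeff_of (row_op n (Var k) a F f) m"
  using assms
proof (induction a arbitrary: F vs m)
  case (Suc a)
  let ?S = "step_op n (Var k) a F"
  have S: "0 \<le> coeff_of (?S g) m" for g m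
    by (simp add: step_op_def bump_op_def lookup_add coeff_Var_times Suc.prems)
  show ?case
  proof (cases "a \<in> set vs")
    case False
    with Suc.prems(2) have sub: "set vs \<subseteq> {..<a}" by (auto simp: less_Suc_eq)
    have "distinct vs" using Suc.prems(1) by (simp add: strict_sorted_iff)
    with sub have len: "length vs \<le> a"
      by (metis card_lessThan card_mono distinct_card finite_lessThan)
    have le: "coeff_of (Var k * F (bumps n vs f)) m \<le> coeff_of (?S (bumps n vs f)) m" for m
      by (simp add: step_op_def bump_op_def lookup_add Suc.prems)
    have "coeff_of (Var k ^ (Suc a - length vs) * F (bumps n vs f)) m =
        coeff_of (Var k ^ (a - length vs) * (Var k * F (bumps n vs f))) m"
      using len by (simp add: Suc_diff_le mult_ac)
    also have "\<dots> \<le> coeff_of (Var k ^ (a - length vs) * ?S (bumps n vs f)) m"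
      using le by (simp add: coeff_Var_power_times)
    also have "\<dots> \<le> coeff_of (row_op n (Var k) a ?S f) m"
      by (rule Suc.IH) (use Suc.prems sub S in auto)
    finally show ?thesis by simp
  next
    case True
    define us where "us = filter (\<lambda>t. t < a) vs"
    have vs: "vs = us @ [a]"
    proof (rule strict_sorted_equal)
      show "set vs = set (us @ [a])" using True Suc.prems(2) by (auto simp: us_def less_Suc_eq)
    qed (use Suc.prems(1) in \<open>auto simp: us_def sorted_wrt_append sorted_wrt_filter\<close>)
    have us: "sorted_wrt (<) us" "set us \<subseteq> {..<a}" "valid n us f"
      using Suc.prems unfolding vs by (auto simp: sorted_wrt_append)
    have ex: "\<exists>i<n. bumps n us f i = a" using Suc.prems(3) unfolding vs by simp
    have le: "coeff_of (F (bumps n vs f)) m \<le> coeff_of (?S (bumps n us f)) m" for m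
      using ex by (simp add: vs step_op_def bump_op_def lookup_add coeff_Var_times Suc.prems)
    have "coeff_of (Var k ^ (Suc a - length vs) * F (bumps n vs f)) m =
        coeff_of (Var k ^ (a - length us) * F (bumps n vs f)) m"
      by (simp add: vs)
    also have "\<dots> \<le> coeff_of (Var k ^ (a - length us) * ?S (bumps n us f)) m"
      using le by (simp add: coeff_Var_power_times)
    also have "\<dots> \<le> coeff_of (row_op n (Var k) a ?S f) m"
      by (rule Suc.IH) (use us S in auto)
    finally show ?thesis by simp
  qed
qed simp

lemma bump_poly_support_lower: "reach n f b \<Longrightarrow> 0 < coeff_of (bump_poly n f) (mon n b)"
proof (induction n arbitrary: f b)
  case (Suc n)
  from reach_outcome[OF Suc.prems] obtain vs d where vs: "sorted_wrt (<) vs" "set vs \<subseteq> {..<f n}"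
    "valid n vs f" "length vs + b n = f n" and d: "reach n (bumps n vs f) d" "agree n d b"
    unfolding outcome_def by blast
  have "0 < coeff_of (bump_poly n (bumps n vs f)) (mon n b)"
    using Suc.IH[OF d(1)] mon_agree[OF d(2)] by simp
  also have "\<dots> = coeff_of (Var n ^ (f n - length vs) * bump_poly n (bumps n vs f)) (mon (Suc n) b)"
    using vs(4) by (simp add: coeff_Var_power_times lookup_add expo_mon mon_Suc flip: vs(4))
  also have "\<dots> \<le> coeff_of (bump_poly (Suc n) f) (mon (Suc n) b)"
    using row_op_lower[OF vs(1-3), of "bump_poly n" n] by (simp add: bump_poly_nonneg)
  finally show ?case .
qed (simp add: mon_def)

text \<open>The top power of the row variable comes from the empty bump sequence only.\<close>

lemma row_op_top:
  assumes "\<And>g m. d < expo m k \<Longrightarrow> coeff_of (F g) m = 0" "expo m k = a + d"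
  shows "coeff_of (row_op n (Var k) a F f) m = coeff_of (F f) (m - Poly_Mapping.single k a)"
  using assms
proof (induction a arbitrary: F d)
  case (Suc a)
  have "coeff_of (step_op n (Var k) a F g) m = 0" if "Suc d < expo m k" for g m
    using that Suc.prems(1)
    by (simp add: step_op_def bump_op_def lookup_add coeff_Var_times lookup_minus)
  from Suc.IH[OF this] Suc.prems(2)
  have "coeff_of (row_op n (Var k) (Suc a) F f) m =
      coeff_of (step_op n (Var k) a F f) (m - Poly_Mapping.single k a)"
    by simp
  also have "\<dots> = coeff_of (F f) (m - Poly_Mapping.single k a - Poly_Mapping.single k 1)"
    using Suc.prems by (simp add: step_op_def bump_op_def lookup_add coeff_Var_times lookup_minus)
  also have "m - Poly_Mapping.single k a - Poly_Mapping.single k 1 = m - Poly_Mapping.single k (Suc a)"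
    by (intro poly_mapping_eqI) (auto simp: lookup_minus lookup_single when_def)
  finally show ?case .
qed simp

section \<open>Coefficients of key polynomials\<close>

definition in_vars :: "nat \<Rightarrow> nat mpoly \<Rightarrow> bool" where
  "in_vars n p \<longleftrightarrow> (\<forall>m j. n \<le> j \<and> 0 < expo m j \<longrightarrow> coeff_of p m = 0)"

lemma in_varsD: "in_vars n p \<Longrightarrow> n \<le> j \<Longrightarrow> 0 < expo m j \<Longrightarrow> coeff_of p m = 0"
  unfolding in_vars_def by blast

lemma in_vars_row_op:
  "(\<And>g. in_vars n (F g)) \<Longrightarrow> k < n \<Longrightarrow> in_vars n (row_op l (Var k) a F f)"
proof (induction a arbitrary: F)
  case (Suc a)
  have "in_vars n (step_op l (Var k) a F g)" for g
    unfolding in_vars_def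
  proof (intro allI impI)
    fix m j assume j: "n \<le> j \<and> 0 < expo m j"
    then have "expo (m - Poly_Mapping.single k 1) j = expo m j"
      using Suc.prems(2) by (simp add: lookup_minus lookup_single)
    with j have "coeff_of (F g) (m - Poly_Mapping.single k 1) = 0"
      by (intro in_varsD[OF Suc.prems(1)]) auto
    moreover have "coeff_of (F g') m = 0" for g'
      by (rule in_varsD[OF Suc.prems(1)]) (use j in auto)
    ultimately show "coeff_of (step_op l (Var k) a F g) m = 0"
      by (simp add: step_op_def bump_op_def lookup_add coeff_Var_times)
  qed
  then show ?case using Suc by simp
qed simp

lemma in_vars_mono: "in_vars n p \<Longrightarrow> n \<le> k \<Longrightarrow> in_vars k p"
  unfolding in_vars_def by (meson le_trans)

lemma in_vars_bump_poly: "in_vars n (bump_poly n f)"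
proof (induction n arbitrary: f)
  case (Suc n)
  then have "in_vars (Suc n) (bump_poly n g)" for g by (rule in_vars_mono) simp
  then show ?case by (simp add: in_vars_row_op)
qed (auto simp: in_vars_def lookup_one when_def)

lemma Var_power: "Var v ^ k = Poly_Mapping.single (Poly_Mapping.single v k) (1 :: int)"
proof (induction k)
  case (Suc k)
  have "Poly_Mapping.single v (Suc k) = Poly_Mapping.single v 1 + Poly_Mapping.single v k"
    by (simp flip: single_add)
  then show ?case using Suc by (simp add: Var_def mult_single)
qed (simp add: single_one)

lemma prod_single:
  "(\<Prod>a\<in>A. Poly_Mapping.single (h a) (1::int)) = Poly_Mapping.single (\<Sum>a\<in>A. h a) 1"
  by (induction A rule: infinite_finite_induct) (auto simp: mult_single single_one)

text \<open>A variable with \<open>g k = None\<close> is set to zero and the others are renamed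
  injectively. This covers the transposition of two variables, the deletion of one, and the passage
  to the alphabets.\<close>

lemma coeff_subst_monom_partial:
  fixes g :: "nat \<Rightarrow> 'v option" and M :: "'v monom"
  assumes \<sigma>: "\<And>k. k < n \<Longrightarrow> \<sigma> k = (case g k of None \<Rightarrow> 0 | Some v \<Rightarrow> Var v)"
    and inj: "\<And>k l v. k < n \<Longrightarrow> l < n \<Longrightarrow> g k = Some v \<Longrightarrow> g l = Some v \<Longrightarrow> k = l"
    and m: "Poly_Mapping.keys m \<subseteq> {..<n}"
  shows "coeff_of (subst_monom \<sigma> m) M = (if (\<forall>v\<in>Poly_Mapping.keys M. \<exists>k<n. g k = Some v) \<and>
     m = mon n (\<lambda>k. case g k of None \<Rightarrow> 0 | Some v \<Rightarrow> expo M v) then 1 else 0)"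
    (is "_ = (if ?C \<and> m = ?m0 then 1 else 0)")
proof -
  have sm: "subst_monom \<sigma> m = (\<Prod>k<n. \<sigma> k ^ expo m k)"
    using m by (simp add: subst_monom_superset[of "{..<n}"])
  show ?thesis
  proof (cases "\<exists>k<n. 0 < expo m k \<and> g k = None")
    case True
    then obtain k where k: "k < n" "0 < expo m k" "g k = None" by blast
    then have "subst_monom \<sigma> m = 0"
      unfolding sm using \<sigma>[OF k(1)] by (intro prod_zero) (auto simp: power_0_left intro!: bexI[of _ k])
    moreover have "m \<noteq> ?m0"
    proof
      assume "m = ?m0"
      from arg_cong[OF this, of "\<lambda>m. expo m k"] k show False by (simp add: expo_mon)
    qed
    ultimately show ?thesis by simp
  next
    case False
    define push where "push = (\<Sum>k<n. case g k of None \<Rightarrow> 0 | Some v \<Rightarrow> Poly_Mapping.single v (expo m k))"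
    have "\<sigma> k ^ expo m k = Poly_Mapping.single (case g k of None \<Rightarrow> 0 | Some v \<Rightarrow> Poly_Mapping.single v (expo m k)) 1"
      if "k < n" for k
      using that False \<sigma>[OF that] by (auto simp: Var_power single_one split: option.splits)
    then have "subst_monom \<sigma> m = Poly_Mapping.single push 1"
      unfolding sm push_def prod_single[symmetric] by (intro prod.cong) auto
    then have LHS: "coeff_of (subst_monom \<sigma> m) M = (if push = M then 1 else 0)"
      by (simp add: lookup_single when_def)
    have push: "expo push v = expo m k" if "k < n" "g k = Some v" for k v
    proof -
      have "expo push v = (\<Sum>l<n. if l = k then expo m k else 0)"
        unfolding push_def lookup_sum
        using that inj by (intro sum.cong) (auto simp: lookup_single when_def split: option.splits)
      with that show ?thesis by simp
    qed
    have push0: "expo push v = 0" if "\<forall>k<n. g k \<noteq> Some v" for v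
      unfolding push_def lookup_sum using that
      by (intro sum.neutral) (auto simp: lookup_single when_def split: option.splits)
    have "push = M \<longleftrightarrow> ?C \<and> m = ?m0"
    proof
      assume M: "push = M"
      have "m = ?m0"
      proof (intro poly_mapping_eqI)
        fix k
        show "expo m k = expo ?m0 k"
          using m False push[of k] M
          by (cases "k < n") (auto simp: expo_mon not_in_keys_iff_lookup_eq_zero split: option.splits)
      qed
      moreover have ?C using push0 M by (auto simp: in_keys_iff)
      ultimately show "?C \<and> m = ?m0" by blast
    next
      assume C: "?C \<and> m = ?m0"
      show "push = M"
      proof (intro poly_mapping_eqI)
        fix v
        show "expo push v = expo M v"
        proof (cases "\<exists>k<n. g k = Some v")
          case True
          then obtain k where k: "k < n" "g k = Some v" by blast
          have "expo m k = expo ?m0 k" using C by simp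
          then show ?thesis using push[OF k] k by (simp add: expo_mon)
        next
          case False
          then have "v \<notin> Poly_Mapping.keys M" using C by blast
          with False push0 show ?thesis by (auto simp: not_in_keys_iff_lookup_eq_zero)
        qed
      qed
    qed
    then show ?thesis unfolding LHS by simp
  qed
qed

lemma coeff_subst_partial:
  fixes g :: "nat \<Rightarrow> 'v option" and M :: "'v monom"
  assumes p: "in_vars n p"
    and \<sigma>: "\<And>k. k < n \<Longrightarrow> \<sigma> k = (case g k of None \<Rightarrow> 0 | Some v \<Rightarrow> Var v)"
    and inj: "\<And>k l v. k < n \<Longrightarrow> l < n \<Longrightarrow> g k = Some v \<Longrightarrow> g l = Some v \<Longrightarrow> k = l"
  shows "coeff_of (subst \<sigma> p) M = (if \<forall>v\<in>Poly_Mapping.keys M. \<exists>k<n. g k = Some v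
     then coeff_of p (mon n (\<lambda>k. case g k of None \<Rightarrow> 0 | Some v \<Rightarrow> expo M v)) else 0)"
    (is "_ = (if ?C then coeff_of p ?m0 else 0)")
proof -
  have keys: "Poly_Mapping.keys m \<subseteq> {..<n}" if "m \<in> Poly_Mapping.keys p" for m
    using p that unfolding in_vars_def by (metis in_keys_iff lessThan_iff not_le not_gr_zero subsetI)
  have Const: "coeff_of (Const c * q) M = c * coeff_of q M" for c and q :: "'v mpoly"
    by (simp add: Const_def coeff_single_times)
  have "coeff_of (subst \<sigma> p) M = (\<Sum>m\<in>Poly_Mapping.keys p. coeff_of p m * coeff_of (subst_monom \<sigma> m) M)"
    by (subst subst_superset[of "Poly_Mapping.keys p"]) (auto simp: lookup_sum Const)
  also have "\<dots> = (\<Sum>m\<in>Poly_Mapping.keys p. if m = ?m0 then (if ?C then coeff_of p ?m0 else 0) else 0)"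
    using keys by (intro sum.cong) (auto simp: coeff_subst_monom_partial[OF \<sigma> inj])
  also have "\<dots> = (if ?C then coeff_of p ?m0 else 0)"
    by (auto simp: in_keys_iff)
  finally show ?thesis .
qed

lemma coeff_swap_vars:
  assumes "in_vars n p" "Suc i < n"
  shows "coeff_of (swap_vars i p) (mon n b) = coeff_of p (mon n (b \<circ> transpose i (Suc i)))"
proof -
  let ?t = "transpose i (Suc i)"
  have t: "?t k < n \<longleftrightarrow> k < n" for k using assms(2) by (auto simp: transpose_def)
  have C: "\<forall>v\<in>Poly_Mapping.keys (mon n b). \<exists>k<n. Some (?t k) = Some v"
  proof
    fix v assume "v \<in> Poly_Mapping.keys (mon n b)"
    then have "v < n" by (auto simp: in_keys_iff expo_mon split: if_splits)
    then show "\<exists>k<n. Some (?t k) = Some v" using t by (intro exI[of _ "?t v"]) simp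
  qed
  have "coeff_of (swap_vars i p) (mon n b) = coeff_of p (mon n (\<lambda>k. expo (mon n b) (?t k)))"
    unfolding swap_vars_def
    by (subst coeff_subst_partial[OF assms(1), where g = "\<lambda>k. Some (?t k)"])
      (use C in \<open>auto dest: transpose_eq_imp_eq\<close>)
  also have "mon n (\<lambda>k. expo (mon n b) (?t k)) = mon n (b \<circ> ?t)"
    by (rule mon_agree) (simp add: agree_def expo_mon t)
  finally show ?thesis .
qed

lemma coeff_symmetric:
  assumes "Suc i < n" "f i \<le> f (Suc i)"
  shows "coeff_of (bump_poly n f) (mon n (b \<circ> transpose i (Suc i))) = coeff_of (bump_poly n f) (mon n b)"
  using coeff_swap_vars[OF in_vars_bump_poly assms(1), of f b] bump_poly_symmetric[OF assms] by simp

subsection \<open>The support of a key polynomial\<close>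

lemma coeff_Var_times_mon:
  "i < n \<Longrightarrow> coeff_of (Var i * p) (mon n b) =
    (if 0 < b i then coeff_of p (mon n (b(i := b i - 1))) else 0)"
proof -
  assume i: "i < n"
  have "mon n b - Poly_Mapping.single i 1 = mon n (b(i := b i - 1))"
    using i by (intro poly_mapping_eqI) (auto simp: lookup_minus expo_mon lookup_single when_def)
  then show ?thesis using i by (simp add: coeff_Var_times expo_mon)
qed

text \<open>Reachability up to the entries from n on, which \<open>mon n b\<close> does not
  see.\<close>

definition reaches :: "nat \<Rightarrow> (nat \<Rightarrow> nat) \<Rightarrow> (nat \<Rightarrow> nat) \<Rightarrow> bool" where
  "reaches n f b \<longleftrightarrow> (\<exists>b'. reach n f b' \<and> agree n b' b)"

lemma reaches_between:
  assumes "reaches n f b" "p < q" "q < n" "b p \<le> c" "c \<le> b q" "agree n g (b(p := c, q := b p + b q - c))"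
  shows "reaches n f g"
proof -
  from assms(1) obtain b' where b': "reach n f b'" "agree n b' b" by (auto simp: reaches_def)
  have eq: "b' p = b p" "b' q = b q" using b'(2) assms(2,3) by (auto simp: agree_def)
  have "reach n b' (b'(p := c, q := b' p + b' q - c))"
    by (rule reach_between) (use assms eq in auto)
  with b'(1) have "reach n f (b'(p := c, q := b' p + b' q - c))" by (rule rtranclp_trans)
  moreover have "agree n (b'(p := c, q := b' p + b' q - c)) g"
    using b'(2) assms(6) eq by (auto simp: agree_def)
  ultimately show ?thesis by (auto simp: reaches_def)
qed

lemma reaches_transpose:
  assumes "Suc i < n" "f i \<le> f (Suc i)" "reaches n f b"
  shows "reaches n f (b \<circ> transpose i (Suc i))"
proof -
  from assms(3) obtain b' where b': "reach n f b'" "agree n b' b" by (auto simp: reaches_def)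
  from b'(2) assms(1) have "agree n (b' \<circ> transpose i (Suc i)) (b \<circ> transpose i (Suc i))"
    by (auto simp: agree_def transpose_def)
  with reach_transpose[OF assms(1,2) b'(1)] show ?thesis by (auto simp: reaches_def)
qed

text \<open>Along one \<open>i\<close>-string, the coefficients \<open>g\<^sub>j\<close> of the quotient satisfy
  \<open>g\<^sub>j - g\<^sub>j\<^sub>-\<^sub>1 = c\<^sub>j - c\<^sub>k\<^sub>+\<^sub>1\<^sub>-\<^sub>j\<close>, where \<open>c\<close> are the coefficients of the original polynomial.\<close>

lemma bump_poly_support_upper:
  "coeff_of (bump_poly n f) (mon n b) \<noteq> 0 \<Longrightarrow> reaches n f b"
proof (induction "\<Sum>k<n. k * f k" arbitrary: f b rule: less_induct)
  case less
  show ?case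
  proof (cases "\<forall>i. Suc i < n \<longrightarrow> f (Suc i) \<le> f i")
    case True
    have "f j \<le> f i" if "i < j" "j < n" for i j
      using that
    proof (induction j)
      case (Suc j)
      then have "f (Suc j) \<le> f j" using True by blast
      with Suc show ?case by (cases "i = j") auto
    qed simp
    then have "bump_poly n f = (\<Prod>k<n. Var k ^ f k)" by (rule bump_poly_dominant)
    also have "\<dots> = Poly_Mapping.single (mon n f) 1"
      by (simp add: Var_power prod_single mon_def)
    finally have "mon n f = mon n b"
      using less.prems by (auto simp: lookup_single when_def split: if_splits)
    then have "expo (mon n f) i = expo (mon n b) i" for i by simp
    then have "agree n f b" unfolding expo_mon agree_def by metis
    then show ?thesis unfolding reaches_def by blast
  next
    case False
    then obtain i where i: "Suc i < n" "f i < f (Suc i)" by (auto simp: not_le)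
    let ?t = "transpose i (Suc i)"
    let ?f0 = "f \<circ> ?t"
    have f0: "sort_at i ?f0 = f" using i by (auto simp: sort_at_def fun_eq_iff transpose_def)
    have mv0: "reach n f ?f0"
      by (rule reach_transpose) (use i in auto)
    have IH: "reaches n f c" if "coeff_of (bump_poly n ?f0) (mon n c) \<noteq> 0" for c
    proof -
      have "reaches n ?f0 c" by (rule less.hyps[OF sum_transpose_descent that]) (use i in auto)
      then show ?thesis using mv0 unfolding reaches_def by (meson rtranclp_trans)
    qed
    let ?P = "\<lambda>c. coeff_of (bump_poly n f) (mon n c)" and ?Q = "\<lambda>c. coeff_of (bump_poly n ?f0) (mon n c)"
    have "(Var i - Var (Suc i)) * bump_poly n f =
        Var i * bump_poly n ?f0 - Var (Suc i) * swap_vars i (bump_poly n ?f0)"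
      using key_rel_bump_poly[OF i(1)] f0 unfolding key_rel_def by metis
    then have rel: "coeff_of (Var i * bump_poly n f) m - coeff_of (Var (Suc i) * bump_poly n f) m =
        coeff_of (Var i * bump_poly n ?f0) m - coeff_of (Var (Suc i) * swap_vars i (bump_poly n ?f0)) m" for m
      by (metis left_diff_distrib lookup_minus)
    \<comment> \<open>One half of the string suffices, by the symmetry at i. The induction runs
      towards its end, where the entry at \<open>Suc i\<close> is zero.\<close>
    have main: "reaches n f c" if "c (Suc i) \<le> c i" "?P c \<noteq> 0" for c
      using that
    proof (induction "c (Suc i)" arbitrary: c rule: less_induct)
      case inner: less
      let ?c1 = "c(i := Suc (c i), Suc i := c (Suc i) - 1)"
      \<comment> \<open>This compares the coefficients of x_i times x^c in the key relation.\<close>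
      have r: "?P c - (if 0 < c (Suc i) then ?P ?c1 else 0) =
          ?Q c - (if 0 < c (Suc i) then ?Q (?c1 \<circ> ?t) else 0)"
        using rel[of "mon n (c(i := Suc (c i)))"] i(1)
        by (simp add: coeff_Var_times_mon coeff_swap_vars[OF in_vars_bump_poly] split: if_splits)
      \<comment> \<open>The exchanged \<open>?c1\<close> ascends at i and spans the part of the
        string that contains c.\<close>
      have end': "reaches n f c" if "reaches n f (?c1 \<circ> ?t)" "0 < c (Suc i)"
        by (rule reaches_between[OF that(1), of i "Suc i" "c i"])
          (use i that(2) inner.prems(1) in \<open>auto simp: agree_def transpose_def\<close>)
      have "\<not> (?Q c = 0 \<and> (0 < c (Suc i) \<longrightarrow> ?P ?c1 = 0 \<and> ?Q (?c1 \<circ> ?t) = 0))"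
      proof
        assume "?Q c = 0 \<and> (0 < c (Suc i) \<longrightarrow> ?P ?c1 = 0 \<and> ?Q (?c1 \<circ> ?t) = 0)"
        with r have "?P c = 0" by (simp split: if_splits)
        with inner.prems(2) show False by contradiction
      qed
      then consider "?Q c \<noteq> 0" | "0 < c (Suc i)" "?P ?c1 \<noteq> 0" | "0 < c (Suc i)" "?Q (?c1 \<circ> ?t) \<noteq> 0"
        by metis
      then show ?case
      proof cases
        case 1
        then show ?thesis by (rule IH)
      next
        case 2
        then have "reaches n f ?c1" using inner.prems(1) by (intro inner.hyps) auto
        then have "reaches n f (?c1 \<circ> ?t)" using i by (intro reaches_transpose) auto
        with 2 show ?thesis by (intro end')
      next
        case 3
        then show ?thesis by (intro end' IH)
      qed
    qed
    \<comment> \<open>An ascending b is handled through its mirror image, which has the same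
      coefficient because f ascends at i.\<close>
    show ?thesis
    proof (cases "b (Suc i) \<le> b i")
      case True
      with main less.prems show ?thesis by blast
    next
      case False
      have "reaches n f (b \<circ> ?t)"
        by (rule main) (use False less.prems i coeff_symmetric[of i n f b] in auto)
      with i have "reaches n f ((b \<circ> ?t) \<circ> ?t)" by (meson less_imp_le reaches_transpose)
      moreover have "(b \<circ> ?t) \<circ> ?t = b" by (auto simp: fun_eq_iff)
      ultimately show ?thesis by simp
    qed
  qed
qed

theorem bump_poly_support: "coeff_of (bump_poly n f) (mon n b) \<noteq> 0 \<longleftrightarrow> reaches n f b"
  using bump_poly_support_upper bump_poly_support_lower mon_agree unfolding reaches_def
  by (metis less_irrefl)

lemma bump_poly_leading: "coeff_of (bump_poly n f) (mon n f) = 1"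
proof (induction n arbitrary: f)
  case (Suc n)
  have "coeff_of (bump_poly (Suc n) f) (mon (Suc n) f) =
      coeff_of (bump_poly n f) (mon (Suc n) f - Poly_Mapping.single n (f n))"
    unfolding bump_poly.simps
    by (rule row_op_top[of 0]) (use in_vars_bump_poly[of n] in \<open>auto simp: in_vars_def expo_mon\<close>)
  also have "mon (Suc n) f - Poly_Mapping.single n (f n) = mon n f"
    by (simp add: mon_Suc)
  finally show ?case using Suc by simp
qed (simp add: mon_def)

subsection \<open>Deleting a zero entry\<close>

definition ins :: "nat \<Rightarrow> nat \<Rightarrow> (nat \<Rightarrow> nat) \<Rightarrow> nat \<Rightarrow> nat" where
  "ins k c f j = (if j < k then f j else if j = k then c else f (j - 1))"

text \<open>For z = 0 the row is the full product of the bumps u_0, ..., u_(c-1). For v > c the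
  values are far apart; for v < c the neighbours u_(v-1) and u_(v+1) are passed by the plactic
  relations. The excluded case v = c is the bump that makes the row longer.\<close>

lemma bump_full_row_commute:
  assumes "v \<noteq> c"
  shows "bump_op k v (row_op k 0 c G) = row_op k 0 c (bump_op k v G)"
proof (cases "c < v")
  case True
  then show ?thesis by (rule bump_row_commute)
next
  case False
  with assms have "Suc v \<le> c" by simp
  have step0: "step_op k 0 v G = bump_op k v G" for v and G :: "(nat \<Rightarrow> nat) \<Rightarrow> 'a"
    by (simp add: step_op_def[abs_def])
  from \<open>Suc v \<le> c\<close> show ?thesis
  proof (induction c arbitrary: G rule: dec_induct)
    case base
    show ?case
    proof (cases v)
      case 0
      then show ?thesis by (simp add: step0)
    next
      case (Suc u)
      then show ?thesis using bump_op_plactic_up[of k u G]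
        by (simp add: step0 bump_row_commute)
    qed
  next
    case (step w)
    have "bump_op k v (row_op k 0 (Suc w) G) = row_op k 0 w (bump_op k v (bump_op k w G))"
      by (simp add: step0 step.IH)
    also have "\<dots> = row_op k 0 w (bump_op k w (bump_op k v G))"
    proof (cases "w = Suc v")
      case True
      then show ?thesis using bump_op_plactic_down[of k v G] by (simp add: step0)
    next
      case False
      with step.hyps show ?thesis by (simp add: bump_op_commute)
    qed
    finally show ?case by (simp add: step0)
  qed
qed

lemma row_op_upd_outside:
  "k \<le> j \<Longrightarrow> row_op k z a (\<lambda>g. G (g(j := x))) f = row_op k z a G (f(j := x))"
proof (induction a arbitrary: G)
  case (Suc a)
  have "step_op k z a (\<lambda>g. G (g(j := x))) = (\<lambda>g. step_op k z a G (g(j := x)))"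
  proof
    fix g
    have l: "is_last k a (g(j := x)) i \<longleftrightarrow> is_last k a g i" for i
      using Suc.prems by (auto simp: is_last_def)
    show "step_op k z a (\<lambda>g. G (g(j := x))) g = step_op k z a G (g(j := x))"
    proof (cases k g a rule: last_cases)
      case none
      then show ?thesis using Suc.prems by (simp add: step_op_def bump_op_none)
    next
      case (last i)
      then have "i \<noteq> j" using Suc.prems by (auto simp: is_last_def)
      then show ?thesis using last l[of i] by (simp add: step_op_def bump_op_eq fun_upd_twist)
    qed
  qed
  with Suc.IH[OF Suc.prems, of "step_op k z a G"] show ?case by (simp del: fun_upd_apply)
qed simp

text \<open>Once x_k is zero, an inserted entry c must spend all its values on bumps, which is a row
  with z = 0. All c are included because later rows may raise an inserted zero.\<close>

definition delete_rel :: "nat \<Rightarrow> ((nat \<Rightarrow> nat) \<Rightarrow> 'a::comm_ring_1) \<Rightarrow> ((nat \<Rightarrow> nat) \<Rightarrow> 'a) \<Rightarrow> bool" where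
  "delete_rel k F G \<longleftrightarrow> (\<forall>c f. F (ins k c f) = row_op k 0 c G f)"

text \<open>The bumped v lies behind, at or before position k. Behind it, the row on the first k
  entries does not interfere; at it, c = v becomes v + 1 and the full row gains the factor u_v;
  before it, the bump commutes with the full row.\<close>

lemma delete_rel_bump_op:
  assumes kn: "k \<le> n" and rel: "delete_rel k F G"
  shows "delete_rel k (bump_op (Suc n) v F) (bump_op n v G)"
  unfolding delete_rel_def
proof (intro allI)
  fix c f
  show "bump_op (Suc n) v F (ins k c f) = row_op k 0 c (bump_op n v G) f"
  proof (cases "\<exists>j<n. k \<le> j \<and> f j = v")
    case True
    then have "\<exists>i<n. f i = v" by blast
    then obtain j where j: "is_last n v f j" using is_last_ex by blast
    with True have kj: "k \<le> j" unfolding is_last_def by (metis le_trans not_less)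
    have l1: "is_last (Suc n) v (ins k c f) (Suc j)"
      unfolding is_last_def
    proof (intro conjI allI impI)
      fix i assume "Suc j < i \<and> i < Suc n"
      then have "j < i - 1" "i - 1 < n" "k < i" using kj by auto
      then show "ins k c f i \<noteq> v" using j by (simp add: ins_def is_last_def)
    qed (use j kj in \<open>auto simp: ins_def is_last_def\<close>)
    have l2: "is_last n v g j" if "\<forall>i\<ge>k. g i = f i" for g
      using j that kj by (auto simp: is_last_def)
    have "(ins k c f)(Suc j := Suc v) = ins k c (f(j := Suc v))"
      using kj by (auto simp: ins_def fun_eq_iff)
    then have "bump_op (Suc n) v F (ins k c f) = row_op k 0 c G (f(j := Suc v))"
      using rel l1 by (simp add: bump_op_eq delete_rel_def)
    also have "\<dots> = row_op k 0 c (\<lambda>g. G (g(j := Suc v))) f"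
      using kj by (simp add: row_op_upd_outside)
    also have "\<dots> = row_op k 0 c (bump_op n v G) f"
      using l2 by (intro row_op_cong) (simp add: bump_op_eq[OF l2])
    finally show ?thesis .
  next
    case False
    have eq: "bump_op n v G g = bump_op k v G g" if g: "\<forall>i\<ge>k. g i = f i" for g
    proof (cases k g v rule: last_cases)
      case none
      have "g i \<noteq> v" if "i < n" for i
        using none[of i] False g that by (cases "i < k") auto
      with none show ?thesis by (simp add: bump_op_none)
    next
      case (last i)
      have "is_last n v g i"
        unfolding is_last_def
      proof (intro conjI allI impI)
        fix j assume "i < j \<and> j < n"
        then show "g j \<noteq> v" using last False g by (cases "j < k") (auto simp: is_last_def)
      qed (use last kn in \<open>auto simp: is_last_def\<close>)
      with last show ?thesis by (simp add: bump_op_eq)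
    qed
    have R: "row_op k 0 c (bump_op n v G) f = row_op k 0 c (bump_op k v G) f"
      by (rule row_op_cong) (rule eq)
    have above: "ins k c f i \<noteq> v" if "k < i" "i < Suc n" for i
    proof -
      have "k \<le> i - 1" "i - 1 < n" using that by auto
      with False that show ?thesis by (auto simp: ins_def)
    qed
    show ?thesis
    proof (cases "c = v")
      case True
      have l: "is_last (Suc n) v (ins k c f) k"
        unfolding is_last_def using kn above True by (auto simp: ins_def)
      have "(ins k c f)(k := Suc v) = ins k (Suc v) f" by (auto simp: ins_def fun_eq_iff)
      then have "bump_op (Suc n) v F (ins k c f) = row_op k 0 (Suc v) G f"
        using rel l by (simp add: bump_op_eq delete_rel_def)
      then show ?thesis using R True by (simp add: step_op_def[abs_def])
    next
      case cv: False
      have "bump_op (Suc n) v F (ins k c f) = bump_op k v (row_op k 0 c G) f"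
      proof (cases k f v rule: last_cases)
        case none
        have "ins k c f i \<noteq> v" if "i < Suc n" for i
          using none[of i] above[of i] that cv by (cases i k rule: linorder_cases) (auto simp: ins_def)
        with none show ?thesis by (simp add: bump_op_none)
      next
        case (last i)
        have l: "is_last (Suc n) v (ins k c f) i"
          unfolding is_last_def
        proof (intro conjI allI impI)
          fix j assume "i < j \<and> j < Suc n"
          then show "ins k c f j \<noteq> v" using last above[of j] cv
            by (cases j k rule: linorder_cases) (auto simp: ins_def is_last_def)
        qed (use last kn in \<open>auto simp: ins_def is_last_def\<close>)
        have "(ins k c f)(i := Suc v) = ins k c (f(i := Suc v))"
          using last by (auto simp: ins_def fun_eq_iff is_last_def)
        then show ?thesis using rel l last by (simp add: bump_op_eq delete_rel_def)
      qed
      then show ?thesis using R bump_full_row_commute[of v c k G] cv by simp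
    qed
  qed
qed

lemma delete_rel_row_op:
  assumes "k \<le> n" "delete_rel k F G"
  shows "delete_rel k (row_op (Suc n) z a F) (row_op n z a G)"
  using assms(2)
proof (induction a arbitrary: F G)
  case (Suc a)
  have "delete_rel k (step_op (Suc n) z a F) (step_op n z a G)"
    using Suc.prems delete_rel_bump_op[OF assms(1) Suc.prems, of a]
    by (simp add: delete_rel_def step_op_def[abs_def] row_op_add row_op_scale)
  then show ?case by (simp add: Suc.IH)
qed simp

definition drop_var :: "nat \<Rightarrow> nat \<Rightarrow> nat mpoly" where
  "drop_var k j = (if j < k then Var j else if j = k then 0 else Var (j - 1))"

lemma delete_rel_bump_poly:
  "k \<le> n \<Longrightarrow> delete_rel k (\<lambda>f. subst (drop_var k) (bump_poly (Suc n) f)) (bump_poly n)"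
proof (induction n rule: dec_induct)
  case base
  have "subst (drop_var k) (bump_poly k f) = bump_poly k f" for f
    using subst_bump_poly_cong[of k "drop_var k" Var f] by (simp add: drop_var_def)
  then have "subst (drop_var k) (bump_poly (Suc k) (ins k c f)) = row_op k 0 c (bump_poly k) (ins k c f)" for c f
    by (simp add: semiring_hom.hom_row_op[OF semiring_hom_subst] drop_var_def ins_def)
  moreover have "row_op k 0 c (bump_poly k) (ins k c f) = row_op k 0 c (bump_poly k) f" for c f
    using local_row_op[OF local_bump_poly] unfolding local_to_def by (metis agree_def ins_def)
  ultimately show ?case by (simp add: delete_rel_def)
next
  case (step n)
  show ?case
    unfolding delete_rel_def
  proof (intro allI)
    fix c f
    have n: "ins k c f (Suc n) = f n" using step.hyps by (simp add: ins_def)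
    have "subst (drop_var k) (bump_poly (Suc (Suc n)) (ins k c f)) =
      row_op (Suc n) (Var n) (f n) (\<lambda>f. subst (drop_var k) (bump_poly (Suc n) f)) (ins k c f)"
      using step.hyps n
      by (simp only: bump_poly.simps(2)[of "Suc n"] semiring_hom.hom_row_op[OF semiring_hom_subst])
        (simp add: drop_var_def)
    also have "\<dots> = row_op k 0 c (row_op n (Var n) (f n) (bump_poly n)) f"
      using delete_rel_row_op[OF step.hyps(1) step.IH] unfolding delete_rel_def by blast
    also have "\<dots> = row_op k 0 c (bump_poly (Suc n)) f"
      by (rule row_op_cong) (use step.hyps in simp)
    finally show "subst (drop_var k) (bump_poly (Suc (Suc n)) (ins k c f)) = row_op k 0 c (bump_poly (Suc n)) f" .
  qed
qed

text \<open>For c = 0 the row in \<open>delete_rel\<close> is the identity, so setting x_k to zero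
  simply deletes the entry.\<close>

theorem coeff_delete_zero:
  assumes "k \<le> n"
  shows "coeff_of (bump_poly (Suc n) (ins k 0 f)) (mon (Suc n) (ins k 0 b)) = coeff_of (bump_poly n f) (mon n b)"
proof -
  define g where "g = (\<lambda>j. if j < k then Some j else if j = k then None else Some (j - 1))"
  have "coeff_of (bump_poly n f) (mon n b) = coeff_of (subst (drop_var k) (bump_poly (Suc n) (ins k 0 f))) (mon n b)"
    using delete_rel_bump_poly[OF assms] by (simp add: delete_rel_def)
  also have "\<dots> = coeff_of (bump_poly (Suc n) (ins k 0 f))
      (mon (Suc n) (\<lambda>j. case g j of None \<Rightarrow> 0 | Some v \<Rightarrow> expo (mon n b) v))"
  proof -
    have C: "\<forall>v\<in>Poly_Mapping.keys (mon n b). \<exists>j<Suc n. g j = Some v"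
    proof
      fix v assume "v \<in> Poly_Mapping.keys (mon n b)"
      then have "v < n" by (auto simp: in_keys_iff expo_mon split: if_splits)
      then show "\<exists>j<Suc n. g j = Some v"
        by (intro exI[of _ "if v < k then v else Suc v"]) (auto simp: g_def)
    qed
    show ?thesis
      by (subst coeff_subst_partial[OF in_vars_bump_poly, where g = g])
        (use C in \<open>auto simp: g_def drop_var_def split: if_splits\<close>)
  qed
  also have "mon (Suc n) (\<lambda>j. case g j of None \<Rightarrow> 0 | Some v \<Rightarrow> expo (mon n b) v) = mon (Suc n) (ins k 0 b)"
    using assms by (intro mon_agree) (auto simp: agree_def g_def ins_def expo_mon)
  finally show ?thesis by simp
qed

section \<open>Stability of the block coefficients\<close>

definition offset :: "(nat \<Rightarrow> nat) \<Rightarrow> nat \<Rightarrow> nat" where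
  "offset n i = (\<Sum>i'<i. n i')"

lemma offset_Suc [simp]: "offset n (Suc i) = offset n i + n i"
  by (simp add: offset_def)

lemma offset_0 [simp]: "offset n 0 = 0"
  by (simp add: offset_def)

lemma offset_mono: "i \<le> j \<Longrightarrow> offset n i \<le> offset n j"
  by (induction j rule: dec_induct) auto

lemma offset_less: "i < r \<Longrightarrow> j < n i \<Longrightarrow> offset n i + j < offset n r"
  using offset_mono[of "Suc i" r n] by simp

lemma position_ex: "k < offset n r \<Longrightarrow> \<exists>i<r. \<exists>j<n i. k = offset n i + j"
proof (induction r)
  case (Suc r)
  show ?case
  proof (cases "k < offset n r")
    case True
    with Suc.IH show ?thesis using less_Suc_eq by blast
  next
    case False
    with Suc.prems show ?thesis by (intro exI[of _ r]) (auto intro!: exI[of _ "k - offset n r"])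
  qed
qed simp

lemma length_concat_blocks:
  "(\<And>i. i < r \<Longrightarrow> length (c i) = n i) \<Longrightarrow> length (concat (map c [0..<r])) = offset n r"
  by (induction r) auto

lemma nth_concat_blocks:
  assumes "\<And>i. i < r \<Longrightarrow> length (c i) = n i" "i < r" "j < n i"
  shows "concat (map c [0..<r]) ! (offset n i + j) = c i ! j"
  using assms
proof (induction r)
  case (Suc r)
  have len: "length (concat (map c [0..<r])) = offset n r"
    using Suc.prems(1) by (intro length_concat_blocks) auto
  show ?case
  proof (cases "i = r")
    case True
    then show ?thesis by (simp add: nth_append len)
  next
    case False
    with Suc.prems have "i < r" by simp
    with offset_less[where n = n, OF this Suc.prems(3)] Suc show ?thesis by (simp add: nth_append len)
  qed
qed simp

lemma block_vars_alt: "block_vars r n = concat (map (\<lambda>i. map (Pair i) [0..<n i]) [0..<r])"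
  by (simp add: block_vars_def)

lemma nth_block_vars: "i < r \<Longrightarrow> j < n i \<Longrightarrow> block_vars r n ! (offset n i + j) = (i, j)"
  unfolding block_vars_alt by (subst nth_concat_blocks) auto

definition flat :: "nat \<Rightarrow> (nat \<Rightarrow> nat) \<Rightarrow> (nat \<times> nat \<Rightarrow> nat) \<Rightarrow> nat \<Rightarrow> nat" where
  "flat r n h k = h (block_vars r n ! k)"

lemma flat_nth: "i < r \<Longrightarrow> j < n i \<Longrightarrow> flat r n h (offset n i + j) = h (i, j)"
  by (simp add: flat_def nth_block_vars)

lemma offset_upd:
  "offset (n(i0 := Suc (n i0))) i = (if i0 < i then Suc (offset n i) else offset n i)"
  by (induction i) (auto simp: less_Suc_eq)

definition ins_pair :: "nat \<Rightarrow> nat \<Rightarrow> (nat \<times> nat \<Rightarrow> nat) \<Rightarrow> nat \<times> nat \<Rightarrow> nat" where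
  "ins_pair i0 t h = (\<lambda>(i, j). if i = i0 then ins t 0 (\<lambda>j. h (i0, j)) j else h (i, j))"

lemma flat_ins:
  assumes "i0 < r" "t \<le> n i0"
  shows "agree (offset (n(i0 := Suc (n i0))) r) (flat r (n(i0 := Suc (n i0))) (ins_pair i0 t h))
    (ins (offset n i0 + t) 0 (flat r n h))"
  unfolding agree_def
proof (intro allI impI)
  let ?n = "n(i0 := Suc (n i0))"
  fix k assume "k < offset ?n r"
  then obtain i j where ij: "i < r" "j < ?n i" "k = offset ?n i + j" using position_ex by blast
  have L: "flat r ?n (ins_pair i0 t h) k = ins_pair i0 t h (i, j)"
    unfolding ij(3) by (rule flat_nth[where n = ?n, OF ij(1,2)])
  consider "i < i0" | "i = i0" | "i0 < i" by linarith
  then show "flat r ?n (ins_pair i0 t h) k = ins (offset n i0 + t) 0 (flat r n h) k"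
  proof cases
    case 1
    with ij have k: "k = offset n i + j" "j < n i" by (auto simp: offset_upd)
    have "k < offset n i0" unfolding k(1) by (rule offset_less) (use 1 k in auto)
    then show ?thesis using 1 k ij(1) unfolding L by (simp add: ins_pair_def ins_def flat_nth)
  next
    case 2
    with ij have k: "k = offset n i0 + j" "j \<le> n i0" by (auto simp: offset_upd)
    have "flat r n h (offset n i0 + j') = h (i0, j')" if "j' < n i0" for j'
      using assms that by (intro flat_nth) auto
    from this[of j] this[of "j - 1"] show ?thesis
      using 2 k assms unfolding L by (auto simp: ins_pair_def ins_def)
  next
    case 3
    with ij have k: "k = Suc (offset n i + j)" "j < n i" by (auto simp: offset_upd)
    have "offset n i0 + n i0 \<le> offset n i" using offset_mono[of "Suc i0" i n] 3 by simp
    then show ?thesis using 3 k ij(1) assms unfolding L by (simp add: ins_pair_def ins_def flat_nth)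
  qed
qed

definition block_entry :: "nat list list \<Rightarrow> (nat \<Rightarrow> nat) \<Rightarrow> nat \<times> nat \<Rightarrow> nat" where
  "block_entry lam n = (\<lambda>(i, j). (replicate (n i - length (lam ! i)) 0 @ rev (lam ! i)) ! j)"

definition fits :: "nat list list \<Rightarrow> (nat \<Rightarrow> nat) \<Rightarrow> bool" where
  "fits lam n \<longleftrightarrow> (\<forall>i<length lam. length (lam ! i) \<le> n i)"

lemma length_block_comp: "fits lam n \<Longrightarrow> length (block_comp lam n) = offset n (length lam)"
  unfolding block_comp_def by (intro length_concat_blocks) (simp add: fits_def)

lemma block_comp_agree:
  assumes "fits lam n"
  shows "agree (offset n (length lam)) ((!) (block_comp lam n)) (flat (length lam) n (block_entry lam n))"
  unfolding agree_def
proof (intro allI impI)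
  fix k assume "k < offset n (length lam)"
  then obtain i j where ij: "i < length lam" "j < n i" "k = offset n i + j" using position_ex by blast
  show "block_comp lam n ! k = flat (length lam) n (block_entry lam n) k"
    unfolding ij(3) flat_nth[where n = n, OF ij(1,2)] block_comp_def
    by (subst nth_concat_blocks) (use ij assms in \<open>auto simp: block_entry_def fits_def\<close>)
qed

definition block_coeff :: "nat list list \<Rightarrow> (nat \<Rightarrow> nat) \<Rightarrow> (nat \<times> nat \<Rightarrow> nat) \<Rightarrow> int" where
  "block_coeff lam n h = coeff_of (bump_poly (offset n (length lam)) (flat (length lam) n (block_entry lam n)))
     (mon (offset n (length lam)) (flat (length lam) n h))"

lemma coeff_block_key:
  assumes "fits lam n"
  shows "coeff_of (block_key lam n) M =
    (if \<forall>(i, j)\<in>Poly_Mapping.keys M. i < length lam \<and> j < n i then block_coeff lam n (expo M) else 0)"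
proof -
  let ?r = "length lam" and ?N = "offset n (length lam)"
  have key: "key_poly (block_comp lam n) = bump_poly ?N (flat ?r n (block_entry lam n))"
    using local_bump_poly block_comp_agree[OF assms] unfolding local_to_def
    by (simp add: key_poly_eq length_block_comp[OF assms])
  have "(\<forall>v\<in>Poly_Mapping.keys M. \<exists>k<?N. Some (block_vars ?r n ! k) = Some v) \<longleftrightarrow>
      (\<forall>(i, j)\<in>Poly_Mapping.keys M. i < ?r \<and> j < n i)"
  proof (intro ball_cong refl)
    fix v assume "v \<in> Poly_Mapping.keys M"
    show "(\<exists>k<?N. Some (block_vars ?r n ! k) = Some v) \<longleftrightarrow> (case v of (i, j) \<Rightarrow> i < ?r \<and> j < n i)"
    proof
      assume "\<exists>k<?N. Some (block_vars ?r n ! k) = Some v"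
      then obtain k where k: "k < ?N" "block_vars ?r n ! k = v" by auto
      then obtain i j where "i < ?r" "j < n i" "k = offset n i + j" using position_ex by blast
      with k show "case v of (i, j) \<Rightarrow> i < ?r \<and> j < n i" by (auto simp: nth_block_vars)
    next
      assume "case v of (i, j) \<Rightarrow> i < ?r \<and> j < n i"
      then show "\<exists>k<?N. Some (block_vars ?r n ! k) = Some v"
        by (cases v) (auto intro!: exI[of _ "offset n (fst v) + snd v"] simp: nth_block_vars offset_less)
    qed
  qed
  moreover have "k = l" if "k < ?N" "l < ?N" "block_vars ?r n ! k = block_vars ?r n ! l" for k l
  proof -
    from that obtain i j i' j' where "i < ?r" "j < n i" "k = offset n i + j"
      "i' < ?r" "j' < n i'" "l = offset n i' + j'" using position_ex by metis
    with that(3) show ?thesis by (simp add: nth_block_vars)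
  qed
  ultimately show ?thesis
    unfolding block_key_def key block_coeff_def
    by (subst coeff_subst_partial[OF in_vars_bump_poly, where g = "\<lambda>k. Some (block_vars ?r n ! k)"])
      (auto simp: flat_def[abs_def])
qed

subsection \<open>Stability of the coefficients\<close>

lemma block_entry_mono:
  assumes "lam \<in> Par r" "i < r" "j < j'" "j' < n i" "length (lam ! i) \<le> n i"
  shows "block_entry lam n (i, j) \<le> block_entry lam n (i, j')"
proof -
  have p: "sorted_wrt (\<ge>) (lam ! i)" using assms(1,2) by (auto simp: Par_def is_partition_def)
  then have "sorted (rev (lam ! i))" by (simp add: sorted_wrt_rev)
  then have "sorted (replicate (n i - length (lam ! i)) 0 @ rev (lam ! i))"
    by (simp add: sorted_append)
  then show ?thesis using assms by (simp add: block_entry_def sorted_iff_nth_mono)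
qed

text \<open>The composition gains its zero at the front of the block, while the vanishing exponent
  belongs to the last variable of the block. Only after the exponent has been moved to the front can
  both zeros be deleted together.\<close>

lemma block_coeff_extend:
  assumes lam: "lam \<in> Par r" and i0: "i0 < r" and fits: "fits lam n" and h0: "h (i0, n i0) = 0"
  shows "block_coeff lam (n(i0 := Suc (n i0))) h = block_coeff lam n h"
proof -
  let ?n = "n(i0 := Suc (n i0))"
  let ?N = "offset n r" and ?N' = "offset ?n r"
  let ?g = "flat r n (block_entry lam n)" and ?g' = "flat r ?n (block_entry lam ?n)"
  let ?b = "flat r n h" and ?k = "offset n i0"
  have r: "length lam = r" using lam by (simp add: Par_def)
  have N': "?N' = Suc ?N" using i0 by (simp add: offset_upd)
  have kN: "?k + n i0 \<le> ?N" using offset_mono[of "Suc i0" r n] i0 by simp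
  have "block_entry lam ?n (i, j) = ins_pair i0 0 (block_entry lam n) (i, j)" for i j
    using fits i0 r by (auto simp: block_entry_def ins_pair_def ins_def Suc_diff_le fits_def nth_Cons')
  then have "block_entry lam ?n = ins_pair i0 0 (block_entry lam n)" by auto
  then have g': "agree ?N' ?g' (ins ?k 0 ?g)"
    using flat_ins[of i0 r 0 n "block_entry lam n"] i0 by simp
  have P: "bump_poly ?N' ?g' = bump_poly (Suc ?N) (ins ?k 0 ?g)"
    using local_bump_poly g' unfolding local_to_def N' by blast
  have "agree ?N' (flat r ?n h) (flat r ?n (ins_pair i0 (n i0) h))"
    unfolding agree_def
  proof (intro allI impI)
    fix k assume "k < ?N'"
    then obtain i j where ij: "i < r" "j < ?n i" "k = offset ?n i + j" using position_ex by blast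
    show "flat r ?n h k = flat r ?n (ins_pair i0 (n i0) h) k"
      unfolding ij(3) flat_nth[where n = ?n, OF ij(1,2)]
      using ij(2) h0 by (auto simp: ins_pair_def ins_def split: if_splits)
  qed
  with flat_ins[of i0 r "n i0" n h] i0 have b': "agree ?N' (flat r ?n h) (ins (?k + n i0) 0 ?b)"
    by (simp add: agree_def)
  \<comment> \<open>Adjacent exchanges carry the zero exponent to the front; each preserves the
    coefficient because the composition ascends within the block.\<close>
  have rot: "coeff_of (bump_poly (Suc ?N) (ins ?k 0 ?g)) (mon (Suc ?N) (ins (?k + t) 0 ?b)) =
      coeff_of (bump_poly (Suc ?N) (ins ?k 0 ?g)) (mon (Suc ?N) (ins ?k 0 ?b))" if "t \<le> n i0" for t
    using that
  proof (induction t)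
    case (Suc t)
    have lt: "Suc (?k + t) < Suc ?N" using Suc.prems kN by simp
    have 1: "ins (?k + Suc t) 0 ?b = ins (?k + t) 0 ?b \<circ> transpose (?k + t) (Suc (?k + t))"
      by (auto simp: fun_eq_iff ins_def transpose_def)
    have "?g' (?k + t) \<le> ?g' (?k + Suc t)"
    proof -
      have fl: "?g' (offset ?n i0 + j) = block_entry lam ?n (i0, j)" if "j < Suc (n i0)" for j
        using that i0 by (intro flat_nth) auto
      moreover have "block_entry lam ?n (i0, t) \<le> block_entry lam ?n (i0, Suc t)"
        by (rule block_entry_mono[OF lam i0]) (use Suc.prems fits i0 r in \<open>auto simp: fits_def le_SucI\<close>)
      ultimately show ?thesis using Suc.prems fl[of t] fl[of "Suc t"] by (simp add: offset_upd)
    qed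
    then have 2: "ins ?k 0 ?g (?k + t) \<le> ins ?k 0 ?g (Suc (?k + t))"
      using g' lt unfolding agree_def N' by simp
    show ?case unfolding 1 coeff_symmetric[OF lt 2] using Suc by simp
  qed simp
  have "block_coeff lam ?n h = coeff_of (bump_poly (Suc ?N) (ins ?k 0 ?g)) (mon (Suc ?N) (ins (?k + n i0) 0 ?b))"
    unfolding block_coeff_def r P using mon_agree[OF b'] by (simp add: N')
  also have "\<dots> = coeff_of (bump_poly ?N ?g) (mon ?N ?b)"
    unfolding rot[OF order_refl] by (rule coeff_delete_zero) (use kN in simp)
  finally show ?thesis by (simp add: block_coeff_def r)
qed

lemma block_coeff_cong:
  assumes "\<And>i. i < length lam \<Longrightarrow> n i = n' i"
  shows "block_coeff lam n h = block_coeff lam n' h"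
proof -
  have o: "offset n i = offset n' i" if "i \<le> length lam" for i
    using that assms unfolding offset_def by (intro sum.cong) auto
  have bv: "block_vars (length lam) n = block_vars (length lam) n'"
    unfolding block_vars_alt using assms by (intro arg_cong[of _ _ concat] map_cong) auto
  have "agree (offset n (length lam)) (flat (length lam) n (block_entry lam n))
     (flat (length lam) n' (block_entry lam n'))"
    unfolding agree_def
  proof (intro allI impI)
    fix k assume "k < offset n (length lam)"
    then obtain i j where ij: "i < length lam" "j < n i" "k = offset n i + j" using position_ex by blast
    then have "block_vars (length lam) n ! k = (i, j)" by (simp add: nth_block_vars)
    then show "flat (length lam) n (block_entry lam n) k = flat (length lam) n' (block_entry lam n') k"
      using ij assms by (simp add: flat_def block_entry_def flip: bv)
  qed
  then have "bump_poly (offset n (length lam)) (flat (length lam) n (block_entry lam n)) =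
      bump_poly (offset n (length lam)) (flat (length lam) n' (block_entry lam n'))"
    using local_bump_poly unfolding local_to_def by blast
  moreover have "flat (length lam) n h = flat (length lam) n' h"
    by (simp add: flat_def[abs_def] bv)
  ultimately show ?thesis unfolding block_coeff_def using o[of "length lam"] by simp
qed

text \<open>Blocks are shortened one variable at a time; the last variable of a block longer than L
  has exponent zero.\<close>

lemma block_coeff_stable:
  assumes lam: "lam \<in> Par r" and fits: "fits lam (\<lambda>_. L)"
    and h0: "\<And>i j. i < r \<Longrightarrow> L \<le> j \<Longrightarrow> h (i, j) = 0" and n: "\<And>i. i < r \<Longrightarrow> L \<le> n i"
  shows "block_coeff lam n h = block_coeff lam (\<lambda>_. L) h"
  using n
proof (induction "\<Sum>i<r. n i - L" arbitrary: n rule: less_induct)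
  case less
  have r: "length lam = r" using lam by (simp add: Par_def)
  show ?case
  proof (cases "\<forall>i<r. n i = L")
    case True
    then show ?thesis by (intro block_coeff_cong) (simp add: r)
  next
    case False
    with less.prems obtain i0 where i0: "i0 < r" "L < n i0" using le_neq_implies_less by metis
    define n' where "n' = n(i0 := n i0 - 1)"
    have n: "n'(i0 := Suc (n' i0)) = n" using i0 by (intro ext) (simp add: n'_def)
    have ge: "L \<le> n' i" if "i < r" for i using less.prems[OF that] i0 by (cases "i = i0") (auto simp: n'_def)
    have "(\<Sum>i<r. n' i - L) < (\<Sum>i<r. n i - L)"
      by (rule sum_strict_mono_ex1) (use i0 in \<open>auto simp: n'_def intro!: bexI[of _ i0]\<close>)
    from less.hyps[OF this ge] have "block_coeff lam n' h = block_coeff lam (\<lambda>_. L) h" .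
    moreover have "block_coeff lam (n'(i0 := Suc (n' i0))) h = block_coeff lam n' h"
    proof (rule block_coeff_extend[OF lam i0(1)])
      show "fits lam n'" using fits ge r unfolding fits_def by (meson le_trans)
      show "h (i0, n' i0) = 0" using h0 ge i0 by blast
    qed
    ultimately show ?thesis unfolding n by (rule trans[rotated])
  qed
qed

text \<open>L is an explicit threshold from which the coefficient is constant, so the limit is read
  off at blocks of the common length L.\<close>

theorem multi_S_eq:
  assumes lam: "lam \<in> Par r" and fits: "fits lam (\<lambda>_. L)"
    and keys: "\<And>i j. (i, j) \<in> Poly_Mapping.keys M \<Longrightarrow> j < L"
  shows "multi_S lam M =
    (if Poly_Mapping.keys M \<subseteq> {..<r} \<times> UNIV then block_coeff lam (\<lambda>_. L) (expo M) else 0)" (is "_ = ?c")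
proof -
  have r: "length lam = r" using lam by (simp add: Par_def)
  have c: "coeff_of (block_key lam n) M = ?c" if n: "\<forall>i<length lam. L \<le> n i" for n
  proof -
    have f: "fits lam n" using fits n unfolding fits_def by (meson le_trans)
    have "(\<forall>(i, j)\<in>Poly_Mapping.keys M. i < length lam \<and> j < n i) \<longleftrightarrow> Poly_Mapping.keys M \<subseteq> {..<r} \<times> UNIV"
    proof
      assume R: "Poly_Mapping.keys M \<subseteq> {..<r} \<times> UNIV"
      have "i < length lam \<and> j < n i" if "(i, j) \<in> Poly_Mapping.keys M" for i j
      proof -
        have "i < r" using R that by blast
        with n keys[OF that] r show ?thesis by (metis less_le_trans)
      qed
      then show "\<forall>(i, j)\<in>Poly_Mapping.keys M. i < length lam \<and> j < n i" by blast
    qed (auto simp: r)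
    moreover have "block_coeff lam n (expo M) = block_coeff lam (\<lambda>_. L) (expo M)"
    proof (rule block_coeff_stable[OF lam fits])
      fix i j assume "L \<le> j"
      then show "expo M (i, j) = 0" using keys[of i j] by (metis in_keys_iff not_less)
    qed (use n r in auto)
    ultimately show ?thesis unfolding coeff_block_key[OF f] by simp
  qed
  show ?thesis
    unfolding multi_S_def
  proof (rule the_equality)
    show "\<exists>N. \<forall>n. (\<forall>i<length lam. N \<le> n i) \<longrightarrow> coeff_of (block_key lam n) M = ?c"
      using c by blast
  next
    fix c' assume "\<exists>N. \<forall>n. (\<forall>i<length lam. N \<le> n i) \<longrightarrow> coeff_of (block_key lam n) M = c'"
    then obtain N where N: "\<And>n. \<forall>i<length lam. N \<le> n i \<Longrightarrow> coeff_of (block_key lam n) M = c'" by blast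
    show "c' = ?c" using N[of "\<lambda>_. max N L"] c[of "\<lambda>_. max N L"] by simp
  qed
qed

section \<open>Moves on tuples of partitions\<close>

abbreviation positive :: "nat multiset \<Rightarrow> nat multiset" where
  "positive \<equiv> filter_mset (\<lambda>v. 0 < v)"

text \<open>All blocks have the same length L, so the block of an index k is simply
  \<open>k div L\<close>.\<close>

definition block_mset :: "nat \<Rightarrow> (nat \<Rightarrow> nat) \<Rightarrow> nat \<Rightarrow> nat multiset" where
  "block_mset L b i = image_mset b (mset_set {i * L..<i * L + L})"

lemma block_index: "k div L = (i::nat) \<Longrightarrow> 0 < L \<Longrightarrow> k \<in> {i * L..<i * L + L}"
  using div_mult_mod_eq[of k L] mod_less_divisor[of L k]
  by (metis add_less_cancel_left atLeastLessThan_iff le_add1)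

lemma block_mset_upd:
  assumes "k div L = i" "0 < L"
  shows "add_mset (b k) (block_mset L (b(k := x)) i) = add_mset x (block_mset L b i)"
proof -
  let ?S = "{i * L..<i * L + L}"
  have k: "k \<in> ?S" by (rule block_index[OF assms])
  then have S: "mset_set ?S = add_mset k (mset_set (?S - {k}))"
    by (simp add: mset_set.remove)
  have "image_mset (b(k := x)) (mset_set (?S - {k})) = image_mset b (mset_set (?S - {k}))"
    by (intro image_mset_cong) auto
  then show ?thesis unfolding block_mset_def S by simp
qed

lemma block_mset_upd_other:
  assumes "k div L \<noteq> i"
  shows "block_mset L (b(k := x)) i = block_mset L b i"
  unfolding block_mset_def
proof (intro image_mset_cong)
  fix l assume "l \<in># mset_set {i * L..<i * L + L}"
  then have "i * L \<le> l" "l < Suc i * L" by auto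
  then have "l div L = i" by (metis div_nat_eqI mult.commute)
  with assms show "(b(k := x)) l = b l" by auto
qed

lemma block_mset_mem: "k div L = i \<Longrightarrow> 0 < L \<Longrightarrow> b k \<in># block_mset L b i"
  using block_index[of k L i] by (simp add: block_mset_def)

lemma block_mset_memE:
  assumes "v \<in># block_mset L b i"
  obtains k where "k div L = i" "b k = v"
proof -
  from assms obtain k where "i * L \<le> k" "k < Suc i * L" "b k = v" by (auto simp: block_mset_def)
  moreover from this have "k div L = i" by (metis div_nat_eqI mult.commute)
  ultimately show ?thesis using that by blast
qed

lemma size_block_mset: "size (block_mset L b i) = L"
  by (simp add: block_mset_def)

lemma block_mset_swap:
  assumes "k div L = i" "l div L = i" "0 < L" "k \<noteq> l"
  shows "block_mset L (b(k := b l, l := b k)) = block_mset L b"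
proof
  fix i'
  show "block_mset L (b(k := b l, l := b k)) i' = block_mset L b i'"
  proof (cases "i' = i")
    case True
    have 1: "add_mset (b l) (block_mset L (b(k := b l, l := b k)) i) = add_mset (b k) (block_mset L (b(k := b l)) i)"
      using block_mset_upd[OF assms(2,3), of "b(k := b l)" "b k"] assms(4) by simp
    have 2: "add_mset (b k) (block_mset L (b(k := b l)) i) = add_mset (b l) (block_mset L b i)"
      by (rule block_mset_upd[OF assms(1,3)])
    from 1 2 True show ?thesis by simp
  qed (use assms in \<open>simp add: block_mset_upd_other\<close>)
qed

subsection \<open>Entries of padded partitions\<close>

text \<open>A part may be zero through padding, so the single parts pass through
  \<open>positive\<close> too; adding on both sides avoids multiset subtraction.\<close>

lemma mset_set_part:
  "positive (mset (set_part p j v)) + positive {#part p j#} = positive (mset p) + positive {#v#}"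
proof -
  let ?q = "p @ replicate (Suc j - length p) 0"
  have j: "j < length ?q" "?q ! j = part p j"
    by (auto simp: part_def nth_append)
  have "?q ! j \<in># mset ?q" using j(1) by (metis nth_mem_mset)
  then have "add_mset (?q ! j) (mset (?q[j := v])) = add_mset v (mset ?q)"
    unfolding mset_update[OF j(1)] by (subst add_mset_commute) (simp only: insert_DiffM)
  from arg_cong[OF this, of positive] have "positive (mset (?q[j := v])) + positive {#?q ! j#} =
      positive (mset ?q) + positive {#v#}"
    by (simp split: if_splits)
  moreover have "positive (mset ?q) = positive (mset p)"
    by (simp add: filter_mset_eq_conv)
  ultimately show ?thesis unfolding j(2) set_part_def by simp
qed

lemma set_part_mem: "v \<in> set (set_part p j v)"
  unfolding set_part_def by (intro set_update_memI) simp

lemma part_set_part: "k \<noteq> j \<Longrightarrow> part (set_part p j v) k = part p k"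
  by (auto simp: part_def set_part_def nth_append nth_list_update)

lemma mset_resort: "mset (resort p) = positive (mset p)"
  by (simp add: resort_def mset_filter)

lemma is_partition_resort: "is_partition (resort p)"
  by (auto simp: is_partition_def resort_def sorted_wrt_rev)

lemma positive_partition: "is_partition p \<Longrightarrow> positive (mset p) = mset p"
  by (auto simp: is_partition_def filter_mset_eq_conv intro!: gr0I)

lemma part_antimono: "is_partition p \<Longrightarrow> j \<le> k \<Longrightarrow> part p k \<le> part p j"
  by (cases "j = k") (auto simp: part_def is_partition_def sorted_wrt_iff_nth_less)

lemma part_ex:
  assumes "v = 0 \<or> v \<in> set p"
  obtains j where "part p j = v"
  using assms
proof
  assume "v = 0"
  then show ?thesis using that[of "length p"] by (simp add: part_def)
next
  assume "v \<in> set p"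
  then show ?thesis using that by (metis in_set_conv_nth part_def)
qed

lemma partition_eq_iff_mset: "is_partition p \<Longrightarrow> is_partition q \<Longrightarrow> mset p = mset q \<longleftrightarrow> p = q"
proof
  assume p: "is_partition p" "is_partition q" and "mset p = mset q"
  then have "mset (rev p) = mset (rev q)" by simp
  moreover have "sorted (rev p)" "sorted (rev q)" using p by (auto simp: is_partition_def sorted_wrt_rev)
  ultimately have "rev p = rev q" by (metis properties_for_sort)
  then show "p = q" by simp
qed simp

lemma block_set_part:
  assumes "positive (block_mset L b i) = positive (mset p)" "k div L = i" "0 < L" "b k = part p j"
  shows "positive (block_mset L (b(k := v)) i) = positive (mset (set_part p j v))"
proof -
  have "positive (add_mset (b k) (block_mset L (b(k := v)) i)) = positive (add_mset v (block_mset L b i))"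
    using block_mset_upd[OF assms(2,3), of b v] by simp
  then have "positive {#b k#} + positive (block_mset L (b(k := v)) i) = positive {#v#} + positive (block_mset L b i)"
    by (auto split: if_splits)
  with mset_set_part[of p j v] show ?thesis unfolding assms(1,4)
    by (metis add.commute add_left_cancel)
qed

text \<open>Any position holding v can serve for undoing the change. A new part v = 0 is not visible
  in the partition, so a zero entry in the block is then required explicitly.\<close>

lemma block_set_part_undo:
  assumes "positive (block_mset L b i) = positive (mset (set_part p j v))" "0 < L"
    and "0 < v \<or> 0 \<in># block_mset L b i"
  obtains k where "k div L = i" "b k = v" "positive (block_mset L (b(k := part p j)) i) = positive (mset p)"
proof -
  have "v \<in># block_mset L b i"
  proof (cases "0 < v")
    case True
    then have "v \<in># positive (mset (set_part p j v))" by (simp add: set_part_mem)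
    then show ?thesis unfolding assms(1)[symmetric] by simp
  next
    case False
    with assms(3) show ?thesis by simp
  qed
  then obtain k where k: "k div L = i" "b k = v" by (rule block_mset_memE)
  have "positive (add_mset (b k) (block_mset L (b(k := part p j)) i)) =
      positive (add_mset (part p j) (block_mset L b i))"
    using block_mset_upd[OF k(1) assms(2), of b "part p j"] by simp
  then have "positive {#v#} + positive (block_mset L (b(k := part p j)) i) =
      positive {#part p j#} + positive (block_mset L b i)"
    unfolding k(2) by (auto split: if_splits)
  with mset_set_part[of p j v] have "positive (block_mset L (b(k := part p j)) i) = positive (mset p)"
    unfolding assms(1) by (metis add.commute add_left_cancel)
  with k that show ?thesis by blast
qed

subsection \<open>Weights\<close>

definition part_weight :: "(nat \<Rightarrow> nat) \<Rightarrow> nat list \<Rightarrow> nat" where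
  "part_weight \<phi> p = (\<Sum>v\<in>#positive (mset p). \<phi> v)"

definition weight :: "(nat \<Rightarrow> nat \<Rightarrow> nat) \<Rightarrow> nat list list \<Rightarrow> nat" where
  "weight \<phi> nu = (\<Sum>i<length nu. part_weight (\<phi> i) (nu ! i))"

lemma part_weight_resort [simp]: "part_weight \<phi> (resort p) = part_weight \<phi> p"
  by (simp add: part_weight_def mset_resort filter_filter_mset)

lemma part_weight_set_part:
  assumes "\<phi> 0 = 0"
  shows "part_weight \<phi> (set_part p j v) + \<phi> (part p j) = part_weight \<phi> p + \<phi> v"
proof -
  have 1: "(\<Sum>w\<in>#positive {#x#}. \<phi> w) = \<phi> x" for x
    using assms by (cases "x = 0") auto
  from arg_cong[OF mset_set_part[of p j v], of "\<lambda>M. \<Sum>w\<in>#M. \<phi> w"] show ?thesis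
    unfolding image_mset_union sum_mset.union 1 part_weight_def .
qed

lemma weight_upd:
  assumes "i < length nu"
  shows "weight \<phi> (nu[i := q]) + part_weight (\<phi> i) (nu ! i) = weight \<phi> nu + part_weight (\<phi> i) q"
proof -
  let ?S = "{..<length nu} - {i}"
  have split: "(\<Sum>k<length nu. g k) = g i + sum g ?S" for g :: "nat \<Rightarrow> nat"
    using assms by (simp add: sum.remove)
  have "(\<Sum>k\<in>?S. part_weight (\<phi> k) (nu[i := q] ! k)) = (\<Sum>k\<in>?S. part_weight (\<phi> k) (nu ! k))"
    by (intro sum.cong) auto
  then show ?thesis using assms unfolding weight_def length_list_update split by simp
qed

text \<open>All three moves replace a smaller part x and a larger part y by new parts, with the
  index of x at most that of y. One equation for every additive weight that ignores zeros then
  yields both the invariance of \<open>total\<close> and the decreasing statistic.\<close>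

lemma move_weight:
  assumes "move nu nu'"
  obtains i1 i2 x y x' y' where "i1 \<le> i2" "x < y"
    "(i1 < i2 \<and> x' = y \<and> y' = x) \<or> (x + 1 < y \<and> x' = x + 1 \<and> y' = y - 1)"
    "\<And>\<phi>. (\<And>i. \<phi> i 0 = 0) \<Longrightarrow> weight \<phi> nu' + \<phi> i1 x + \<phi> i2 y = weight \<phi> nu + \<phi> i1 x' + \<phi> i2 y'"
  using assms
proof cases
  case (move1 i1 i2 j1 j2)
  have "weight \<phi> nu' + \<phi> i1 (part (nu ! i1) j1) + \<phi> i2 (part (nu ! i2) j2) =
      weight \<phi> nu + \<phi> i1 (part (nu ! i2) j2) + \<phi> i2 (part (nu ! i1) j1)" if \<phi>: "\<And>i. \<phi> i 0 = 0" for \<phi>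
  proof -
    let ?q1 = "set_part (nu ! i1) j1 (part (nu ! i2) j2)" and ?q2 = "set_part (nu ! i2) j2 (part (nu ! i1) j1)"
    have "weight \<phi> nu' + part_weight (\<phi> i2) (nu ! i2) = weight \<phi> (nu[i1 := resort ?q1]) + part_weight (\<phi> i2) ?q2"
      using move1 weight_upd[of i2 "nu[i1 := resort ?q1]" \<phi> "resort ?q2"] by simp
    moreover have "weight \<phi> (nu[i1 := resort ?q1]) + part_weight (\<phi> i1) (nu ! i1) = weight \<phi> nu + part_weight (\<phi> i1) ?q1"
      using move1 weight_upd[of i1 nu \<phi> "resort ?q1"] by simp
    ultimately show ?thesis
      using part_weight_set_part[of "\<phi> i1" "nu ! i1" j1 "part (nu ! i2) j2"]
        part_weight_set_part[of "\<phi> i2" "nu ! i2" j2 "part (nu ! i1) j1"] \<phi> by simp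
  qed
  with move1 show ?thesis
    by (intro that[of i1 i2 "part (nu ! i1) j1" "part (nu ! i2) j2"
        "part (nu ! i2) j2" "part (nu ! i1) j1"]) auto
next
  case (move2 i j k)
  let ?x = "part (nu ! i) j" and ?y = "part (nu ! i) k"
  have "weight \<phi> nu' + \<phi> i ?y + \<phi> i ?x = weight \<phi> nu + \<phi> i (?y + 1) + \<phi> i (?x - 1)"
    if \<phi>: "\<And>i. \<phi> i 0 = 0" for \<phi>
  proof -
    let ?p1 = "set_part (nu ! i) j (?x - 1)"
    have "part ?p1 k = ?y" using move2 by (simp add: part_set_part)
    then show ?thesis
      using weight_upd[of i nu \<phi> "resort (set_part ?p1 k (?y + 1))"] move2
        part_weight_set_part[of "\<phi> i" ?p1 k "?y + 1"] part_weight_set_part[of "\<phi> i" "nu ! i" j "?x - 1"] \<phi>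
      by simp
  qed
  with move2 show ?thesis by (intro that[of i i ?y ?x "?y + 1" "?x - 1"]) auto
next
  case (move3 i1 i2 j1 j2)
  let ?x = "part (nu ! i1) j1" and ?y = "part (nu ! i2) j2"
  have "weight \<phi> nu' + \<phi> i1 ?x + \<phi> i2 ?y = weight \<phi> nu + \<phi> i1 (?x + 1) + \<phi> i2 (?y - 1)"
    if \<phi>: "\<And>i. \<phi> i 0 = 0" for \<phi>
  proof -
    let ?q1 = "set_part (nu ! i1) j1 (?x + 1)" and ?q2 = "set_part (nu ! i2) j2 (?y - 1)"
    have "weight \<phi> nu' + part_weight (\<phi> i2) (nu ! i2) = weight \<phi> (nu[i1 := resort ?q1]) + part_weight (\<phi> i2) ?q2"
      using move3 weight_upd[of i2 "nu[i1 := resort ?q1]" \<phi> "resort ?q2"] by simp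
    moreover have "weight \<phi> (nu[i1 := resort ?q1]) + part_weight (\<phi> i1) (nu ! i1) = weight \<phi> nu + part_weight (\<phi> i1) ?q1"
      using move3 weight_upd[of i1 nu \<phi> "resort ?q1"] by simp
    ultimately show ?thesis
      using part_weight_set_part[of "\<phi> i1" "nu ! i1" j1 "?x + 1"]
        part_weight_set_part[of "\<phi> i2" "nu ! i2" j2 "?y - 1"] \<phi> by simp
  qed
  with move3 show ?thesis by (intro that[of i1 i2 ?x ?y "?x + 1" "?y - 1"]) auto
qed

definition total :: "nat list list \<Rightarrow> nat" where
  "total = weight (\<lambda>i v. v)"

lemma move_total: "move nu nu' \<Longrightarrow> total nu' = total nu"
  unfolding total_def
proof (elim move_weight)
  fix i1 i2 x y x' y' :: nat
  assume *: "(i1 < i2 \<and> x' = y \<and> y' = x) \<or> (x + 1 < y \<and> x' = x + 1 \<and> y' = y - 1)"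
    and "\<And>\<phi>. (\<And>i. \<phi> i 0 = 0) \<Longrightarrow> weight \<phi> nu' + \<phi> i1 x + \<phi> i2 y = weight \<phi> nu + \<phi> i1 x' + \<phi> i2 y'"
  from this(2)[of "\<lambda>i v. v"] * show "weight (\<lambda>i v. v) nu' = weight (\<lambda>i v. v) nu" by auto
qed

text \<open>A unit transfer lowers the sum of squares and does not raise the sum of i * v; an
  exchange keeps the squares and lowers the latter, since the larger part goes to the smaller index.
  This makes the order irreflexive and separates the leading term from the sum.\<close>

lemma move_decreasing:
  assumes "move nu nu'"
  shows "weight (\<lambda>i v. v * v + i * v) nu' < weight (\<lambda>i v. v * v + i * v) nu"
  using assms
proof (rule move_weight)
  fix i1 i2 x y x' y' :: nat
  let ?\<phi> = "\<lambda>i v. v * v + i * v"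
  assume le: "i1 \<le> i2" "x < y"
    and *: "(i1 < i2 \<and> x' = y \<and> y' = x) \<or> (x + 1 < y \<and> x' = x + 1 \<and> y' = y - 1)"
    and W: "\<And>\<phi>. (\<And>i. \<phi> i 0 = 0) \<Longrightarrow> weight \<phi> nu' + \<phi> i1 x + \<phi> i2 y = weight \<phi> nu + \<phi> i1 x' + \<phi> i2 y'"
  from le obtain d e where d: "i2 = i1 + d" and e: "y = x + Suc e"
    by (metis le_iff_add less_iff_Suc_add add_Suc_right)
  have "?\<phi> i1 x' + ?\<phi> i2 y' < ?\<phi> i1 x + ?\<phi> i2 y"
    using *
  proof
    assume "i1 < i2 \<and> x' = y \<and> y' = x"
    then show ?thesis unfolding d e by (auto simp: algebra_simps)
  next
    assume **: "x + 1 < y \<and> x' = x + 1 \<and> y' = y - 1"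
    then obtain f where "e = Suc f" unfolding e by (cases e) auto
    with ** show ?thesis unfolding d e by (auto simp: algebra_simps)
  qed
  with W[of ?\<phi>] show ?thesis by simp
qed

lemma move_Par: "move nu nu' \<Longrightarrow> nu \<in> Par r \<Longrightarrow> nu' \<in> Par r"
  by (induction rule: move.induct)
    (auto simp: Par_def is_partition_resort dest!: set_update_subset_insert[THEN subsetD])

lemma moves_from_Par:
  assumes "lam \<in> Par r" "move\<^sup>*\<^sup>* lam mu"
  shows "mu \<in> Par r" "total mu = total lam"
  using assms(2) by (induction rule: rtranclp_induct) (auto simp: assms(1) move_Par move_total)

text \<open>As moves preserve \<open>total\<close>, one block length beyond it leaves a zero in each
  block for every tuple that occurs.\<close>

lemma length_part_le_weight:
  assumes "nu \<in> Par r" "i < r"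
  shows "length (nu ! i) \<le> total nu"
proof -
  have p: "is_partition (nu ! i)" and r: "length nu = r" using assms by (auto simp: Par_def)
  have "size (mset (nu ! i)) \<le> (\<Sum>v\<in>#mset (nu ! i). v)"
  proof -
    have "0 \<notin># mset (nu ! i)" using p by (simp add: is_partition_def)
    then have "size M \<le> (\<Sum>v\<in>#M. v)" if "M = mset (nu ! i)" for M
      unfolding that[symmetric]
      by (induction M) (auto simp: Suc_le_eq intro: add_less_le_mono)
    then show ?thesis by blast
  qed
  then have "length (nu ! i) \<le> part_weight (\<lambda>v. v) (nu ! i)"
    by (simp add: part_weight_def positive_partition[OF p])
  also have "\<dots> \<le> total nu"
    unfolding total_def weight_def using assms r by (intro member_le_sum) auto
  finally show ?thesis .
qed

section \<open>Sorting compositions within blocks\<close>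

lemma reaches_trans:
  assumes "reaches n f b" "reach n b b'"
  shows "reaches n f b'"
  using assms(2)
proof (induction rule: rtranclp_induct)
  case (step b' b'')
  from step.hyps(2) obtain p q c where "p < q" "q < n" "b' p < c" "c \<le> b' q"
    "b'' = b'(p := c, q := b' p + b' q - c)" by (rule mv_cases)
  then show ?case by (intro reaches_between[OF step.IH, of p q c]) (auto simp: agree_def)
qed (rule assms(1))

lemma reaches_agree: "agree n f g \<Longrightarrow> reach n f b \<Longrightarrow> reaches n g b"
  by (rule reaches_trans[of n g f]) (auto simp: reaches_def agree_def)

definition ascending :: "nat \<Rightarrow> nat \<Rightarrow> (nat \<Rightarrow> nat) \<Rightarrow> bool" where
  "ascending r L b \<longleftrightarrow> (\<forall>k. Suc k < r * L \<and> Suc k div L = k div L \<longrightarrow> b k \<le> b (Suc k))"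

lemma block_sort:
  assumes "0 < L" "ascending r L f"
  shows "\<exists>c. reach (r * L) c b \<and>
    coeff_of (bump_poly (r * L) f) (mon (r * L) c) = coeff_of (bump_poly (r * L) f) (mon (r * L) b) \<and>
    block_mset L c = block_mset L b \<and> ascending r L c"
proof (induction "\<Sum>k<r * L. (r * L - k) * b k" arbitrary: b rule: less_induct)
  case less
  let ?N = "r * L"
  show ?case
  proof (cases "ascending r L b")
    case False
    then obtain k where k: "Suc k < ?N" "Suc k div L = k div L" "b (Suc k) < b k"
      by (auto simp: ascending_def not_le)
    let ?t = "transpose k (Suc k)"
    let ?b = "b \<circ> ?t"
    have upd: "?b = b(k := b (Suc k), Suc k := b k)" by (auto simp: fun_eq_iff transpose_def)
    have "(\<Sum>l<?N. (?N - l) * ?b l) < (\<Sum>l<?N. (?N - l) * b l)"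
    proof -
      let ?S = "{..<?N} - {k} - {Suc k}"
      have split: "(\<Sum>l<?N. g l) = g k + g (Suc k) + sum g ?S" for g :: "nat \<Rightarrow> nat"
        using k(1) by (simp add: sum.remove[of "{..<?N}" k] sum.remove[of "{..<?N} - {k}" "Suc k"])
      have "(\<Sum>l\<in>?S. (?N - l) * ?b l) = (\<Sum>l\<in>?S. (?N - l) * b l)"
        by (intro sum.cong) (auto simp: transpose_def)
      moreover obtain m where m: "?N - k = Suc m" "?N - Suc k = m"
        using k(1) by (metis Suc_diff_Suc Suc_lessD)
      ultimately show ?thesis unfolding split m using k(3) by (simp add: algebra_simps)
    qed
    from less[OF this] obtain c where c: "reach ?N c ?b"
      "coeff_of (bump_poly ?N f) (mon ?N c) = coeff_of (bump_poly ?N f) (mon ?N ?b)"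
      "block_mset L c = block_mset L ?b" "ascending r L c" by blast
    have "reach ?N ?b b"
      by (rule reach_between'[of k "Suc k" _ _ "b k"]) (use k in \<open>auto simp: upd fun_eq_iff\<close>)
    with c(1) have "reach ?N c b" by (rule rtranclp_trans)
    moreover have "coeff_of (bump_poly ?N f) (mon ?N ?b) = coeff_of (bump_poly ?N f) (mon ?N b)"
      using assms(2) k by (intro coeff_symmetric) (auto simp: ascending_def)
    moreover have "block_mset L ?b = block_mset L b"
      unfolding upd using k assms(1) by (intro block_mset_swap) auto
    ultimately show ?thesis using c by auto
  qed blast
qed

lemma map_block_nth:
  "k div L = i \<Longrightarrow> 0 < L \<Longrightarrow> map b [i * L..<i * L + L] ! (k mod L) = b k"
  by auto

lemma ascending_unique:
  assumes "0 < L" "ascending r L b" "ascending r L c" "\<And>i. i < r \<Longrightarrow> block_mset L b i = block_mset L c i"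
  shows "agree (r * L) b c"
  unfolding agree_def
proof (intro allI impI)
  fix k assume "k < r * L"
  then have i: "k div L < r" by (simp add: less_mult_imp_div_less)
  let ?i = "k div L"
  let ?l = "\<lambda>b. map b [?i * L..<?i * L + L]"
  have le: "Suc ?i * L \<le> r * L" using i by (intro mult_le_mono1) simp
  have sorted: "sorted (?l b)" if "ascending r L b" for b :: "nat \<Rightarrow> nat"
    unfolding sorted_iff_nth_Suc
  proof (intro allI impI)
    fix j assume "Suc j < length (?l b)"
    then have j: "Suc j < L" by simp
    have d: "(i * L + j) div L = i" if "j < L" for i j using that by simp
    have "Suc (?i * L + j) div L = ?i" "(?i * L + j) div L = ?i"
      unfolding add_Suc_right[symmetric] by (rule d[OF j], rule d[OF Suc_lessD[OF j]])
    moreover have "Suc (?i * L + j) < r * L" using j le by simp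
    ultimately show "?l b ! j \<le> ?l b ! Suc j"
      using that j unfolding ascending_def by simp
  qed
  have "mset (?l b) = mset (?l c)"
    using assms(4)[OF i] by (simp add: block_mset_def)
  then have "sort (?l c) = ?l b" using sorted[OF assms(2)] by (rule properties_for_sort)
  moreover have "sort (?l c) = ?l c" using sorted[OF assms(3)] by (rule sorted_sort_id)
  ultimately have "?l b = ?l c" by (rule trans[OF sym])
  then show "b k = c k" using map_block_nth[OF refl assms(1)] by metis
qed

section \<open>Compositions of a given type and the moves that they induce\<close>

definition has_type :: "nat \<Rightarrow> nat \<Rightarrow> (nat \<Rightarrow> nat) \<Rightarrow> nat list list \<Rightarrow> bool" where
  "has_type r L b nu \<longleftrightarrow> (\<forall>i<r. positive (block_mset L b i) = mset (nu ! i))"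

lemma mset_eq_positive:
  assumes "positive A = positive B" "size A = size B"
  shows "A = B"
proof -
  have zeros: "filter_mset (\<lambda>v. \<not> 0 < v) M = replicate_mset (count M 0) 0" for M :: "nat multiset"
    by (simp add: filter_eq_replicate_mset)
  have split: "M = positive M + replicate_mset (count M 0) 0" for M :: "nat multiset"
    unfolding zeros[symmetric] by (rule multiset_partition)
  have "size M = size (positive M) + count M 0" for M :: "nat multiset"
    using arg_cong[OF split[of M], of size] by simp
  from this[of A] this[of B] assms have "count A 0 = count B 0" by simp
  have "A = positive A + replicate_mset (count A 0) 0" by (rule split)
  also have "\<dots> = positive B + replicate_mset (count B 0) 0"
    by (simp only: assms(1) \<open>count A 0 = count B 0\<close>)
  also have "\<dots> = B" by (rule split[symmetric])
  finally show ?thesis .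
qed

lemma has_type_unique:
  assumes "has_type r L b nu" "has_type r L c nu" "i < r"
  shows "block_mset L b i = block_mset L c i"
proof (rule mset_eq_positive)
  show "positive (block_mset L b i) = positive (block_mset L c i)"
    using assms by (simp add: has_type_def)
qed (simp add: size_block_mset)

lemma has_type_upd:
  assumes "has_type r L b nu" "k div L = i" "0 < L" "b k = part (nu ! i) j" "i < length nu"
    "nu \<in> Par r"
  shows "has_type r L (b(k := v)) (nu[i := resort (set_part (nu ! i) j v)])"
  unfolding has_type_def
proof (intro allI impI)
  fix i' assume i': "i' < r"
  show "positive (block_mset L (b(k := v)) i') = mset (nu[i := resort (set_part (nu ! i) j v)] ! i')"
  proof (cases "i' = i")
    case True
    have "is_partition (nu ! i)" using assms(5,6) by (auto simp: Par_def)
    then have "positive (block_mset L b i) = positive (mset (nu ! i))"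
      using assms(1) i' True by (simp add: has_type_def positive_partition)
    from block_set_part[OF this assms(2,3,4), of v] show ?thesis
      using True assms(5) by (simp add: mset_resort)
  next
    case False
    then show ?thesis using assms i' by (simp add: has_type_def block_mset_upd_other)
  qed
qed

lemma has_type_part:
  assumes "has_type r L b nu" "k div L = i" "i < r" "0 < L"
  obtains j where "part (nu ! i) j = b k"
proof -
  have "b k \<in># block_mset L b i" using assms by (intro block_mset_mem)
  then have "b k = 0 \<or> b k \<in> set (nu ! i)"
  proof (cases "b k = 0")
    case False
    with \<open>b k \<in># block_mset L b i\<close> have "b k \<in># positive (block_mset L b i)" by simp
    with assms(1,3) show ?thesis by (simp add: has_type_def)
  qed simp
  then show ?thesis using part_ex that by metis
qed

text \<open>Across two blocks, an exchange is Move 1 and a unit transfer is Move 3. Within one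
  block, an exchange leaves the type unchanged and a unit transfer is Move 2.\<close>

lemma mv_to_move:
  assumes L: "0 < L" and mv: "mv (r * L) b b'" and nu: "nu \<in> Par r" and ty: "has_type r L b nu"
  shows "\<exists>nu'\<in>Par r. has_type r L b' nu' \<and> (nu' = nu \<or> move nu nu')"
proof -
  from mv obtain p q where pq: "p < q" "q < r * L" "b p < b q"
    and b': "b' = b(p := b q, q := b p) \<or> (Suc (b p) < b q \<and> b' = b(p := Suc (b p), q := b q - 1))"
    unfolding mv_def by blast
  let ?i1 = "p div L" and ?i2 = "q div L"
  have i: "?i1 \<le> ?i2" "?i2 < r" using pq by (auto simp: div_le_mono less_mult_imp_div_less)
  have r: "length nu = r" using nu by (simp add: Par_def)
  obtain j1 where j1: "part (nu ! ?i1) j1 = b p" using has_type_part[OF ty refl _ L] i by (meson le_less_trans)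
  obtain j2 where j2: "part (nu ! ?i2) j2 = b q" using has_type_part[OF ty refl i(2) L] by blast
  have other: "?thesis" if M: "move nu (nu[?i1 := resort (set_part (nu ! ?i1) j1 x), ?i2 := resort (set_part (nu ! ?i2) j2 y)])"
    and lt: "?i1 < ?i2" and eq: "b' = b(p := x, q := y)" for x y
  proof -
    let ?nu1 = "nu[?i1 := resort (set_part (nu ! ?i1) j1 x)]"
    have 1: "has_type r L (b(p := x)) ?nu1"
      by (rule has_type_upd[OF ty]) (use L j1 i r nu in auto)
    have "?nu1 \<in> Par r" using nu i r
      by (auto simp: Par_def is_partition_resort dest!: set_update_subset_insert[THEN subsetD])
    then have "has_type r L ((b(p := x))(q := y)) (?nu1[?i2 := resort (set_part (?nu1 ! ?i2) j2 y)])"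
      by (intro has_type_upd[OF 1]) (use L j2 i r nu pq lt in auto)
    then have "has_type r L b' (?nu1[?i2 := resort (set_part (nu ! ?i2) j2 y)])"
      using lt eq by simp
    with M move_Par[OF M nu] show ?thesis by blast
  qed
  show ?thesis
  proof (cases "?i1 = ?i2")
    case False
    with i have lt: "?i1 < ?i2" by simp
    from b' show ?thesis
    proof
      assume e: "b' = b(p := b q, q := b p)"
      show ?thesis
        by (rule other[OF _ lt e]) (use move1[OF lt, of nu j1 j2] i r pq j1 j2 in simp)
    next
      assume e: "Suc (b p) < b q \<and> b' = b(p := Suc (b p), q := b q - 1)"
      show ?thesis
        by (rule other[OF _ lt conjunct2[OF e]]) (use move3[OF lt, of nu j1 j2] i r e j1 j2 in simp)
    qed
  next
    case True
    from b' show ?thesis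
    proof
      assume e: "b' = b(p := b q, q := b p)"
      have "block_mset L b' = block_mset L b"
        unfolding e using True pq L by (intro block_mset_swap) auto
      with ty nu show ?thesis unfolding has_type_def by auto
    next
      assume e: "Suc (b p) < b q \<and> b' = b(p := Suc (b p), q := b q - 1)"
      let ?i = "?i2"
      have part: "is_partition (nu ! ?i)" using nu i r by (auto simp: Par_def)
      have gt: "part (nu ! ?i) j2 > part (nu ! ?i) j1 + 1" using e j1 j2 True by simp
      \<comment> \<open>Parts weakly decrease, so the larger part has the smaller index, as Move 2
        demands.\<close>
      have jj: "j2 < j1" using part_antimono[OF part, of j1 j2] gt by (cases "j1 \<le> j2") auto
      let ?p1 = "set_part (nu ! ?i) j2 (part (nu ! ?i) j2 - 1)"
      let ?nu' = "nu[?i := resort (set_part ?p1 j1 (part (nu ! ?i) j1 + 1))]"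
      have M: "move nu ?nu'" by (rule move2) (use gt jj i r in auto)
      have "has_type r L b' ?nu'"
        unfolding has_type_def
      proof (intro allI impI)
        fix i' assume i': "i' < r"
        show "positive (block_mset L b' i') = mset (?nu' ! i')"
        proof (cases "i' = ?i")
          case True': True
          have "positive (block_mset L b ?i) = positive (mset (nu ! ?i))"
            using ty i by (simp add: has_type_def positive_partition[OF part])
          then have 1: "positive (block_mset L (b(q := b q - 1)) ?i) = positive (mset ?p1)"
            using block_set_part[of L b ?i "nu ! ?i" q j2 "b q - 1"] L j2 by simp
          have "(b(q := b q - 1)) p = part ?p1 j1"
            using jj j1 True pq by (simp add: part_set_part)
          with block_set_part[OF 1 True L, where j = j1 and v = "b p + 1"]
          have "positive (block_mset L ((b(q := b q - 1))(p := b p + 1)) ?i) =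
              positive (mset (set_part ?p1 j1 (b p + 1)))" by blast
          moreover have "(b(q := b q - 1))(p := b p + 1) = b'" using e pq by (auto simp: fun_eq_iff)
          ultimately show ?thesis using True' i r j1 True by (simp add: mset_resort)
        next
          case False
          with e True ty i' show ?thesis by (simp add: has_type_def block_mset_upd_other)
        qed
      qed
      with M move_Par[OF M nu] show ?thesis by blast
    qed
  qed
qed

lemma block_pos_less: "k div L = i \<Longrightarrow> i < i' \<Longrightarrow> l div L = i' \<Longrightarrow> (k::nat) < l"
  by (metis div_le_mono leD not_less)

lemma zero_mem_block:
  assumes "has_type r L b nu" "i < r" "length (nu ! i) < L"
  shows "0 \<in># block_mset L b i"
proof (rule ccontr)
  assume "0 \<notin># block_mset L b i"
  then have "positive (block_mset L b i) = block_mset L b i"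
    by (auto simp: filter_mset_eq_conv intro!: gr0I)
  then have "size (block_mset L b i) = length (nu ! i)"
    using assms(1,2) by (simp add: has_type_def flip: size_mset)
  with assms(3) show False by (simp add: size_block_mset)
qed

lemma div_less_bound: "k div L < r \<Longrightarrow> 0 < L \<Longrightarrow> (k::nat) < r * L"
  using div_less_iff_less_mult by blast

text \<open>The preimage arises by undoing the move at positions of b' that hold the new
  parts.\<close>

lemma move_to_reach:
  assumes L: "total nu' < L" and mv: "move nu nu'" and nu: "nu \<in> Par r" and ty: "has_type r L b' nu'"
  shows "\<exists>b. has_type r L b nu \<and> reach (r * L) b b'"
proof -
  have r: "length nu = r" using nu by (simp add: Par_def)
  have nu': "nu' \<in> Par r" using mv nu by (rule move_Par)
  have L0: "0 < L" using L by simp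
  have posn: "positive (mset (nu ! i)) = mset (nu ! i)" if "i < r" for i
    using nu that by (intro positive_partition) (auto simp: Par_def)
  \<comment> \<open>Move 1 may turn a part into zero; the bound on L provides an entry at which this
    can be undone.\<close>
  have zero: "0 \<in># block_mset L b' i" if "i < r" for i
    using zero_mem_block[OF ty that] length_part_le_weight[OF nu' that] L by simp
  have two: "\<exists>k1 k2. k1 div L = i1 \<and> k2 div L = i2 \<and> b' k1 = x \<and> b' k2 = y \<and>
      has_type r L (b'(k1 := part (nu ! i1) j1, k2 := part (nu ! i2) j2)) nu"
    if i: "i1 < i2" "i2 < r" and x: "0 < x"
      and e: "nu' = nu[i1 := resort (set_part (nu ! i1) j1 x), i2 := resort (set_part (nu ! i2) j2 y)]"
    for i1 i2 j1 j2 x y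
  proof -
    have t1: "positive (block_mset L b' i1) = positive (mset (set_part (nu ! i1) j1 x))"
      using ty i r by (simp add: has_type_def e mset_resort)
    obtain k1 where k1: "k1 div L = i1" "b' k1 = x"
      "positive (block_mset L (b'(k1 := part (nu ! i1) j1)) i1) = positive (mset (nu ! i1))"
      using block_set_part_undo[OF t1 L0] x by blast
    have t2: "positive (block_mset L b' i2) = positive (mset (set_part (nu ! i2) j2 y))"
      using ty i r by (simp add: has_type_def e mset_resort)
    obtain k2 where k2: "k2 div L = i2" "b' k2 = y"
      "positive (block_mset L (b'(k2 := part (nu ! i2) j2)) i2) = positive (mset (nu ! i2))"
      using block_set_part_undo[OF t2 L0] zero[OF i(2)] by blast
    have "has_type r L (b'(k1 := part (nu ! i1) j1, k2 := part (nu ! i2) j2)) nu"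
      unfolding has_type_def
    proof (intro allI impI)
      fix i assume ir: "i < r"
      have comm: "b'(k1 := part (nu ! i1) j1, k2 := part (nu ! i2) j2) =
          b'(k2 := part (nu ! i2) j2, k1 := part (nu ! i1) j1)"
        using k1 k2 i by (intro fun_upd_twist) auto
      consider "i = i1" | "i = i2" | "i \<noteq> i1" "i \<noteq> i2" by blast
      then show "positive (block_mset L (b'(k1 := part (nu ! i1) j1, k2 := part (nu ! i2) j2)) i) = mset (nu ! i)"
      proof cases
        case 1
        then show ?thesis using k1 k2 i posn by (simp add: block_mset_upd_other)
      next
        case 2
        then show ?thesis unfolding comm using k1 k2 i posn by (simp add: block_mset_upd_other)
      next
        case 3
        then show ?thesis using k1 k2 ty ir r e by (simp add: block_mset_upd_other has_type_def)
      qed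
    qed
    with k1 k2 show ?thesis by blast
  qed
  from mv show ?thesis
  proof cases
    case (move1 i1 i2 j1 j2)
    let ?x = "part (nu ! i1) j1" and ?y = "part (nu ! i2) j2"
    from two[of i1 i2 ?y j1 j2 ?x] move1 r obtain k1 k2 where
      k: "k1 div L = i1" "k2 div L = i2" "b' k1 = ?y" "b' k2 = ?x" "has_type r L (b'(k1 := ?x, k2 := ?y)) nu"
      by auto
    have "reach (r * L) (b'(k1 := ?x, k2 := ?y)) b'"
      by (rule reach_between'[of k1 k2 _ _ ?y])
        (use k move1 r L0 block_pos_less[OF k(1) _ k(2)] in \<open>auto simp: fun_eq_iff intro!: div_less_bound\<close>)
    with k(5) show ?thesis by blast
  next
    case (move3 i1 i2 j1 j2)
    let ?x = "part (nu ! i1) j1" and ?y = "part (nu ! i2) j2"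
    from two[of i1 i2 "?x + 1" j1 j2 "?y - 1"] move3 r obtain k1 k2 where
      k: "k1 div L = i1" "k2 div L = i2" "b' k1 = ?x + 1" "b' k2 = ?y - 1" "has_type r L (b'(k1 := ?x, k2 := ?y)) nu"
      by auto
    have "reach (r * L) (b'(k1 := ?x, k2 := ?y)) b'"
      by (rule reach_between'[of k1 k2 _ _ "?x + 1"])
        (use k move3 r L0 block_pos_less[OF k(1) _ k(2)] in \<open>auto simp: fun_eq_iff intro!: div_less_bound\<close>)
    with k(5) show ?thesis by blast
  next
    case (move2 i j k)
    let ?x = "part (nu ! i) j" and ?y = "part (nu ! i) k"
    let ?p1 = "set_part (nu ! i) j (?x - 1)"
    have t1: "positive (block_mset L b' i) = positive (mset (set_part ?p1 k (?y + 1)))"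
      using ty move2 r by (simp add: has_type_def mset_resort)
    obtain q where q: "q div L = i" "b' q = ?y + 1"
      "positive (block_mset L (b'(q := part ?p1 k)) i) = positive (mset ?p1)"
      using block_set_part_undo[OF t1 L0] by auto
    have y: "part ?p1 k = ?y" using move2 by (simp add: part_set_part)
    have "0 < ?x - 1" using move2 by simp
    then obtain p where p: "p div L = i" "(b'(q := ?y)) p = ?x - 1"
      "positive (block_mset L ((b'(q := ?y))(p := ?x)) i) = positive (mset (nu ! i))"
      using block_set_part_undo[OF q(3)[unfolded y] L0] by blast
    have pq: "p \<noteq> q" "b' p = ?x - 1" using p(2) move2 by (auto split: if_splits)
    let ?b = "b'(q := ?y, p := ?x)"
    have tb: "has_type r L ?b nu"
      unfolding has_type_def
    proof (intro allI impI)
      fix i' assume "i' < r"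
      then show "positive (block_mset L ?b i') = mset (nu ! i')"
        using p q ty posn move2 by (cases "i' = i") (auto simp: block_mset_upd_other has_type_def)
    qed
    have lt: "p < r * L" "q < r * L" using p q move2 r L0 by (auto intro!: div_less_bound)
    show ?thesis
    proof (cases "q < p")
      case True
      have "reach (r * L) ?b b'"
        by (rule reach_between'[of q p _ _ "?y + 1"]) (use True lt pq q move2 in \<open>auto simp: fun_eq_iff\<close>)
      with tb show ?thesis by blast
    next
      case False
      \<comment> \<open>The positions come in the wrong order for a transfer from right to left.
        Exchanging their values does not alter the type, and the redistribution then starts from the
        exchanged composition.\<close>
      with pq have lt': "p < q" by simp
      let ?c = "?b(p := ?b q, q := ?b p)"
      have "block_mset L ?c = block_mset L ?b"
        using pq p(1) q(1) L0 by (intro block_mset_swap) auto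
      with tb have "has_type r L ?c nu" by (simp add: has_type_def)
      moreover have "reach (r * L) ?c b'"
        by (rule reach_between'[of p q _ _ "?x - 1"]) (use lt' lt pq q move2 in \<open>auto simp: fun_eq_iff\<close>)
      ultimately show ?thesis by blast
    qed
  qed
qed

section \<open>The monomial expansion\<close>

definition block_type :: "(nat \<times> nat) monom \<Rightarrow> nat \<Rightarrow> nat multiset" where
  "block_type M i = image_mset (expo M) (mset_set (Poly_Mapping.keys M \<inter> {i} \<times> UNIV))"

definition monom_type :: "nat \<Rightarrow> (nat \<times> nat) monom \<Rightarrow> nat list list \<Rightarrow> bool" where
  "monom_type r M mu \<longleftrightarrow> Poly_Mapping.keys M \<subseteq> {..<r} \<times> UNIV \<and> (\<forall>i<r. block_type M i = mset (mu ! i))"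

lemma monom_type_unique:
  assumes "monom_type r M mu" "monom_type r M nu" "mu \<in> Par r" "nu \<in> Par r"
  shows "mu = nu"
proof (rule nth_equalityI)
  show "length mu = length nu" using assms by (simp add: Par_def)
  fix i assume i: "i < length mu"
  then have "is_partition (mu ! i)" "is_partition (nu ! i)" "i < r"
    using assms(3,4) by (auto simp: Par_def)
  then show "mu ! i = nu ! i"
    using assms(1,2) by (simp add: monom_type_def flip: partition_eq_iff_mset)
qed

lemma monom_type_ex:
  assumes "Poly_Mapping.keys M \<subseteq> {..<r} \<times> UNIV"
  shows "\<exists>mu\<in>Par r. monom_type r M mu"
proof
  let ?p = "\<lambda>i. rev (sorted_list_of_multiset (block_type M i))"
  let ?mu = "map ?p [0..<r]"
  have "0 \<notin># block_type M i" for i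
    by (auto simp: block_type_def in_keys_iff)
  then have "is_partition (?p i)" for i
    by (simp add: is_partition_def sorted_wrt_rev)
  then show "?mu \<in> Par r" by (auto simp: Par_def)
  show "monom_type r M ?mu" using assms by (simp add: monom_type_def)
qed

lemma monom_of_type_ex:
  assumes "mu \<in> Par r"
  shows "\<exists>M. monom_type r M mu"
proof -
  define h where "h = (\<lambda>(i, j). if i < r \<and> j < length (mu ! i) then mu ! i ! j else 0)"
  define M where "M = Abs_poly_mapping h"
  have "finite {v. h v \<noteq> 0}"
    by (rule finite_subset[of _ "Sigma {..<r} (\<lambda>i. {..<length (mu ! i)})"])
      (auto simp: h_def split: if_splits)
  then have M: "expo M = h" by (simp add: M_def)
  have pos: "mu ! i ! j \<noteq> 0" if "i < r" "j < length (mu ! i)" for i j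
  proof -
    have "mu ! i \<in> set mu" using assms that(1) by (simp add: Par_def)
    then have "is_partition (mu ! i)" using assms by (simp add: Par_def)
    then show ?thesis using nth_mem[OF that(2)] unfolding is_partition_def by metis
  qed
  have keys: "Poly_Mapping.keys M = Sigma {..<r} (\<lambda>i. {..<length (mu ! i)})"
    using pos by (auto simp: in_keys_iff M h_def split: if_splits)
  have "block_type M i = mset (mu ! i)" if i: "i < r" for i
  proof -
    have "Poly_Mapping.keys M \<inter> {i} \<times> UNIV = Pair i ` {..<length (mu ! i)}"
      using i by (auto simp: keys)
    then have "block_type M i = image_mset (expo M) (image_mset (Pair i) (mset_set {..<length (mu ! i)}))"
      by (simp add: block_type_def image_mset_mset_set inj_on_def)
    also have "\<dots> = image_mset (\<lambda>j. mu ! i ! j) (mset_set {..<length (mu ! i)})"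
      unfolding multiset.map_comp using i by (intro image_mset_cong) (auto simp: M h_def)
    also have "\<dots> = mset (map (\<lambda>j. mu ! i ! j) [0..<length (mu ! i)])"
      by (simp add: lessThan_atLeast0)
    finally show ?thesis by (simp add: map_nth)
  qed
  moreover have "Poly_Mapping.keys M \<subseteq> {..<r} \<times> UNIV" unfolding keys by auto
  ultimately show ?thesis unfolding monom_type_def by blast
qed

lemma offset_const: "offset (\<lambda>_. L) i = i * L"
  by (simp add: offset_def)

lemma flat_const: "i < r \<Longrightarrow> j < L \<Longrightarrow> flat r (\<lambda>_. L) h (i * L + j) = h (i, j)"
  using flat_nth[of i r j "\<lambda>_. L" h] by (simp add: offset_const)

lemma positive_block_mset_flat:
  assumes "Poly_Mapping.keys M \<subseteq> {..<r} \<times> {..<L}" "i < r"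
  shows "positive (block_mset L (flat r (\<lambda>_. L) (expo M)) i) = block_type M i"
proof -
  let ?b = "flat r (\<lambda>_. L) (expo M)"
  let ?S = "{k \<in> {i * L..<i * L + L}. 0 < ?b k}"
  let ?f = "\<lambda>k. (i, k - i * L)"
  have b: "?b k = expo M (?f k)" if "k \<in> {i * L..<i * L + L}" for k
    using flat_const[of i r "k - i * L" L "expo M"] that assms(2) by auto
  have inj: "inj_on ?f ?S" by (auto simp: inj_on_def)
  have im: "?f ` ?S = Poly_Mapping.keys M \<inter> {i} \<times> UNIV"
  proof (intro equalityI subsetI)
    fix v assume v: "v \<in> Poly_Mapping.keys M \<inter> {i} \<times> UNIV"
    then obtain j where v': "v = (i, j)" "(i, j) \<in> Poly_Mapping.keys M" by auto
    with assms(1) have "(i, j) \<in> {..<r} \<times> {..<L}" by blast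
    with v' have j: "v = (i, j)" "j < L" "0 < expo M (i, j)"
      by (auto simp: in_keys_iff)
    then have "i * L + j \<in> ?S" using b[of "i * L + j"] by simp
    then show "v \<in> ?f ` ?S" using j by (intro image_eqI[of _ _ "i * L + j"]) auto
  next
    fix v assume "v \<in> ?f ` ?S"
    then obtain k where "v = ?f k" "k \<in> ?S" by blast
    then show "v \<in> Poly_Mapping.keys M \<inter> {i} \<times> UNIV" using b[of k] by (auto simp: in_keys_iff)
  qed
  have "positive (block_mset L ?b i) = image_mset ?b (mset_set ?S)"
    by (simp add: block_mset_def filter_mset_image_mset)
  also have "\<dots> = image_mset (expo M) (image_mset ?f (mset_set ?S))"
    unfolding multiset.map_comp using b by (intro image_mset_cong) auto
  also have "\<dots> = block_type M i"
    by (simp only: image_mset_mset_set[OF inj] im block_type_def)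
  finally show ?thesis .
qed

lemma monom_type_iff_has_type:
  assumes "Poly_Mapping.keys M \<subseteq> {..<r} \<times> {..<L}"
  shows "monom_type r M mu \<longleftrightarrow> has_type r L (flat r (\<lambda>_. L) (expo M)) mu"
  using assms positive_block_mset_flat[OF assms]
  by (auto simp: monom_type_def has_type_def)

subsection \<open>The support of a multi-symmetric Schur function\<close>

text \<open>A common block length beyond \<open>total lam\<close> leaves room for every tuple
  reachable from lam, with a zero in each block.\<close>

locale block_composition =
  fixes r L :: nat and lam :: "nat list list"
  assumes lam_Par: "lam \<in> Par r" and total_less: "total lam < L"
begin

abbreviation \<gamma> :: "nat \<Rightarrow> nat" where
  "\<gamma> \<equiv> flat r (\<lambda>_. L) (block_entry lam (\<lambda>_. L))"

lemma L0: "0 < L"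
  using total_less by simp

lemma length_part: "i < r \<Longrightarrow> length (lam ! i) < L"
  using length_part_le_weight[OF lam_Par] total_less by (meson le_less_trans)

lemma fits: "fits lam (\<lambda>_. L)"
  using length_part lam_Par by (auto simp: fits_def Par_def less_imp_le)

lemma has_type_\<gamma>: "has_type r L \<gamma> lam"
  unfolding has_type_def
proof (intro allI impI)
  fix i assume i: "i < r"
  let ?l = "replicate (L - length (lam ! i)) 0 @ rev (lam ! i)"
  have "map \<gamma> [i * L..<i * L + L] = ?l"
    using length_part[OF i] i by (intro nth_equalityI) (auto simp: flat_const block_entry_def)
  then have "block_mset L \<gamma> i = mset ?l"
    unfolding block_mset_def by (metis mset_map mset_upt)
  moreover have "is_partition (lam ! i)" using lam_Par i by (auto simp: Par_def)
  ultimately show "positive (block_mset L \<gamma> i) = mset (lam ! i)"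
    by (simp add: positive_partition filter_mset_eq_conv)
qed

lemma ascending_\<gamma>: "ascending r L \<gamma>"
  unfolding ascending_def
proof (intro allI impI)
  fix k assume k: "Suc k < r * L \<and> Suc k div L = k div L"
  define i j where "i = k div L" and "j = k mod L"
  have kij: "k = i * L + j" by (simp add: i_def j_def)
  have i: "i < r" unfolding i_def using k by (simp add: less_mult_imp_div_less)
  have "Suc j < L"
  proof (rule ccontr)
    assume "\<not> Suc j < L"
    moreover have "j < L" using L0 by (simp add: j_def)
    ultimately have "Suc j = L" by simp
    then have "Suc k = Suc i * L" using kij by simp
    then have "Suc k div L = Suc i" using L0 by (metis nonzero_mult_div_cancel_right less_not_refl)
    with k show False by (simp add: i_def)
  qed
  then show "\<gamma> k \<le> \<gamma> (Suc k)"
    using block_entry_mono[OF lam_Par i, of j "Suc j" "\<lambda>_. L"] length_part[OF i] i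
      flat_const[of i r j L] flat_const[of i r "Suc j" L] by (simp add: kij)
qed

text \<open>Sorting within the blocks preserves coefficients, and the sorted composition is
  determined by the type.\<close>

lemma coeff_has_type:
  assumes "has_type r L b mu" "has_type r L c mu"
  shows "coeff_of (bump_poly (r * L) \<gamma>) (mon (r * L) b) = coeff_of (bump_poly (r * L) \<gamma>) (mon (r * L) c)"
proof -
  obtain b' where b': "coeff_of (bump_poly (r * L) \<gamma>) (mon (r * L) b') = coeff_of (bump_poly (r * L) \<gamma>) (mon (r * L) b)"
    "block_mset L b' = block_mset L b" "ascending r L b'"
    using block_sort[OF L0 ascending_\<gamma>] by blast
  obtain c' where c': "coeff_of (bump_poly (r * L) \<gamma>) (mon (r * L) c') = coeff_of (bump_poly (r * L) \<gamma>) (mon (r * L) c)"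
    "block_mset L c' = block_mset L c" "ascending r L c'"
    using block_sort[OF L0 ascending_\<gamma>] by blast
  have "agree (r * L) b' c'"
    by (rule ascending_unique[OF L0 b'(3) c'(3)]) (simp add: b' c' has_type_unique[OF assms])
  then show ?thesis using mon_agree b'(1) c'(1) by metis
qed

text \<open>Moves are lifted backwards from a prescribed b. At the start of the chain, an arbitrary
  composition of type lam is reached from its blockwise sorted form, which is
  \<open>\<gamma>\<close>.\<close>

lemma reaches_if_moves: "move\<^sup>*\<^sup>* lam mu \<Longrightarrow> has_type r L b mu \<Longrightarrow> reaches (r * L) \<gamma> b"
proof (induction arbitrary: b rule: rtranclp_induct)
  case base
  obtain c where c: "reach (r * L) c b" "block_mset L c = block_mset L b" "ascending r L c"
    using block_sort[OF L0 ascending_\<gamma>] by blast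
  have "agree (r * L) c \<gamma>"
    by (rule ascending_unique[OF L0 c(3) ascending_\<gamma>]) (simp add: c has_type_unique[OF base has_type_\<gamma>])
  with c(1) show ?case by (intro reaches_agree)
next
  case (step nu nu')
  have nu: "nu \<in> Par r" "total nu = total lam" using moves_from_Par[OF lam_Par step.hyps(1)] by blast+
  with move_total[OF step.hyps(2)] total_less obtain c where "has_type r L c nu" "reach (r * L) c b"
    using move_to_reach[OF _ step.hyps(2) nu(1) step.prems] by auto
  with step.IH show ?case by (blast intro: reaches_trans)
qed

lemma moves_if_reaches:
  assumes "reaches (r * L) \<gamma> b" "has_type r L b mu" "mu \<in> Par r"
  shows "move\<^sup>*\<^sup>* lam mu"
proof -
  from assms(1) obtain b' where b': "reach (r * L) \<gamma> b'" "agree (r * L) b' b" by (auto simp: reaches_def)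
  from b'(1) obtain nu where nu: "nu \<in> Par r" "has_type r L b' nu" "move\<^sup>*\<^sup>* lam nu"
  proof (induction rule: rtranclp_induct)
    case base
    then show ?case using has_type_\<gamma> lam_Par by blast
  next
    case (step c c')
    from step.IH show ?case
      by (metis mv_to_move[OF L0 step.hyps(2)] rtranclp.rtrancl_into_rtrancl step.prems)
  qed
  have "nu = mu"
  proof (rule nth_equalityI)
    show "length nu = length mu" using nu(1) assms(3) by (simp add: Par_def)
    fix i assume "i < length nu"
    with nu(1) have i: "i < r" by (simp add: Par_def)
    have "Suc i * L \<le> r * L" using i by (intro mult_le_mono1) simp
    then have "block_mset L b' i = block_mset L b i"
      unfolding block_mset_def using b'(2) by (intro image_mset_cong) (auto simp: agree_def)
    then have "mset (nu ! i) = mset (mu ! i)" using nu(2) assms(2) i unfolding has_type_def by metis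
    moreover have "is_partition (nu ! i)" "is_partition (mu ! i)"
      using nu(1) assms(3) i by (auto simp: Par_def)
    ultimately show "nu ! i = mu ! i" by (simp add: partition_eq_iff_mset)
  qed
  with nu(3) show ?thesis by simp
qed

lemma multi_S_coeff:
  assumes "Poly_Mapping.keys M \<subseteq> {..<r} \<times> {..<L}"
  shows "multi_S lam M = coeff_of (bump_poly (r * L) \<gamma>) (mon (r * L) (flat r (\<lambda>_. L) (expo M)))"
proof -
  have "multi_S lam M = (if Poly_Mapping.keys M \<subseteq> {..<r} \<times> UNIV then block_coeff lam (\<lambda>_. L) (expo M) else 0)"
    using assms by (intro multi_S_eq[OF lam_Par fits]) auto
  moreover have "length lam = r" using lam_Par by (simp add: Par_def)
  ultimately show ?thesis using assms by (auto simp: block_coeff_def offset_const)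
qed

end

lemma keys_bounded_ex:
  fixes M :: "(nat \<times> nat) monom"
  obtains L where "t < L" "\<And>i j. (i, j) \<in> Poly_Mapping.keys M \<Longrightarrow> j < L"
proof -
  let ?s = "\<Sum>v\<in>Poly_Mapping.keys M. snd v"
  have "j \<le> ?s" if "(i, j) \<in> Poly_Mapping.keys M" for i j
    using member_le_sum[of "(i, j)" "Poly_Mapping.keys M" snd] that by simp
  then show ?thesis by (intro that[of "Suc (t + ?s)"]) (auto simp: less_Suc_eq_le intro: trans_le_add2)
qed

lemma multi_S_outside:
  assumes "lam \<in> Par r" "\<not> Poly_Mapping.keys M \<subseteq> {..<r} \<times> UNIV"
  shows "multi_S lam M = 0"
proof -
  obtain L where L: "total lam < L" "\<And>i j. (i, j) \<in> Poly_Mapping.keys M \<Longrightarrow> j < L"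
    using keys_bounded_ex by blast
  interpret block_composition r L lam using assms(1) L(1) by unfold_locales
  show ?thesis using multi_S_eq[OF assms(1) fits L(2)] assms(2) by simp
qed

lemma
  assumes lam: "lam \<in> Par r" and mu: "mu \<in> Par r" and M: "monom_type r M mu"
  shows multi_S_nonzero_iff: "multi_S lam M \<noteq> 0 \<longleftrightarrow> move\<^sup>*\<^sup>* lam mu"
    and multi_S_leading: "mu = lam \<Longrightarrow> multi_S lam M = 1"
    and multi_S_type: "monom_type r M' mu \<Longrightarrow> multi_S lam M' = multi_S lam M"
proof -
  obtain L1 where L1: "total lam < L1" "\<And>i j. (i, j) \<in> Poly_Mapping.keys M \<Longrightarrow> j < L1"
    using keys_bounded_ex by blast
  \<comment> \<open>This L bounds the variables of M and of M', so both monomials are read in blocks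
    of one length.\<close>
  obtain L where L: "L1 < L" "\<And>i j. (i, j) \<in> Poly_Mapping.keys M' \<Longrightarrow> j < L"
    using keys_bounded_ex by blast
  interpret block_composition r L lam using lam L1(1) L(1) by unfold_locales simp_all
  have keys: "Poly_Mapping.keys M \<subseteq> {..<r} \<times> {..<L}"
  proof (rule subrelI)
    fix i j assume ij: "(i, j) \<in> Poly_Mapping.keys M"
    then have "i < r" using M unfolding monom_type_def by blast
    with L1(2)[OF ij] L(1) show "(i, j) \<in> {..<r} \<times> {..<L}" by simp
  qed
  note S = multi_S_coeff[OF keys]
  have ty: "has_type r L (flat r (\<lambda>_. L) (expo M)) mu"
    using M monom_type_iff_has_type[OF keys] by simp
  show "multi_S lam M \<noteq> 0 \<longleftrightarrow> move\<^sup>*\<^sup>* lam mu"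
    unfolding S bump_poly_support using reaches_if_moves moves_if_reaches ty mu by blast
  show "multi_S lam M = 1" if "mu = lam"
    unfolding S using coeff_has_type[OF ty[unfolded that] has_type_\<gamma>] by (simp add: bump_poly_leading)
  show "multi_S lam M' = multi_S lam M" if M': "monom_type r M' mu"
  proof -
    have keys': "Poly_Mapping.keys M' \<subseteq> {..<r} \<times> {..<L}"
    proof (rule subrelI)
      fix i j assume ij: "(i, j) \<in> Poly_Mapping.keys M'"
      then have "i < r" using M' unfolding monom_type_def by blast
      with L(2)[OF ij] show "(i, j) \<in> {..<r} \<times> {..<L}" by simp
    qed
    have "has_type r L (flat r (\<lambda>_. L) (expo M')) mu"
      using M' monom_type_iff_has_type[OF keys'] by simp
    from coeff_has_type[OF this ty] show ?thesis unfolding S multi_S_coeff[OF keys'] .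
  qed
qed

subsection \<open>Monomial symmetric functions\<close>

lemma finite_factorizations: "finite {(A, B). A + B = (M :: 'v monom)}"
proof -
  let ?S = "{(A, B). A + B = M}"
  let ?b = "\<Sum>v\<in>Poly_Mapping.keys M. expo M v"
  let ?F = "{f. \<forall>v. (v \<in> Poly_Mapping.keys M \<longrightarrow> f v \<in> {..?b}) \<and> (v \<notin> Poly_Mapping.keys M \<longrightarrow> f v = (0::nat))}"
  have "(\<lambda>(A, B). expo A) ` ?S \<subseteq> ?F"
  proof
    fix f assume "f \<in> (\<lambda>(A, B). expo A) ` ?S"
    then obtain A B where AB: "A + B = M" "f = expo A" by auto
    then have le: "f v \<le> expo M v" for v by (auto simp: lookup_add)
    have "expo M v \<le> ?b" if "v \<in> Poly_Mapping.keys M" for v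
      using that by (intro member_le_sum) auto
    then have "f v \<in> {..?b}" if "v \<in> Poly_Mapping.keys M" for v using le[of v] that by (auto intro: le_trans)
    moreover have "f v = 0" if "v \<notin> Poly_Mapping.keys M" for v
      using le[of v] that by (simp add: in_keys_iff)
    ultimately show "f \<in> ?F" by blast
  qed
  then have "finite ((\<lambda>(A, B). expo A) ` ?S)"
    by (rule finite_subset) (rule finite_set_of_finite_funs; simp)
  moreover have "inj_on (\<lambda>(A, B). expo A) ?S"
    by (rule inj_onI) (auto simp: poly_mapping_eq_iff[symmetric])
  ultimately show ?thesis by (rule finite_imageD)
qed

definition restrict_monom :: "'v set \<Rightarrow> 'v monom \<Rightarrow> 'v monom" where
  "restrict_monom S M = Abs_poly_mapping (\<lambda>v. if v \<in> S then expo M v else 0)"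

lemma expo_restrict_monom: "expo (restrict_monom S M) v = (if v \<in> S then expo M v else 0)"
proof -
  have "finite {v. (if v \<in> S then expo M v else 0) \<noteq> 0}"
    by (rule finite_subset[of _ "Poly_Mapping.keys M"]) (auto simp: in_keys_iff)
  then show ?thesis by (simp add: restrict_monom_def)
qed

lemma keys_restrict_monom: "Poly_Mapping.keys (restrict_monom S M) = Poly_Mapping.keys M \<inter> S"
  by (auto simp: in_keys_iff expo_restrict_monom split: if_splits)

lemma block_type_restrict:
  assumes "{i} \<times> UNIV \<subseteq> S"
  shows "block_type (restrict_monom S M) i = block_type M i"
proof -
  have "Poly_Mapping.keys M \<inter> S \<inter> {i} \<times> UNIV = Poly_Mapping.keys M \<inter> {i} \<times> UNIV"
    using assms by auto
  then have "block_type (restrict_monom S M) i =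
      image_mset (expo (restrict_monom S M)) (mset_set (Poly_Mapping.keys M \<inter> {i} \<times> UNIV))"
    by (simp add: block_type_def keys_restrict_monom)
  also have "\<dots> = block_type M i"
    unfolding block_type_def using assms by (intro image_mset_cong) (auto simp: expo_restrict_monom)
  finally show ?thesis .
qed

lemma mono_sym_alt:
  "mono_sym i p M = (if Poly_Mapping.keys M \<subseteq> {i} \<times> UNIV \<and> block_type M i = mset p then 1 else 0)"
proof -
  have "Poly_Mapping.keys M \<inter> {i} \<times> UNIV = Poly_Mapping.keys M" if "Poly_Mapping.keys M \<subseteq> {i} \<times> UNIV"
    using that by blast
  then show ?thesis by (auto simp: mono_sym_def block_type_def)
qed

text \<open>The only factorization that can contribute splits M into its part in the alphabet i and
  the remainder, so the Cauchy product has at most one nonzero term.\<close>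

lemma foldr_mono_sym:
  "distinct is \<Longrightarrow> foldr series_times (map (\<lambda>i. mono_sym i (mu ! i)) is) series_one M =
    (if Poly_Mapping.keys M \<subseteq> set is \<times> UNIV \<and> (\<forall>i\<in>set is. block_type M i = mset (mu ! i)) then 1 else 0)"
proof (induction "is" arbitrary: M)
  case Nil
  then show ?case by (simp add: series_one_def)
next
  case (Cons i "is")
  let ?F = "foldr series_times (map (\<lambda>i. mono_sym i (mu ! i)) is) series_one"
  let ?t = "\<lambda>(A, B). mono_sym i (mu ! i) A * ?F B"
  let ?S = "{(A, B). A + B = M}"
  let ?U = "{i} \<times> (UNIV :: nat set)"
  let ?A = "restrict_monom ?U M" and ?B = "restrict_monom (- ?U) M"
  have F: "?F B = (if Poly_Mapping.keys B \<subseteq> set is \<times> UNIV \<and> (\<forall>i\<in>set is. block_type B i = mset (mu ! i)) then 1 else 0)" for B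
    using Cons by simp
  have AB: "(?A, ?B) \<in> ?S"
    by (auto intro!: poly_mapping_eqI simp: lookup_add expo_restrict_monom)
  have "?t x = 0" if x: "x \<in> ?S - {(?A, ?B)}" for x
  proof (rule ccontr)
    assume nz: "?t x \<noteq> 0"
    obtain A B where xAB: "x = (A, B)" by (cases x)
    with x have sum: "A + B = M" by simp
    from nz xAB have kA: "Poly_Mapping.keys A \<subseteq> ?U" and kB: "Poly_Mapping.keys B \<subseteq> set is \<times> UNIV"
      by (auto simp: mono_sym_alt F split: if_splits)
    have "i \<notin> set is" using Cons.prems by simp
    then have A0: "expo A v = 0" if "v \<notin> ?U" for v using kA that by (meson in_keys_iff subsetD)
    have B0: "expo B v = 0" if "v \<in> ?U" for v using kB that \<open>i \<notin> set is\<close> by (auto simp: in_keys_iff subset_iff)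
    have M: "expo M v = expo A v + expo B v" for v using sum by (auto simp: lookup_add)
    have "expo A v = expo ?A v \<and> expo B v = expo ?B v" for v
      using A0[of v] B0[of v] M[of v] by (cases v; cases "fst v = i") (auto simp: expo_restrict_monom)
    then have "A = ?A" "B = ?B" by (blast intro: poly_mapping_eqI)+
    then show False using x xAB by blast
  qed
  then have "(\<Sum>x\<in>?S. ?t x) = (\<Sum>x\<in>{(?A, ?B)}. ?t x)"
    using AB finite_factorizations by (intro sum.mono_neutral_right) auto
  then have S: "series_times (mono_sym i (mu ! i)) ?F M = mono_sym i (mu ! i) ?A * ?F ?B"
    by (simp add: series_times_def)
  have mA: "mono_sym i (mu ! i) ?A = (if block_type M i = mset (mu ! i) then 1 else 0)"
    by (simp add: mono_sym_alt keys_restrict_monom block_type_restrict)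
  have i: "i \<notin> set is" using Cons.prems by simp
  have bt: "block_type ?B i' = block_type M i'" if "i' \<in> set is" for i'
    using i that by (intro block_type_restrict) auto
  have kB: "Poly_Mapping.keys ?B \<subseteq> set is \<times> UNIV \<longleftrightarrow> Poly_Mapping.keys M \<subseteq> set (i # is) \<times> UNIV"
    using i by (auto simp: keys_restrict_monom)
  show ?case
    unfolding list.map foldr.simps o_apply S mA F kB using bt by auto
qed

lemma multi_m_eq: "length mu = r \<Longrightarrow> multi_m mu M = (if monom_type r M mu then 1 else 0)"
  unfolding multi_m_def by (subst foldr_mono_sym) (auto simp: monom_type_def lessThan_atLeast0)

section \<open>Existence and uniqueness of the Kostka coefficients\<close>

lemma finite_Par_total: "finite {mu \<in> Par r. total mu = t}"
proof -
  let ?A = "{p. set p \<subseteq> {..t} \<and> length p \<le> t}"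
  have "finite {mu. set mu \<subseteq> ?A \<and> length mu = r}"
    by (intro finite_lists_length_eq finite_lists_length_le) simp
  moreover have "{mu \<in> Par r. total mu = t} \<subseteq> {mu. set mu \<subseteq> ?A \<and> length mu = r}"
  proof
    fix mu assume "mu \<in> {mu \<in> Par r. total mu = t}"
    then have mu: "mu \<in> Par r" "total mu = t" by auto
    then have r: "length mu = r" by (simp add: Par_def)
    have "mu ! i \<in> ?A" if i: "i < r" for i
    proof -
      have p: "is_partition (mu ! i)" using mu i by (auto simp: Par_def)
      have "v \<le> t" if v: "v \<in> set (mu ! i)" for v
      proof -
        have "v \<le> sum_list (mu ! i)" using v by (intro member_le_sum_list) auto
        also have "\<dots> = part_weight (\<lambda>v. v) (mu ! i)"
          by (simp add: part_weight_def positive_partition[OF p] sum_mset_sum_list)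
        also have "\<dots> \<le> total mu"
          unfolding total_def weight_def using i r by (intro member_le_sum) auto
        finally show ?thesis using mu by simp
      qed
      then show ?thesis using length_part_le_weight[OF mu(1) i] mu by auto
    qed
    then show "mu \<in> {mu. set mu \<subseteq> ?A \<and> length mu = r}"
      using r by (auto simp: set_conv_nth)
  qed
  ultimately show ?thesis by (rule finite_subset[rotated])
qed

lemma finite_moves: "lam \<in> Par r \<Longrightarrow> finite {mu. move\<^sup>*\<^sup>* lam mu}"
  by (rule finite_subset[OF _ finite_Par_total[of r "total lam"]]) (auto dest: moves_from_Par)

lemma tri_less_irrefl: "\<not> lam \<lhd> lam"
proof -
  have "weight (\<lambda>i v. v * v + i * v) mu < weight (\<lambda>i v. v * v + i * v) nu" if "mu \<lhd> nu" for mu nu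
    using that unfolding tri_less_def
    by (induction rule: tranclp_induct) (auto dest: move_decreasing)
  then show ?thesis by blast
qed

text \<open>Every monomial in the r alphabets has exactly one type, and \<open>multi_S lam\<close>
  is constant on each type. Its values at representatives are therefore the coefficients of an
  expansion, and evaluation at a representative shows that there is no other.\<close>

lemma
  assumes lam: "lam \<in> Par r"
  shows keys_kostka: "Poly_Mapping.keys (kostka lam) = {mu. move\<^sup>*\<^sup>* lam mu}"
    and kostka_type: "mu \<in> Par r \<Longrightarrow> monom_type r M mu \<Longrightarrow> Poly_Mapping.lookup (kostka lam) mu = multi_S lam M"
    and multi_S_expansion: "multi_S lam M = (\<Sum>mu | move\<^sup>*\<^sup>* lam mu. Poly_Mapping.lookup (kostka lam) mu * multi_m mu M)"
proof -
  have r: "length lam = r" using lam by (simp add: Par_def)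
  let ?rep = "\<lambda>mu. SOME M. monom_type r M mu"
  have rep: "monom_type r (?rep mu) mu" if "mu \<in> Par r" for mu
    using monom_of_type_ex[OF that] by (rule someI_ex)
  let ?f = "\<lambda>mu. if mu \<in> Par r then multi_S lam (?rep mu) else 0"
  define c where "c = Abs_poly_mapping ?f"
  have supp: "?f mu \<noteq> 0 \<longleftrightarrow> move\<^sup>*\<^sup>* lam mu" for mu
    using multi_S_nonzero_iff[OF lam _ rep] moves_from_Par[OF lam] by auto
  then have "finite {mu. ?f mu \<noteq> 0}" using finite_moves[OF lam] by simp
  then have c: "Poly_Mapping.lookup c mu = ?f mu" for mu by (simp add: c_def)
  have keys: "Poly_Mapping.keys c = {mu. move\<^sup>*\<^sup>* lam mu}"
    using supp by (simp add: set_eq_iff in_keys_iff c)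
  have Par: "Poly_Mapping.keys c \<subseteq> Par r" unfolding keys using moves_from_Par[OF lam] by blast
  \<comment> \<open>At a monomial of type nu every \<open>multi_m mu\<close> vanishes except that
    for nu, so evaluation extracts a single coefficient.\<close>
  have eval: "(\<Sum>mu \<in> Poly_Mapping.keys d. Poly_Mapping.lookup d mu * multi_m mu M) = Poly_Mapping.lookup d nu"
    if d: "Poly_Mapping.keys d \<subseteq> Par r" and nu: "nu \<in> Par r" and M: "monom_type r M nu"
    for d :: "nat list list \<Rightarrow>\<^sub>0 int" and nu M
  proof -
    have "Poly_Mapping.lookup d mu * multi_m mu M = (if mu = nu then Poly_Mapping.lookup d nu else 0)"
      if "mu \<in> Poly_Mapping.keys d" for mu
    proof -
      have mu: "mu \<in> Par r" using d that by blast
      then have "length mu = r" by (simp add: Par_def)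
      then have m: "multi_m mu M = (if monom_type r M mu then 1 else 0)" by (rule multi_m_eq)
      show ?thesis
      proof (cases "mu = nu")
        case True
        then show ?thesis using m M by simp
      next
        case False
        then have "\<not> monom_type r M mu" using monom_type_unique[OF _ M mu nu] by blast
        then show ?thesis using m False by simp
      qed
    qed
    then have "(\<Sum>mu \<in> Poly_Mapping.keys d. Poly_Mapping.lookup d mu * multi_m mu M) =
        (\<Sum>mu \<in> Poly_Mapping.keys d. if mu = nu then Poly_Mapping.lookup d nu else 0)"
      by (rule sum.cong[OF refl])
    then show ?thesis by (auto simp: in_keys_iff)
  qed
  have exp: "multi_S lam M = (\<Sum>mu \<in> Poly_Mapping.keys c. Poly_Mapping.lookup c mu * multi_m mu M)" for M
  proof (cases "Poly_Mapping.keys M \<subseteq> {..<r} \<times> UNIV")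
    case True
    then obtain nu where nu: "nu \<in> Par r" "monom_type r M nu" using monom_type_ex by blast
    have "multi_S lam M = Poly_Mapping.lookup c nu"
      using multi_S_type[OF lam nu(1) rep[OF nu(1)] nu(2)] nu(1) by (simp add: c)
    then show ?thesis using eval[OF Par nu] by simp
  next
    case False
    have "multi_m mu M = 0" if "mu \<in> Poly_Mapping.keys c" for mu
    proof -
      have "length mu = r" using Par that by (auto simp: Par_def)
      then show ?thesis using multi_m_eq[of mu r M] False by (simp add: monom_type_def)
    qed
    then show ?thesis using multi_S_outside[OF lam False] by simp
  qed
  have kostka: "kostka lam = c"
    unfolding kostka_def r
  proof (rule the_equality)
    show "Poly_Mapping.keys c \<subseteq> Par r \<and>
        multi_S lam = (\<lambda>M. \<Sum>mu \<in> Poly_Mapping.keys c. Poly_Mapping.lookup c mu * multi_m mu M)"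
      using Par exp by blast
  next
    fix d assume d: "Poly_Mapping.keys d \<subseteq> Par r \<and>
        multi_S lam = (\<lambda>M. \<Sum>mu \<in> Poly_Mapping.keys d. Poly_Mapping.lookup d mu * multi_m mu M)"
    show "d = c"
    proof (rule poly_mapping_eqI)
      fix mu
      show "Poly_Mapping.lookup d mu = Poly_Mapping.lookup c mu"
      proof (cases "mu \<in> Par r")
        case True
        have "Poly_Mapping.lookup d mu = multi_S lam (?rep mu)"
          using eval[OF conjunct1[OF d] True rep[OF True]] fun_cong[OF conjunct2[OF d]] by metis
        with True show ?thesis by (simp add: c)
      next
        case False
        then have "mu \<notin> Poly_Mapping.keys d" using d by blast
        with False show ?thesis by (simp add: c in_keys_iff)
      qed
    qed
  qed
  show "Poly_Mapping.keys (kostka lam) = {mu. move\<^sup>*\<^sup>* lam mu}" unfolding kostka by (rule keys)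
  show "multi_S lam M = (\<Sum>mu | move\<^sup>*\<^sup>* lam mu. Poly_Mapping.lookup (kostka lam) mu * multi_m mu M)"
    unfolding kostka keys[symmetric] by (rule exp)
  show "Poly_Mapping.lookup (kostka lam) mu = multi_S lam M" if "mu \<in> Par r" "monom_type r M mu"
    unfolding kostka using multi_S_type[OF lam that(1) rep[OF that(1)] that(2)] that(1) by (simp add: c)
qed

theorem mainTheorem3:
  fixes r :: nat and lam :: "nat list list"
  assumes "lam \<in> Par r"
  shows "multi_S lam = (\<lambda>M. multi_m lam M +
           (\<Sum>mu | mu \<lhd> lam. Poly_Mapping.lookup (kostka lam) mu * multi_m mu M)) \<and>
         (\<forall>mu. mu \<lhd> lam \<longrightarrow> Poly_Mapping.lookup (kostka lam) mu \<noteq> 0)"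
proof (intro conjI ext allI impI)
  \<comment> \<open>The chains of moves from lam split into the empty one, which gives the leading
    term, and the nonempty ones, which never return to lam.\<close>
  have moves: "{mu. move\<^sup>*\<^sup>* lam mu} = insert lam {mu. mu \<lhd> lam}"
    by (auto simp: tri_less_def tranclp_into_rtranclp dest: rtranclpD)
  have fin: "finite {mu. mu \<lhd> lam}"
    using finite_moves[OF assms] unfolding moves by simp
  obtain M0 where "monom_type r M0 lam" using monom_of_type_ex[OF assms] by blast
  then have "Poly_Mapping.lookup (kostka lam) lam = 1"
    using kostka_type[OF assms assms] multi_S_leading[OF assms assms] by simp
  then show "multi_S lam M = multi_m lam M +
      (\<Sum>mu | mu \<lhd> lam. Poly_Mapping.lookup (kostka lam) mu * multi_m mu M)" for M
    unfolding multi_S_expansion[OF assms] moves using fin tri_less_irrefl by simp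
  show "Poly_Mapping.lookup (kostka lam) mu \<noteq> 0" if "mu \<lhd> lam" for mu
  proof -
    have "mu \<in> Poly_Mapping.keys (kostka lam)"
      unfolding keys_kostka[OF assms] moves using that by simp
    then show ?thesis by (simp add: in_keys_iff)
  qed
qed

end
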